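(* For every $q\in(0,1)$ there exists a constant $C<\infty$ such that $$\sup_{L,H}\gamma(L,H)\le C ,$$ where the supremum is over all natural numbers $L,H$.
   Context: Fix $q\in(0,1)$ and natural numbers $L,H$. Let $\Lambda=\{(i,h)\in\mathbb Z^2:\ i=1,\dots,L,\ h=1,\dots,H\}$ and $\Omega=\{0,1\}^\Lambda$, with elements $\alpha=(\alpha_x)_{x\in\Lambda}$ ($\alpha_x=1$: site $x$ occupied by a particle). Let $\mu$ be the product probability measure on $\Omega$ $$\mu(\alpha)=\prod_{i=1}^L\prod_{h=1}^H\frac{q^{2h\alpha_{(i,h)}}}{1+q^{2h}},$$ and for an integer $N$ let $\nu=\nu_N=\mu(\,\cdot\mid\sum_{x\in\Lambda}\alpha_x=N)$ be the conditional (canonical) measure. Write $\nu(f)$ for the expectation and $\mathrm{Var}(f)=\nu((f-\nu(f))^2)$. For $1\le i,j\le L$ and $1\le h\le H-1$ let $\alpha^{(i,h);(j,h+1)}$ be the configuration obtained from $\alpha$ by interchanging the values at $(i,h)$ and $(j,h+1)$, and set $$\nabla_{(i,h);(j,h+1)}f(\alpha)=f(\alpha^{(i,h);(j,h+1)})-f(\alpha),\qquad c_{(i,h);(j,h+1)}(\alpha)=q^{\alpha_{(i,h)}-\alpha_{(j,h+1)}} .$$ The Markov generator of the process is $$\mathcal L f(\alpha)=\frac1L\sum_{i=1}^L\sum_{j=1}^L\sum_{h=1}^{H-1}c_{(i,h);(j,h+1)}(\alpha)\,\nabla_{(i,h);(j,h+1)}f(\alpha);$$ it is self-adjoint in $L^2(\nu)$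 with Dirichlet form $$\mathcal D(f,f)=\nu(f(-\mathcal L)f)=\frac1L\sum_{i=1}^L\sum_{j=1}^L D_{ij}(f),\qquad D_{ij}(f)=\frac12\sum_{h=1}^{H-1}\nu\big[c_{(i,h);(j,h+1)}(\nabla_{(i,h);(j,h+1)}f)^2\big].$$ Define $$\gamma(L,H)=\sup_{N}\ \sup_{f\in L^2(\nu)}\ \frac{\mathrm{Var}(f)}{\mathcal D(f,f)},$$ where (using the particle–hole symmetry) the number of particles $N$ ranges from $1$ to $LH/2$, and $\nu=\nu_N$.
   Formalization: The supremum is taken over L ≥ 1 and H ≥ 2: for H = 1 there are no bonds, the Dirichlet form vanishes, and γ(L,1) is infinite for L ≥ 2 (take N = 1 and f the occupation of one site). *)

theory Defs
  imports "HOL-Analysis.Analysis"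
begin

type_synonym site = "nat \<times> nat"
type_synonym config = "site \<Rightarrow> nat"

definition Lattice :: "nat \<Rightarrow> nat \<Rightarrow> site set" where
  "Lattice L H = {1..L} \<times> {1..H}"

text \<open>Configurations are extensional functions: outside the lattice they take the fixed value
  \<^const>\<open>undefined\<close>, so that \<open>Omega L H\<close> has exactly \<open>2 ^ (L * H)\<close> elements.\<close>

definition Omega :: "nat \<Rightarrow> nat \<Rightarrow> config set" where
  "Omega L H = Lattice L H \<rightarrow>\<^sub>E {0, 1}"

definition mu_weight :: "real \<Rightarrow> nat \<Rightarrow> nat \<Rightarrow> config \<Rightarrow> real" where
  "mu_weight q L H \<alpha> = (\<Prod>i=1..L. \<Prod>h=1..H. q ^ (2 * h * \<alpha> (i, h)) / (1 + q ^ (2 * h)))"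

definition mu :: "real \<Rightarrow> nat \<Rightarrow> nat \<Rightarrow> config measure" where
  "mu q L H = point_measure (Omega L H) (\<lambda>\<alpha>. ennreal (mu_weight q L H \<alpha>))"

definition Omega_N :: "nat \<Rightarrow> nat \<Rightarrow> nat \<Rightarrow> config set" where
  "Omega_N L H N = {\<alpha> \<in> Omega L H. (\<Sum>x\<in>Lattice L H. \<alpha> x) = N}"

text \<open>\<open>uniform_measure M A\<close> is the library's conditional measure of \<open>M\<close> given the event \<open>A\<close>.\<close>

definition nu :: "real \<Rightarrow> nat \<Rightarrow> nat \<Rightarrow> nat \<Rightarrow> config measure" where
  "nu q L H N = uniform_measure (mu q L H) (Omega_N L H N)"

definition Var :: "config measure \<Rightarrow> (config \<Rightarrow> real) \<Rightarrow> real" where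
  "Var M f = (LINT \<alpha>|M. (f \<alpha> - (LINT \<beta>|M. f \<beta>))\<^sup>2)"

definition exchange :: "site \<Rightarrow> site \<Rightarrow> config \<Rightarrow> config" where
  "exchange x y \<alpha> = \<alpha>(x := \<alpha> y, y := \<alpha> x)"

definition nabla :: "site \<Rightarrow> site \<Rightarrow> (config \<Rightarrow> real) \<Rightarrow> config \<Rightarrow> real" where
  "nabla x y f \<alpha> = f (exchange x y \<alpha>) - f \<alpha>"

definition rate :: "real \<Rightarrow> site \<Rightarrow> site \<Rightarrow> config \<Rightarrow> real" where
  "rate q x y \<alpha> = q powi (int (\<alpha> x) - int (\<alpha> y))"

definition generator :: "real \<Rightarrow> nat \<Rightarrow> nat \<Rightarrow> (config \<Rightarrow> real) \<Rightarrow> config \<Rightarrow> real" where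
  "generator q L H f \<alpha> = (1 / real L) *
     (\<Sum>i=1..L. \<Sum>j=1..L. \<Sum>h=1..H-1.
        rate q (i, h) (j, h + 1) \<alpha> * nabla (i, h) (j, h + 1) f \<alpha>)"

definition Dirichlet :: "real \<Rightarrow> nat \<Rightarrow> nat \<Rightarrow> nat \<Rightarrow> (config \<Rightarrow> real) \<Rightarrow> real" where
  "Dirichlet q L H N f = (LINT \<alpha>|nu q L H N. f \<alpha> * (- generator q L H f \<alpha>))"

definition D_cols :: "real \<Rightarrow> nat \<Rightarrow> nat \<Rightarrow> nat \<Rightarrow> nat \<Rightarrow> nat \<Rightarrow> (config \<Rightarrow> real) \<Rightarrow> real" where
  "D_cols q L H N i j f = (1 / 2) *
     (\<Sum>h=1..H-1. LINT \<alpha>|nu q L H N.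
        rate q (i, h) (j, h + 1) \<alpha> * (nabla (i, h) (j, h + 1) f \<alpha>)\<^sup>2)"

text \<open>The state space is finite, so every \<open>f\<close> is square integrable and the inner supremum runs over
  all real functions. In \<^typ>\<open>ereal\<close> a positive number divided by \<open>0\<close> is \<open>\<infinity>\<close>, whereas
  \<open>0 / 0 = 0\<close>. Hence constant functions do not contribute, while a non-constant function with
  vanishing Dirichlet form would make \<open>gamma q L H\<close> infinite. This is what happens for \<open>H = 1\<close>
  and \<open>L \<ge> 2\<close>, where there are no bonds; the process is only meaningful for \<open>H \<ge> 2\<close>.\<close>

definition gamma :: "real \<Rightarrow> nat \<Rightarrow> nat \<Rightarrow> ereal" where
  "gamma q L H = (SUP N \<in> {1..L * H div 2}. SUP f.
     ereal (Var (nu q L H N) f) / ereal (Dirichlet q L H N f))"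

text \<open>Consistency of the definitions: \<open>mu\<close> and \<open>nu\<close> are probability measures, \<open>nu\<close> has the
  expected finite-sum expectation, and \<open>Dirichlet\<close> is the average of the \<open>D_cols\<close>.\<close>

lemma finite_Lattice: "finite (Lattice L H)"
  by (simp add: Lattice_def)

lemma finite_Omega: "finite (Omega L H)"
  by (simp add: Omega_def finite_Lattice finite_PiE)

lemma mu_weight_alt:
  "mu_weight q L H \<alpha> = (\<Prod>x\<in>Lattice L H. q ^ (2 * snd x * \<alpha> x) / (1 + q ^ (2 * snd x)))"
  unfolding mu_weight_def Lattice_def prod.cartesian_product
  by (intro prod.cong) auto

lemma mu_weight_pos: "0 < q \<Longrightarrow> 0 < mu_weight q L H \<alpha>"
  unfolding mu_weight_def by (intro prod_pos ballI divide_pos_pos add_pos_pos) auto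

lemma sum_mu_weight:
  assumes "0 < q" shows "(\<Sum>\<alpha>\<in>Omega L H. mu_weight q L H \<alpha>) = 1"
proof -
  have "(\<Sum>\<alpha>\<in>Omega L H. mu_weight q L H \<alpha>) =
      (\<Prod>x\<in>Lattice L H. \<Sum>a\<in>{0, 1::nat}. q ^ (2 * snd x * a) / (1 + q ^ (2 * snd x)))"
    unfolding Omega_def mu_weight_alt
    by (subst prod_sum_PiE) (auto simp: finite_Lattice)
  also have "\<dots> = (\<Prod>x\<in>Lattice L H. 1)"
  proof (intro prod.cong refl)
    fix x :: site
    have "1 + q ^ (2 * snd x) > 0" using assms by (simp add: add_pos_pos)
    then show "(\<Sum>a\<in>{0, 1::nat}. q ^ (2 * snd x * a) / (1 + q ^ (2 * snd x))) = 1"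
      by (simp add: add_divide_distrib[symmetric])
  qed
  finally show ?thesis by simp
qed

lemma Omega_N_subset: "Omega_N L H N \<subseteq> Omega L H"
  by (auto simp: Omega_N_def)

lemma emeasure_mu:
  assumes "0 < q" "A \<subseteq> Omega L H"
  shows "emeasure (mu q L H) A = ennreal (\<Sum>\<alpha>\<in>A. mu_weight q L H \<alpha>)"
  unfolding mu_def using assms
  by (subst emeasure_point_measure_finite)
     (auto simp: finite_Omega sum_ennreal mu_weight_pos[THEN less_imp_le])

lemma prob_space_mu:
  assumes "0 < q" shows "emeasure (mu q L H) (space (mu q L H)) = 1"
proof -
  have "space (mu q L H) = Omega L H" by (simp add: mu_def space_point_measure)
  then show ?thesis using emeasure_mu[OF assms, of "Omega L H"] sum_mu_weight[OF assms] by simp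
qed

lemma Omega_N_nonempty:
  assumes "N \<le> L * H" shows "Omega_N L H N \<noteq> {}"
proof -
  have "card (Lattice L H) = L * H" by (simp add: Lattice_def)
  then obtain B where B: "B \<subseteq> Lattice L H" "card B = N"
    using assms obtain_subset_with_card_n by metis
  have "(\<Sum>x\<in>Lattice L H. if x \<in> B then 1 else 0 :: nat) = card B"
    using B by (simp add: finite_Lattice sum.If_cases Int_absorb1)
  then have "restrict (\<lambda>x. if x \<in> B then 1 else 0) (Lattice L H) \<in> Omega_N L H N"
    using B by (auto simp: Omega_N_def Omega_def)
  then show ?thesis by blast
qed

lemma sum_mu_weight_pos:
  assumes "0 < q" "N \<le> L * H" shows "0 < (\<Sum>\<alpha>\<in>Omega_N L H N. mu_weight q L H \<alpha>)"
  using assms Omega_N_nonempty finite_subset[OF Omega_N_subset finite_Omega]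
  by (intro sum_pos mu_weight_pos) auto

lemma nu_alt:
  assumes q: "0 < q" and N: "N \<le> L * H"
  shows "nu q L H N = point_measure (Omega L H) (\<lambda>\<alpha>. ennreal
    (mu_weight q L H \<alpha> * indicator (Omega_N L H N) \<alpha> / (\<Sum>\<beta>\<in>Omega_N L H N. mu_weight q L H \<beta>)))"
proof -
  define Z where "Z = (\<Sum>\<beta>\<in>Omega_N L H N. mu_weight q L H \<beta>)"
  have Z: "Z > 0" unfolding Z_def by (rule sum_mu_weight_pos[OF q N])
  have "nu q L H N = density (mu q L H) (\<lambda>\<alpha>. indicator (Omega_N L H N) \<alpha> / ennreal Z)"
    by (simp add: nu_def uniform_measure_def emeasure_mu[OF q Omega_N_subset] Z_def)
  also have "\<dots> = density (count_space (Omega L H))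
      (\<lambda>\<alpha>. ennreal (mu_weight q L H \<alpha>) * (indicator (Omega_N L H N) \<alpha> / ennreal Z))"
    unfolding mu_def point_measure_def by (subst density_density_eq) auto
  also have "\<dots> = density (count_space (Omega L H))
      (\<lambda>\<alpha>. ennreal (mu_weight q L H \<alpha> * indicator (Omega_N L H N) \<alpha> / Z))"
  proof (intro density_cong AE_I2)
    fix \<alpha>
    show "ennreal (mu_weight q L H \<alpha>) * (indicator (Omega_N L H N) \<alpha> / ennreal Z) =
      ennreal (mu_weight q L H \<alpha> * indicator (Omega_N L H N) \<alpha> / Z)"
      using Z mu_weight_pos[OF q, of L H \<alpha>]
      by (cases "\<alpha> \<in> Omega_N L H N")
         (auto simp: divide_ennreal[symmetric] ennreal_times_divide)
  qed auto
  finally show ?thesis by (simp add: point_measure_def Z_def)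
qed

lemma nu_expectation:
  fixes f :: "config \<Rightarrow> real"
  assumes q: "0 < q" and N: "N \<le> L * H"
  shows "(LINT \<alpha>|nu q L H N. f \<alpha>) =
    (\<Sum>\<alpha>\<in>Omega_N L H N. mu_weight q L H \<alpha> * f \<alpha>) / (\<Sum>\<alpha>\<in>Omega_N L H N. mu_weight q L H \<alpha>)"
proof -
  define Z where "Z = (\<Sum>\<beta>\<in>Omega_N L H N. mu_weight q L H \<beta>)"
  have Z: "Z > 0" unfolding Z_def by (rule sum_mu_weight_pos[OF q N])
  have "(LINT \<alpha>|nu q L H N. f \<alpha>) =
      (\<Sum>\<alpha>\<in>Omega L H. (mu_weight q L H \<alpha> * indicator (Omega_N L H N) \<alpha> / Z) * f \<alpha>)"
    unfolding nu_alt[OF q N] Z_def[symmetric] using Z mu_weight_pos[OF q]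
    by (subst lebesgue_integral_point_measure_finite)
       (auto simp: finite_Omega less_imp_le)
  also have "\<dots> = (\<Sum>\<alpha>\<in>Omega_N L H N. (mu_weight q L H \<alpha> / Z) * f \<alpha>)"
    by (rule sum.mono_neutral_cong_right) (use Omega_N_subset finite_Omega in auto)
  finally show ?thesis by (simp add: Z_def sum_divide_distrib)
qed

lemma prob_space_nu:
  assumes q: "0 < q" and N: "N \<le> L * H"
  shows "emeasure (nu q L H N) (space (nu q L H N)) = 1"
proof -
  define Z where "Z = (\<Sum>\<beta>\<in>Omega_N L H N. mu_weight q L H \<beta>)"
  have Z: "Z > 0" unfolding Z_def by (rule sum_mu_weight_pos[OF q N])
  have "emeasure (nu q L H N) (space (nu q L H N)) =
      ennreal (\<Sum>\<alpha>\<in>Omega L H. mu_weight q L H \<alpha> * indicator (Omega_N L H N) \<alpha> / Z)"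
    unfolding nu_alt[OF q N] Z_def[symmetric] space_point_measure
    using Z mu_weight_pos[OF q, THEN less_imp_le] finite_Omega
    by (subst emeasure_point_measure_finite) (auto simp: sum_ennreal)
  also have "(\<Sum>\<alpha>\<in>Omega L H. mu_weight q L H \<alpha> * indicator (Omega_N L H N) \<alpha> / Z) =
      (\<Sum>\<alpha>\<in>Omega_N L H N. mu_weight q L H \<alpha> / Z)"
    by (rule sum.mono_neutral_cong_right) (use Omega_N_subset finite_Omega in auto)
  also have "\<dots> = 1" using Z by (simp add: sum_divide_distrib[symmetric] Z_def)
  finally show ?thesis by simp
qed

lemma exchange_exchange: "exchange x y (exchange x y \<alpha>) = \<alpha>"
  by (auto simp: exchange_def fun_eq_iff)

lemma exchange_Omega_N:
  assumes "x \<in> Lattice L H" "y \<in> Lattice L H" "\<alpha> \<in> Omega_N L H N"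
  shows "exchange x y \<alpha> \<in> Omega_N L H N"
proof -
  have e: "exchange x y \<alpha> = \<alpha> \<circ> Transposition.transpose x y"
    by (auto simp: exchange_def fun_eq_iff Transposition.transpose_def)
  have "bij_betw (Transposition.transpose x y) (Lattice L H) (Lattice L H)"
    using assms by (intro bij_betwI[where g = "Transposition.transpose x y"] funcsetI)
      (simp_all add: Transposition.transpose_def)
  then have "(\<Sum>z\<in>Lattice L H. exchange x y \<alpha> z) = (\<Sum>z\<in>Lattice L H. \<alpha> z)"
    unfolding e o_def by (rule sum.reindex_bij_betw)
  moreover have "exchange x y \<alpha> \<in> Omega L H"
    using assms by (auto simp: Omega_N_def Omega_def exchange_def PiE_iff extensional_def)
  ultimately show ?thesis using assms by (simp add: Omega_N_def)
qed

lemma detailed_balance: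
  assumes q: "0 < q" and x: "(i, h) \<in> Lattice L H" and y: "(j, h + 1) \<in> Lattice L H"
    and \<alpha>: "\<alpha> \<in> Omega_N L H N"
  shows "mu_weight q L H (exchange (i, h) (j, h + 1) \<alpha>) *
      rate q (i, h) (j, h + 1) (exchange (i, h) (j, h + 1) \<alpha>) =
    mu_weight q L H \<alpha> * rate q (i, h) (j, h + 1) \<alpha>"
proof -
  let ?x = "(i, h)" and ?y = "(j, h + 1)"
  let ?g = "\<lambda>\<alpha> z. q ^ (2 * snd z * \<alpha> z) / (1 + q ^ (2 * snd z))"
  let ?R = "Lattice L H - {?x} - {?y}"
  have split: "mu_weight q L H \<beta> = ?g \<beta> ?x * (?g \<beta> ?y * (\<Prod>z\<in>?R. ?g \<beta> z))" for \<beta>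
    unfolding mu_weight_alt
    by (subst prod.remove[OF finite_Lattice x], subst prod.remove[of _ ?y])
       (use y finite_Lattice in auto)
  have R: "(\<Prod>z\<in>?R. ?g (exchange ?x ?y \<alpha>) z) = (\<Prod>z\<in>?R. ?g \<alpha> z)"
    by (rule prod.cong) (auto simp: exchange_def)
  have ax: "\<alpha> ?x \<in> {0, 1}" and ay: "\<alpha> ?y \<in> {0, 1}"
    using \<alpha> x y unfolding Omega_N_def Omega_def by (auto simp: PiE_iff)
  have ex: "exchange ?x ?y \<alpha> ?x = \<alpha> ?y" "exchange ?x ?y \<alpha> ?y = \<alpha> ?x"
    by (auto simp: exchange_def)
  have "?g (exchange ?x ?y \<alpha>) ?x * ?g (exchange ?x ?y \<alpha>) ?y * rate q ?x ?y (exchange ?x ?y \<alpha>) =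
      ?g \<alpha> ?x * ?g \<alpha> ?y * rate q ?x ?y \<alpha>"
    unfolding rate_def ex using ax ay q
    by (auto simp: field_simps power_int_minus power2_eq_square)
  moreover have "a * (b * r) * s = a' * (b' * r) * s'" if "a * b * s = a' * b' * s'"
    for a b r s a' b' s' :: real
    using that by algebra
  ultimately show ?thesis
    unfolding split R by blast
qed

lemma Dirichlet_bond:
  assumes q: "0 < q" and N: "N \<le> L * H"
    and x: "(i, h) \<in> Lattice L H" and y: "(j, h + 1) \<in> Lattice L H"
  shows "(LINT \<alpha>|nu q L H N. f \<alpha> * (- (rate q (i, h) (j, h + 1) \<alpha> * nabla (i, h) (j, h + 1) f \<alpha>))) =
    (1 / 2) * (LINT \<alpha>|nu q L H N. rate q (i, h) (j, h + 1) \<alpha> * (nabla (i, h) (j, h + 1) f \<alpha>)\<^sup>2)"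
proof -
  let ?e = "exchange (i, h) (j, h + 1)" and ?A = "Omega_N L H N"
  let ?k = "\<lambda>\<alpha>. mu_weight q L H \<alpha> * rate q (i, h) (j, h + 1) \<alpha>"
  let ?n = "nabla (i, h) (j, h + 1) f"
  have bij: "bij_betw ?e ?A ?A"
    by (rule bij_betwI[where g = ?e]) (simp_all only: exchange_exchange exchange_Omega_N[OF x y] Pi_I)
  have "(\<Sum>\<alpha>\<in>?A. ?k \<alpha> * (f \<alpha> * - ?n \<alpha>)) = (\<Sum>\<alpha>\<in>?A. ?k (?e \<alpha>) * (f (?e \<alpha>) * - ?n (?e \<alpha>)))"
    by (rule sum.reindex_bij_betw[OF bij, symmetric])
  also have "\<dots> = (\<Sum>\<alpha>\<in>?A. ?k \<alpha> * (f (?e \<alpha>) * ?n \<alpha>))"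
    by (rule sum.cong)
       (simp_all only: detailed_balance[OF q x y] nabla_def exchange_exchange minus_diff_eq)
  finally have "2 * (\<Sum>\<alpha>\<in>?A. ?k \<alpha> * (f \<alpha> * - ?n \<alpha>)) =
      (\<Sum>\<alpha>\<in>?A. ?k \<alpha> * (f \<alpha> * - ?n \<alpha>)) + (\<Sum>\<alpha>\<in>?A. ?k \<alpha> * (f (?e \<alpha>) * ?n \<alpha>))"
    by simp
  also have "\<dots> = (\<Sum>\<alpha>\<in>?A. ?k \<alpha> * (?n \<alpha>)\<^sup>2)"
    unfolding sum.distrib[symmetric]
    by (rule sum.cong) (simp_all add: nabla_def power2_eq_square algebra_simps)
  finally have *: "(\<Sum>\<alpha>\<in>?A. ?k \<alpha> * (f \<alpha> * - ?n \<alpha>)) = (1 / 2) * (\<Sum>\<alpha>\<in>?A. ?k \<alpha> * (?n \<alpha>)\<^sup>2)"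
    by simp
  have 1: "(\<Sum>\<alpha>\<in>?A. mu_weight q L H \<alpha> * (f \<alpha> * (- (rate q (i, h) (j, h + 1) \<alpha> * ?n \<alpha>)))) =
      (\<Sum>\<alpha>\<in>?A. ?k \<alpha> * (f \<alpha> * - ?n \<alpha>))"
    by (rule sum.cong) (simp_all add: mult_ac)
  have 2: "(\<Sum>\<alpha>\<in>?A. mu_weight q L H \<alpha> * (rate q (i, h) (j, h + 1) \<alpha> * (?n \<alpha>)\<^sup>2)) =
      (\<Sum>\<alpha>\<in>?A. ?k \<alpha> * (?n \<alpha>)\<^sup>2)"
    by (rule sum.cong) (simp_all add: mult_ac)
  show ?thesis
    unfolding nu_expectation[OF q N] 1 2 * by simp
qed

lemma nu_integrable:
  fixes f :: "config \<Rightarrow> real"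
  assumes "0 < q" "N \<le> L * H" shows "integrable (nu q L H N) f"
  unfolding nu_alt[OF assms] by (rule integrable_point_measure_finite[OF finite_Omega])

lemma Dirichlet_eq_D_cols:
  assumes q: "0 < q" and N: "N \<le> L * H"
  shows "Dirichlet q L H N f = (1 / real L) * (\<Sum>i=1..L. \<Sum>j=1..L. D_cols q L H N i j f)"
proof -
  let ?t = "\<lambda>i j h \<alpha>. f \<alpha> * (- (rate q (i, h) (j, h + 1) \<alpha> * nabla (i, h) (j, h + 1) f \<alpha>))"
  have "Dirichlet q L H N f =
      (LINT \<alpha>|nu q L H N. (1 / real L) * (\<Sum>i=1..L. \<Sum>j=1..L. \<Sum>h=1..H-1. ?t i j h \<alpha>))"
    unfolding Dirichlet_def generator_def
    by (simp add: sum_distrib_left sum_negf mult_ac)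
  also have "\<dots> = (1 / real L) * (\<Sum>i=1..L. \<Sum>j=1..L. \<Sum>h=1..H-1. LINT \<alpha>|nu q L H N. ?t i j h \<alpha>)"
    using nu_integrable[OF q N] by (simp add: Bochner_Integration.integral_sum)
  also have "\<dots> = (1 / real L) * (\<Sum>i=1..L. \<Sum>j=1..L. D_cols q L H N i j f)"
    unfolding D_cols_def sum_distrib_left
  proof (intro sum.cong refl, goal_cases)
    case (1 i j h)
    then show ?case
      by (subst Dirichlet_bond[OF q N]) (auto simp: Lattice_def)
  qed
  finally show ?thesis .
qed

end

theory Submission
  imports Defs "HOL-Real_Asymp.Real_Asymp"
begin

text \<open>Replace the process by a reversible one with moves between all pairs of sites: a particle at
  \<open>x\<close> jumps to a hole at \<open>y\<close> at rate \<open>t d\<close> if this lowers the energy and \<open>t d * q ^ (2 * d)\<close>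
  otherwise, where \<open>d\<close> is the difference of the heights and \<open>t d = (1 + e * d) ^ -4\<close> for a small
  \<open>e\<close>. Writing \<open>G\<close> for the negative generator, expand \<open>\<langle>G f, G f\<rangle>\<close> over pairs of bonds. Disjoint
  bonds contribute squares of mixed differences. Bonds sharing a site are grouped into triangles,
  and on a triangle with one or two particles the cross terms form an explicit quadratic form in two
  variables. Since \<open>t\<close> varies slowly, the negative parts of these forms are absorbed, for every
  configuration and not only on average, by the positive ones. What remains is
  \<open>\<langle>G f, G f\<rangle> \<ge> c * L * B f\<close>, where \<open>B f\<close> is the sum of the contributions of bonds between
  neighbouring layers. Moving particles step by step through intermediate layers gives
  \<open>\<langle>f, G f\<rangle> \<le> C * B f\<close>, because \<open>d\<^sup>2 * t d\<close> is summable. Hence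
  \<open>\<langle>G f, G f\<rangle> \<ge> c' * L * \<langle>f, G f\<rangle>\<close>, which bounds the variance of \<open>f\<close> by a multiple of
  \<open>\<langle>f, G f\<rangle> / L\<close>, and therefore of \<open>B f / L\<close>, which is the Dirichlet form up to a constant.\<close>

section \<open>Quadratic forms on a triangle\<close>

text \<open>The additional bonds are there to close triangles. With bonds between neighbouring
  layers only, three sites in consecutive layers contribute, up to a positive factor, the bare
  product \<open>- a * b\<close> of two successive differences, with no square to absorb it. With
  equal strengths on all pairs every triangle form is nonnegative, but the comparison with
  neighbouring layers would lose a constant growing with \<open>H\<close>, as bonds of length
  \<open>d\<close> cost a factor \<open>d\<^sup>2\<close>. So \<open>t\<close> must decay, fast
  enough for \<open>d\<^sup>2 * t d\<close> to be summable and so slowly that its relative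
  differences are of order \<open>e\<close>; a fourth power does both. The factor \<open>L\<close>
  comes from third sites lying in the layer of an end of the bond, each of which contributes
  \<open>q ^ (2 * d) * (t d)\<^sup>2\<close>. For long bonds this is exponentially small compared
  with the losses caused by the decay, which are of order \<open>(t d)\<^sup>2\<close>. Long bonds
  are paid for instead by triangles whose third site lies strictly between the ends, one layer away
  from one of them.\<close>

lemma young_bound:
  fixes k :: real assumes "0 < k"
  shows "2 * X * \<bar>a * b\<bar> \<le> k * b\<^sup>2 + X\<^sup>2 / k * a\<^sup>2"
proof -
  have "0 \<le> (k * \<bar>b\<bar> - X * \<bar>a\<bar>)\<^sup>2 / k" using assms by simp
  also have "(k * \<bar>b\<bar> - X * \<bar>a\<bar>)\<^sup>2 = k * (k * b\<^sup>2) + X\<^sup>2 * a\<^sup>2 - k * (2 * X * (\<bar>a\<bar> * \<bar>b\<bar>))"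
    by (simp add: power2_diff power_mult_distrib) (simp add: power2_eq_square)
  also have "\<dots> / k = k * b\<^sup>2 + X\<^sup>2 / k * a\<^sup>2 - 2 * X * \<bar>a * b\<bar>"
    using assms by (simp add: diff_divide_distrib add_divide_distrib abs_mult)
  finally show ?thesis by simp
qed

text \<open>The forms below arise as follows. Let three states have weights \<open>1\<close>, \<open>p\<close>, \<open>p * r\<close> and let \<open>f\<close>
  drop by \<open>a\<close> from the first to the second and by \<open>b\<close> from the second to the third. If the bonds
  have strengths \<open>t\<^sub>1\<^sub>2\<close>, \<open>t\<^sub>2\<^sub>3\<close>, \<open>t\<^sub>1\<^sub>3\<close>, then the cross terms of the three bonds add up to \<open>p * r\<close> times
  the form with \<open>P = p * t\<^sub>1\<^sub>2 * t\<^sub>1\<^sub>3\<close>, \<open>X = t\<^sub>2\<^sub>3 * (t\<^sub>1\<^sub>2 - t\<^sub>1\<^sub>3)\<close> and \<open>Q = t\<^sub>2\<^sub>3 * t\<^sub>1\<^sub>3\<close>.\<close>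

lemma triangle_form_lower:
  fixes P X Q k a b :: real
  assumes "0 \<le> P" "0 \<le> X" "0 \<le> Q" "P \<le> X + 2 * Q" "0 < k"
  shows "- k * b\<^sup>2 - X\<^sup>2 / k * a\<^sup>2 \<le> 2 * (P * (a * (a + b)) - X * (a * b) + Q * b\<^sup>2)"
proof -
  have "- 2 * X * \<bar>a * b\<bar> \<le> 2 * (P * (a * (a + b)) - X * (a * b) + Q * b\<^sup>2)"
  \<comment> \<open>For \<open>P \<le> X\<close> the mixed coefficient \<open>P - X\<close> lies
    between \<open>- X\<close> and \<open>0\<close>. Otherwise the form is a combination of
    \<open>a\<^sup>2\<close>, \<open>b\<^sup>2\<close> and \<open>(a + b)\<^sup>2\<close> with
    nonnegative coefficients; the one of \<open>b\<^sup>2\<close> is where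
    \<open>P \<le> X + 2 * Q\<close> enters.\<close>
  proof (cases "P \<le> X")
    case True
    have Pa: "0 \<le> P * a\<^sup>2" "0 \<le> Q * b\<^sup>2" using assms by auto
    have e: "P * (a * (a + b)) - X * (a * b) + Q * b\<^sup>2 = P * a\<^sup>2 + Q * b\<^sup>2 + (P - X) * (a * b)"
      by (simp add: algebra_simps power2_eq_square)
    have "- X * \<bar>a * b\<bar> \<le> (P - X) * (a * b)"
    proof (cases "0 \<le> a * b")
      case True
      then have "0 \<le> P * (a * b)" using assms by simp
      then show ?thesis using True by (simp add: algebra_simps)
    next
      case False
      then have "0 \<le> (P - X) * (a * b)" using \<open>P \<le> X\<close> by (intro mult_nonpos_nonpos) auto
      moreover have "- X * \<bar>a * b\<bar> \<le> 0" using assms by (simp add: mult_nonneg_nonneg)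
      ultimately show ?thesis by linarith
    qed
    then show ?thesis using Pa unfolding e by simp
  next
    case False
    have "2 * (P * (a * (a + b)) - X * (a * b) + Q * b\<^sup>2)
        = (P + X) * a\<^sup>2 + (X + 2 * Q - P) * b\<^sup>2 + (P - X) * (a + b)\<^sup>2"
      by (simp add: algebra_simps power2_eq_square)
    moreover have "0 \<le> (P + X) * a\<^sup>2" "0 \<le> (X + 2 * Q - P) * b\<^sup>2" "0 \<le> (P - X) * (a + b)\<^sup>2"
      using assms False by auto
    moreover have "- 2 * X * \<bar>a * b\<bar> \<le> 0" using assms by (simp add: mult_nonneg_nonneg)
    ultimately show ?thesis by linarith
  qed
  then show ?thesis using young_bound[OF assms(5), of X a b] by linarith
qed

lemma square_sum_young:
  fixes d :: real assumes "0 < d"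
  shows "(a + b)\<^sup>2 \<le> (1 + d) * a\<^sup>2 + (1 + 1 / d) * b\<^sup>2"
proof -
  have "2 * 1 * \<bar>b * a\<bar> \<le> d * a\<^sup>2 + 1\<^sup>2 / d * b\<^sup>2" by (rule young_bound[OF assms])
  moreover have "2 * (a * b) \<le> 2 * 1 * \<bar>b * a\<bar>" by (simp add: mult.commute)
  ultimately have "2 * (a * b) \<le> d * a\<^sup>2 + 1 / d * b\<^sup>2" by simp
  then show ?thesis by (simp add: power2_sum algebra_simps)
qed

text \<open>Completing the square in \<open>P * (a * (a + b))\<close> costs
  \<open>Q * b\<^sup>2 / 4\<close>, so \<open>3 / 2 * Q\<close> of the coefficient
  \<open>2 * Q\<close> of \<open>b\<^sup>2\<close> is free and buys
  \<open>g * (a + b)\<^sup>2\<close>. The free parameter \<open>d\<close> keeps the price on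
  \<open>a\<^sup>2\<close> close to \<open>g\<close>. This serves the case where the bond between
  the two lighter states has length one.\<close>

lemma triangle_form_gain_light:
  fixes P X Q k a b g d :: real
  assumes "0 \<le> P" "0 \<le> X" "P \<le> Q" "0 < k" "0 < d" "0 \<le> g" "g * (1 + 1 / d) \<le> 3 / 2 * Q"
  shows "g * (a + b)\<^sup>2 - k * b\<^sup>2 - (X\<^sup>2 / k + g * (1 + d)) * a\<^sup>2
    \<le> 2 * (P * (a * (a + b)) - X * (a * b) + Q * b\<^sup>2)"
proof -
  have "0 \<le> P * (a + b / 2)\<^sup>2" using assms by simp
  moreover have "P * b\<^sup>2 \<le> Q * b\<^sup>2" using assms by (intro mult_right_mono) auto
  moreover have "P * (a + b / 2)\<^sup>2 = P * (a * (a + b)) + P * b\<^sup>2 / 4"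
    by (simp add: field_simps power2_eq_square)
  ultimately have 1: "- (Q * b\<^sup>2) / 4 \<le> P * (a * (a + b))" by simp
  have 2: "g * (a + b)\<^sup>2 \<le> g * ((1 + d) * a\<^sup>2 + (1 + 1 / d) * b\<^sup>2)"
    by (intro mult_left_mono square_sum_young assms)
  have 3: "g * (1 + 1 / d) * b\<^sup>2 \<le> 3 / 2 * Q * b\<^sup>2" using assms by (intro mult_right_mono) auto
  have 4: "2 * X * \<bar>a * b\<bar> \<le> k * b\<^sup>2 + X\<^sup>2 / k * a\<^sup>2" by (rule young_bound[OF assms(4)])
  have 5: "X * (a * b) \<le> X * \<bar>a * b\<bar>" using assms by (intro mult_left_mono) auto
  have 6: "g * ((1 + d) * a\<^sup>2 + (1 + 1 / d) * b\<^sup>2) = g * (1 + d) * a\<^sup>2 + g * (1 + 1 / d) * b\<^sup>2"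
    "(X\<^sup>2 / k + g * (1 + d)) * a\<^sup>2 = X\<^sup>2 / k * a\<^sup>2 + g * (1 + d) * a\<^sup>2"
    by (simp_all only: distrib_left distrib_right mult.assoc)
  have 7: "3 / 2 * Q * b\<^sup>2 = 3 / 2 * (Q * b\<^sup>2)" "2 * X * \<bar>a * b\<bar> = 2 * (X * \<bar>a * b\<bar>)" by simp_all
  have arith: "gc - kb - (Xa + ga) \<le> 2 * (PA - XA + QB)"
    if "- QB / 4 \<le> PA" "gc \<le> ga + gb" "gb \<le> 3 / 2 * QB" "2 * XZ \<le> kb + Xa" "XA \<le> XZ"
    for gc kb Xa ga PA XA QB gb XZ :: real using that by (simp add: algebra_simps)
  show ?thesis using 1 2 3 4 5 unfolding 6 7 by (rule arith)
qed

text \<open>A convex combination, with weight \<open>u\<close>, of two bounds: the one without gain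
  from \<open>triangle_form_lower\<close>, and one that gains \<open>g * (a + b)\<^sup>2\<close> at
  the price \<open>1 / Q + 2\<close> on \<open>a\<^sup>2\<close>. The price may be large, but a
  small \<open>u\<close> scales it down. This serves the case where the bond between the two heavier
  states has length one, so that the price falls on a unit bond.\<close>

lemma triangle_form_gain_heavy:
  fixes P X Q k a b g u :: real
  assumes "0 \<le> P" "0 \<le> X" "P \<le> X + 2 * Q" "0 < k" "P \<le> 1" "X \<le> 1" "0 < Q"
    "0 \<le> u" "u \<le> 1" "0 \<le> g" "2 * g \<le> Q" "g \<le> 1"
  shows "u * g * (a + b)\<^sup>2 - k * b\<^sup>2 - (X\<^sup>2 / k + u * (1 / Q + 2)) * a\<^sup>2
    \<le> 2 * (P * (a * (a + b)) - X * (a * b) + Q * b\<^sup>2)" (is "_ \<le> ?J")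
proof -
  have J1: "- k * b\<^sup>2 - X\<^sup>2 / k * a\<^sup>2 \<le> ?J"
    using assms by (intro triangle_form_lower) auto
  have "(X - P) * (a * b) \<le> \<bar>X - P\<bar> * \<bar>a * b\<bar>" by (metis abs_ge_self abs_mult)
  also have "\<dots> \<le> 1 * \<bar>a * b\<bar>" using assms by (intro mult_right_mono) auto
  finally have "(X - P) * (a * b) \<le> \<bar>a * b\<bar>" by simp
  moreover have "2 * 1 * \<bar>a * b\<bar> \<le> Q * b\<^sup>2 + 1\<^sup>2 / Q * a\<^sup>2" by (rule young_bound) (use assms in auto)
  moreover have "0 \<le> P * a\<^sup>2" using assms by simp
  moreover have "?J = 2 * (P * a\<^sup>2 - (X - P) * (a * b) + Q * b\<^sup>2)"
    by (simp add: algebra_simps power2_eq_square)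
  ultimately have "Q * b\<^sup>2 - 1 / Q * a\<^sup>2 \<le> ?J" by simp
  moreover have "(a + b)\<^sup>2 \<le> 2 * a\<^sup>2 + 2 * b\<^sup>2" using square_sum_young[of 1 a b] by simp
  then have "g * (a + b)\<^sup>2 \<le> g * (2 * a\<^sup>2 + 2 * b\<^sup>2)" using assms by (intro mult_left_mono) auto
  moreover have "2 * g * b\<^sup>2 \<le> Q * b\<^sup>2" using assms by (intro mult_right_mono) auto
  moreover have "g * a\<^sup>2 \<le> 1 * a\<^sup>2" using assms by (intro mult_right_mono) auto
  ultimately have J2: "g * (a + b)\<^sup>2 - (1 / Q + 2) * a\<^sup>2 \<le> ?J" by (simp add: algebra_simps)
  define Y where "Y = k * b\<^sup>2 + X\<^sup>2 / k * a\<^sup>2"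
  define J where "J = ?J"
  have Y: "0 \<le> Y" using assms by (simp add: Y_def)
  have "(1 - u) * (- Y) \<le> (1 - u) * J"
    using J1 assms unfolding Y_def J_def by (intro mult_left_mono) auto
  moreover have "u * (g * (a + b)\<^sup>2 - (1 / Q + 2) * a\<^sup>2) \<le> u * J"
    using J2 assms unfolding J_def by (intro mult_left_mono) auto
  moreover have "(1 - u) * J + u * J = J" "(1 - u) * (- Y) = u * Y - Y" by (simp_all add: algebra_simps)
  moreover have "0 \<le> u * Y" using assms Y by simp
  moreover have "u * g * (a + b)\<^sup>2 - k * b\<^sup>2 - (X\<^sup>2 / k + u * (1 / Q + 2)) * a\<^sup>2
    = u * (g * (a + b)\<^sup>2 - (1 / Q + 2) * a\<^sup>2) - Y"
    unfolding Y_def by (simp only: distrib_right right_diff_distrib mult.assoc)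
  ultimately show ?thesis unfolding J_def[symmetric] by linarith
qed

section \<open>Radial weights\<close>

definition decay :: "real \<Rightarrow> nat \<Rightarrow> real" where
  "decay e d = 1 / (1 + e * real d) ^ 4"

lemma decay_0 [simp]: "decay e 0 = 1"
  by (simp add: decay_def)

lemma decay_pos:
  assumes "0 \<le> e" shows "0 < decay e d"
proof -
  have "0 < 1 + e * real d" using assms by (simp add: add_pos_nonneg)
  then show ?thesis by (simp add: decay_def)
qed

lemma decay_antimono: "0 \<le> e \<Longrightarrow> m \<le> n \<Longrightarrow> decay e n \<le> decay e m"
  unfolding decay_def by (intro divide_left_mono power_mono add_left_mono mult_left_mono mult_pos_pos zero_less_power)
    (auto simp: add_pos_nonneg)

lemma decay_le_1: "0 \<le> e \<Longrightarrow> decay e d \<le> 1"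
  using decay_antimono[of e 0 d] by simp

lemma inverse_decay_le: "0 \<le> e \<Longrightarrow> e \<le> 1 \<Longrightarrow> n \<le> m \<Longrightarrow> 1 / decay e n \<le> (real m + 1) ^ 4"
proof -
  assume "0 \<le> e" "e \<le> 1" "n \<le> m"
  then have "e * real n \<le> 1 * real m" by (intro mult_mono) auto
  then show ?thesis using \<open>0 \<le> e\<close> by (auto simp: decay_def intro!: power_mono)
qed

text \<open>Bernoulli's inequality for the fourth power. The relative decrease carries a factor
  \<open>e\<close>, and the denominator \<open>1 + e * real m\<close> becomes summable once
  squared.\<close>

lemma decay_diff_le:
  assumes "0 \<le> e"
  shows "decay e m - decay e (m + n) \<le> decay e m * (4 * e * real n / (1 + e * real m))"
proof -
  let ?u = "1 + e * real m" and ?v = "1 + e * real (m + n)"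
  have uv: "0 < ?u" "0 < ?v" "?u \<le> ?v" using assms by (auto simp: add_pos_nonneg algebra_simps)
  have x: "?u / ?v = 1 + - (e * real n / ?v)" using uv by (simp add: field_simps)
  have "-1 \<le> - (e * real n / ?v)"
    using uv assms by (simp add: field_simps)
  then have "1 + real 4 * - (e * real n / ?v) \<le> (?u / ?v) ^ 4"
    unfolding x by (rule Bernoulli_inequality)
  moreover have "decay e (m + n) = decay e m * (?u / ?v) ^ 4"
    using uv by (simp add: decay_def power_divide)
  ultimately have "decay e m * (1 - 4 * (e * real n / ?v)) \<le> decay e (m + n)"
    using decay_pos[OF assms, of m] by (simp add: mult_left_mono)
  then have "decay e m - decay e (m + n) \<le> decay e m * (4 * e * real n / ?v)"
    by (simp add: algebra_simps)
  also have "\<dots> \<le> decay e m * (4 * e * real n / ?u)"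
    using uv assms decay_pos[OF assms, of m]
    by (intro mult_left_mono divide_left_mono) auto
  finally show ?thesis .
qed

text \<open>Telescoping against \<open>1 / (1 + e * real n)\<close>. The bound is the same for all
  \<open>e\<close>, so that \<open>e\<close> can be chosen after the other constants.\<close>

lemma sum_inverse_square_le:
  assumes "0 \<le> e"
  shows "(\<Sum>n=1..H. e / (1 + e * real n)\<^sup>2) \<le> 1"
proof -
  have "(\<Sum>n=1..H. e / (1 + e * real n)\<^sup>2) \<le> 1 - 1 / (1 + e * real H)"
  proof (induction H)
    case (Suc H)
    let ?u = "1 + e * real H" and ?v = "1 + e * real (Suc H)"
    have uv: "0 < ?u" "?u \<le> ?v" "?v - ?u = e" using assms by (auto simp: add_pos_nonneg algebra_simps)
    have "e / ?v\<^sup>2 \<le> e / (?u * ?v)"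
      using uv assms by (intro divide_left_mono) (auto simp: power2_eq_square)
    also have "\<dots> = 1 / ?u - 1 / ?v" using uv by (simp add: field_simps)
    finally show ?case using Suc by simp
  qed (use assms in simp)
  also have "\<dots> \<le> 1" using assms by simp
  finally show ?thesis .
qed

lemma sum_square_decay_bounded:
  assumes "0 < e"
  shows "\<exists>C. \<forall>H. (\<Sum>d=1..H. (real d)\<^sup>2 * decay e d) \<le> C"
proof -
  have "(real d)\<^sup>2 * decay e d \<le> 1 / (e\<^sup>2 * e) * (e / (1 + e * real d)\<^sup>2)" for d
  proof -
    have "(real d * e)\<^sup>2 \<le> (1 + e * real d)\<^sup>2" using assms by (intro power_mono) auto
    then have "(real d)\<^sup>2 \<le> 1 / e\<^sup>2 * (1 + e * real d)\<^sup>2" using assms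
      by (simp add: field_simps)
    moreover have "decay e d = 1 / (1 + e * real d)\<^sup>2 * (1 / (1 + e * real d)\<^sup>2)"
      by (simp add: decay_def flip: power_add)
    ultimately have "(real d)\<^sup>2 * decay e d
        \<le> 1 / e\<^sup>2 * (1 + e * real d)\<^sup>2 * (1 / (1 + e * real d)\<^sup>2 * (1 / (1 + e * real d)\<^sup>2))"
      by (intro mult_mono) auto
    moreover have "1 + e * real d > 0" using assms by (simp add: add_pos_nonneg)
    moreover have "1 / e\<^sup>2 * u\<^sup>2 * (1 / u\<^sup>2 * (1 / u\<^sup>2)) = 1 / (e\<^sup>2 * e) * (e / u\<^sup>2)" if "0 < u" for u
      using that assms by (simp add: power2_eq_square)
    ultimately show ?thesis by simp
  qed
  then have "(\<Sum>d=1..H. (real d)\<^sup>2 * decay e d) \<le> 1 / (e\<^sup>2 * e) * (\<Sum>d=1..H. e / (1 + e * real d)\<^sup>2)" for H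
    unfolding sum_distrib_left by (intro sum_mono) auto
  also have "1 / (e\<^sup>2 * e) * (\<Sum>d=1..H. e / (1 + e * real d)\<^sup>2) \<le> 1 / (e\<^sup>2 * e) * 1" for H
    using assms by (intro mult_left_mono sum_inverse_square_le) auto
  finally show ?thesis by blast
qed

lemma sum_geometric_poly_bounded:
  fixes q c :: real
  assumes "0 < q" "q < 1" "0 < c"
  shows "\<exists>C\<ge>0. \<forall>H. (\<Sum>n=1..H. (real n + c) ^ j * q ^ (2 * n)) \<le> C"
proof -
  let ?f = "\<lambda>n. (real n + c) ^ j * q ^ (2 * n)"
  have f0: "0 < ?f n" for n using assms by (intro mult_pos_pos zero_less_power) auto
  have "(\<lambda>n. ((real n + 1 + c) / (real n + c))) \<longlonglongrightarrow> 1"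
    by real_asymp
  then have "(\<lambda>n. ((real n + 1 + c) / (real n + c)) ^ j * q\<^sup>2) \<longlonglongrightarrow> 1 ^ j * q\<^sup>2"
    by (intro tendsto_intros)
  moreover have "1 ^ j * q\<^sup>2 < q" using assms by (simp add: power2_eq_square)
  ultimately have "\<forall>\<^sub>F n in sequentially. ((real n + 1 + c) / (real n + c)) ^ j * q\<^sup>2 < q"
    by (rule order_tendstoD)
  then obtain N where N: "((real n + 1 + c) / (real n + c)) ^ j * q\<^sup>2 < q" if "n \<ge> N" for n
    by (auto simp: eventually_sequentially)
  have "summable ?f"
  proof (rule summable_ratio_test[where N = N])
    fix n assume "N \<le> n"
    have "real n + c > 0" using assms by simp
    then have "?f (Suc n) = ((real n + 1 + c) / (real n + c)) ^ j * q\<^sup>2 * ?f n"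
      by (simp add: power_divide power_add power2_eq_square algebra_simps)
    also have "\<dots> \<le> q * ?f n"
      using N[OF \<open>N \<le> n\<close>] f0[of n] by (intro mult_right_mono) auto
    finally show "norm (?f (Suc n)) \<le> q * norm (?f n)"
      using f0[of n] f0[of "Suc n"] by simp
  qed (rule assms)
  then have "(\<Sum>n=1..H. ?f n) \<le> suminf ?f" for H
    using f0 by (intro sum_le_suminf) (auto simp: less_imp_le)
  moreover have "0 \<le> suminf ?f" using \<open>summable ?f\<close> f0 by (intro suminf_nonneg) (auto simp: less_imp_le)
  ultimately show ?thesis by blast
qed

text \<open>In a triangle of bonds, \<open>loss d n\<close> is the coefficient lost by a bond of length \<open>d\<close> when the
  third site lies beyond its ends at distance \<open>n\<close>, and \<open>gain m n\<close> is the coefficient gained by a bond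
  of length \<open>m + n\<close> when the third site divides it into lengths \<open>m\<close> and \<open>n\<close>. The factor
  \<open>(1 + q\<^sup>2) / 2 < 1\<close> is what lets the gain of a long bond pay for the corresponding loss.\<close>

definition corner_cost :: "real \<Rightarrow> nat \<Rightarrow> real" where
  "corner_cost q n = (if n = 1 then 1 else 0) + q ^ (2 * n) * (2 * (real n + 2) ^ 8 + 4)"

definition loss :: "real \<Rightarrow> real \<Rightarrow> real \<Rightarrow> real \<Rightarrow> nat \<Rightarrow> nat \<Rightarrow> real" where
  "loss q e \<kappa> \<mu> d n = 16 * e / \<kappa> * (real n)\<^sup>2 * q ^ (2 * n) * (decay e d)\<^sup>2
     + \<kappa> * (e / (1 + e * real n)\<^sup>2) * (decay e d)\<^sup>2
     + (if n = 1 then \<mu> * ((1 + q\<^sup>2) / 2) * (decay e d)\<^sup>2 else 0)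
     + (if d = 1 then \<mu> * corner_cost q n else 0)"

definition gain :: "real \<Rightarrow> real \<Rightarrow> nat \<Rightarrow> nat \<Rightarrow> real" where
  "gain e \<mu> m n = \<mu> * (decay e (m + n))\<^sup>2 * ((if m = 1 then 1 else 0) + (if n = 1 then 1 else 0))"

lemma corner_cost_nonneg: "0 < q \<Longrightarrow> 0 \<le> corner_cost q n"
  by (simp add: corner_cost_def)

text \<open>Young's inequality splits the mixed term with parameter \<open>k\<close>: the second
  summand of \<open>loss\<close> pays \<open>k\<close> on the bond of length \<open>n\<close>, the
  first pays \<open>X\<^sup>2 / k\<close> on the bond of length \<open>m\<close>, and
  \<open>k\<close> is chosen so that both are summable over the third site. The last two summands
  pay for the gain: the one with \<open>(1 + q\<^sup>2) / 2\<close> when the lighter bond is a unit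
  bond, \<open>corner_cost\<close> when the heavier one is. If both are, the gain counts twice, and
  the second share is covered by the \<open>1\<close> in \<open>corner_cost\<close>.\<close>

lemma triangle_form_radial:
  fixes q e \<kappa> \<mu> a b :: real and m n :: nat
  defines "t \<equiv> decay e"
  assumes q: "0 < q" "q < 1" and e: "0 < e" "e \<le> 1" and k: "0 < \<kappa>"
    and mu: "0 \<le> \<mu>" "4 * \<mu> * (1 + 2 * q\<^sup>2 / (1 - q\<^sup>2)) \<le> 3" "2 * \<mu> \<le> 1"
    and mn: "1 \<le> m" "1 \<le> n"
  shows "- loss q e \<kappa> \<mu> m n * a\<^sup>2 - loss q e \<kappa> \<mu> n m * q ^ (2 * n) * b\<^sup>2
      + gain e \<mu> m n * q ^ (2 * n) * (a + b)\<^sup>2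
    \<le> q ^ (2 * n) * (2 * (q ^ (2 * m) * t m * t (m + n) * (a * (a + b))
        - t n * (t m - t (m + n)) * (a * b) + t n * t (m + n) * b\<^sup>2))"
proof -
  define r where "r = q ^ (2 * n)"
  define P where "P = q ^ (2 * m) * t m * t (m + n)"
  define X where "X = t n * (t m - t (m + n))"
  define Q where "Q = t n * t (m + n)"
  define k where "k = \<kappa> * (e / (1 + e * real m)\<^sup>2) * (t n)\<^sup>2"
  define l where "l = 16 * e / \<kappa> * (real n)\<^sup>2 * (t m)\<^sup>2"
  define J where "J = 2 * (P * (a * (a + b)) - X * (a * b) + Q * b\<^sup>2)"
  have tp: "0 < t d" "t d \<le> 1" for d using e by (simp_all add: t_def decay_pos decay_le_1)
  have tm: "t j \<le> t i" if "i \<le> j" for i j using e that by (simp add: t_def decay_antimono)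
  have r: "0 < r" "r \<le> 1" using q by (auto simp: r_def power_le_one)
  have p: "0 < q ^ (2 * m)" "q ^ (2 * m) \<le> 1" using q by (auto simp: power_le_one)
  have em: "0 < 1 + e * real m" using e by (simp add: add_pos_nonneg)
  have P: "0 \<le> P" "P \<le> t m * t (m + n)"
    using p tp[of m] tp[of "m + n"] mult_right_mono[OF p(2), of "t m * t (m + n)"]
    by (auto simp: P_def mult.assoc)
  have X: "0 \<le> X" using tp[of n] tm[of m "m + n"] by (simp add: X_def)
  have Q: "0 < Q" using tp by (simp add: Q_def)
  have "t m * t (m + n) \<le> t m * t n" using tm[of n "m + n"] tp[of m] by (intro mult_left_mono) auto
  then have PXQ: "P \<le> X + Q" using P by (simp add: X_def Q_def algebra_simps)
  have k0: "0 < k" using e k em tp[of n] by (simp add: k_def)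
  have Xl: "X\<^sup>2 / k \<le> l"
  proof -
    have "X \<le> t n * (t m * (4 * e * real n / (1 + e * real m)))"
      unfolding X_def t_def using decay_diff_le[of e m n] e tp[of n] by (intro mult_left_mono) (auto simp: t_def)
    then have "X\<^sup>2 \<le> (t n * (t m * (4 * e * real n / (1 + e * real m))))\<^sup>2"
      using X by (intro power_mono) auto
    also have "\<dots> = l * k"
      using k e em by (simp add: l_def k_def field_simps power2_eq_square)
    finally show ?thesis using k0 by (simp add: divide_le_eq)
  qed
  have l0: "0 \<le> l" using k e by (simp add: l_def)
  have loss_nm: "k \<le> loss q e \<kappa> \<mu> n m"
    using q e k mu corner_cost_nonneg[of q m] unfolding loss_def k_def t_def[symmetric]
    by (auto intro!: add_nonneg_nonneg mult_nonneg_nonneg)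
  have base: "r * l + (if n = 1 then \<mu> * ((1 + q\<^sup>2) / 2) * (t m)\<^sup>2 else 0)
     + (if m = 1 then \<mu> * corner_cost q n else 0) \<le> loss q e \<kappa> \<mu> m n"
    using q e k unfolding loss_def l_def t_def[symmetric] r_def by (simp add: mult_ac)
  have suff: ?thesis
    if J: "g * (a + b)\<^sup>2 - k * b\<^sup>2 - h * a\<^sup>2 \<le> J" and g: "gain e \<mu> m n = g"
      and h: "r * h \<le> loss q e \<kappa> \<mu> m n" for g h
  proof -
    have "r * (g * (a + b)\<^sup>2 - k * b\<^sup>2 - h * a\<^sup>2) \<le> r * J" using J r by (intro mult_left_mono) auto
    moreover have "r * h * a\<^sup>2 \<le> loss q e \<kappa> \<mu> m n * a\<^sup>2" using h by (intro mult_right_mono) auto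
    moreover have "k * (r * b\<^sup>2) \<le> loss q e \<kappa> \<mu> n m * (r * b\<^sup>2)"
      using loss_nm r by (intro mult_right_mono) auto
    ultimately show ?thesis
      unfolding g r_def[symmetric] P_def[symmetric] X_def[symmetric] Q_def[symmetric] J_def[symmetric]
      by (simp add: algebra_simps)
  qed
  consider "n = 1" | "m = 1" "2 \<le> n" | "2 \<le> m" "2 \<le> n" using mn by linarith
  then show ?thesis
  proof cases
    case 1
    define g where "g = \<mu> * (t (m + 1))\<^sup>2 * ((if m = 1 then 1 else 0) + 1)"
    \<comment> \<open>Makes \<open>q\<^sup>2 * (1 + d)\<close> the midpoint of
      \<open>q\<^sup>2\<close> and \<open>1\<close>; \<open>1 + 1 / d\<close> is then the factor
      occurring in the hypothesis on \<open>\<mu>\<close>.\<close>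
    define d where "d = (1 - q\<^sup>2) / (2 * q\<^sup>2)"
    have q2: "0 < q\<^sup>2" "q\<^sup>2 < 1" using q mult_strict_mono[of q 1 q 1] by (simp_all add: power2_eq_square)
    have d: "0 < d" "q\<^sup>2 * (1 + d) = (1 + q\<^sup>2) / 2" "1 + 1 / d = 1 + 2 * q\<^sup>2 / (1 - q\<^sup>2)"
      using q2 q by (auto simp: d_def field_simps)
    have g0: "0 \<le> g" using mu by (simp add: g_def)
    have gle: "g \<le> 2 * \<mu> * (t (m + 1))\<^sup>2" using mu by (auto simp: g_def)
    have PQ: "P \<le> Q"
    proof -
      have "P \<le> t m * t (m + n)" by (rule P)
      also have "\<dots> \<le> Q" unfolding Q_def using tm[of n m] mn 1 tp[of "m + n"] by (intro mult_right_mono) auto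
      finally show ?thesis .
    qed
    have "(t (m + 1))\<^sup>2 \<le> Q"
      unfolding Q_def power2_eq_square using 1 tm[of 1 "m + 1"] tp[of "m + 1"] by (intro mult_mono) auto
    then have "2 * \<mu> * (t (m + 1))\<^sup>2 \<le> 2 * \<mu> * Q" using mu by (intro mult_left_mono) auto
    then have "g \<le> 2 * \<mu> * Q" using gle by linarith
    moreover have "0 \<le> 1 + 1 / d" using d(1) by (simp add: add_nonneg_nonneg)
    ultimately have "g * (1 + 1 / d) \<le> 2 * \<mu> * Q * (1 + 1 / d)" by (rule mult_right_mono)
    also have "\<dots> = (4 * \<mu> * (1 + 1 / d)) / 2 * Q" by simp
    also have "\<dots> \<le> 3 / 2 * Q" using mu(2) Q unfolding d(3) by (intro mult_right_mono divide_right_mono) auto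
    finally have cond: "g * (1 + 1 / d) \<le> 3 / 2 * Q" .
    have "g * (a + b)\<^sup>2 - k * b\<^sup>2 - (X\<^sup>2 / k + g * (1 + d)) * a\<^sup>2 \<le> J"
      unfolding J_def by (rule triangle_form_gain_light) (use P X PQ k0 d g0 cond in auto)
    moreover have "gain e \<mu> m n = g" using 1 by (simp add: gain_def g_def t_def)
    moreover have "r * (X\<^sup>2 / k + g * (1 + d)) \<le> loss q e \<kappa> \<mu> m n"
    proof -
      have r2: "r = q\<^sup>2" using 1 by (simp add: r_def)
      have "r * (X\<^sup>2 / k) \<le> r * l" using Xl r by (intro mult_left_mono) auto
      moreover have "r * (g * (1 + d)) = g * ((1 + q\<^sup>2) / 2)"
        unfolding r2 d(2)[symmetric] by (simp add: mult_ac)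
      moreover have "g * ((1 + q\<^sup>2) / 2) \<le> \<mu> * ((1 + q\<^sup>2) / 2) * (t m)\<^sup>2 + (if m = 1 then \<mu> * corner_cost q n else 0)"
      proof -
        have t1: "\<mu> * (t (m + 1))\<^sup>2 * ((1 + q\<^sup>2) / 2) \<le> \<mu> * (t m)\<^sup>2 * ((1 + q\<^sup>2) / 2)"
          using mu tm[of m "m + 1"] tp[of "m + 1"] by (intro mult_right_mono mult_left_mono power_mono) auto
        show ?thesis
        proof (cases "m = 1")
          case True
          have c1: "1 \<le> corner_cost q n" using q 1 by (simp add: corner_cost_def)
          have "(t (m + 1))\<^sup>2 * ((1 + q\<^sup>2) / 2) \<le> 1 * 1"
            using q2 tp[of "m + 1"] by (intro mult_mono power_le_one) auto
          then have "\<mu> * ((t (m + 1))\<^sup>2 * ((1 + q\<^sup>2) / 2)) \<le> \<mu> * corner_cost q n"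
            using c1 mu by (intro mult_left_mono) auto
          moreover have "g * ((1 + q\<^sup>2) / 2) = \<mu> * (t (m + 1))\<^sup>2 * ((1 + q\<^sup>2) / 2)
              + \<mu> * ((t (m + 1))\<^sup>2 * ((1 + q\<^sup>2) / 2))"
            using True by (simp add: g_def)
          moreover have "\<mu> * (t m)\<^sup>2 * ((1 + q\<^sup>2) / 2) = \<mu> * ((1 + q\<^sup>2) / 2) * (t m)\<^sup>2"
            by (simp only: mult_ac)
          ultimately show ?thesis using t1 unfolding if_P[OF True] by linarith
        next
          case False
          moreover have "\<mu> * (t m)\<^sup>2 * ((1 + q\<^sup>2) / 2) = \<mu> * ((1 + q\<^sup>2) / 2) * (t m)\<^sup>2"
            by (simp only: mult_ac)
          moreover have "g = \<mu> * (t (m + 1))\<^sup>2" using False by (simp add: g_def)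
          ultimately show ?thesis using t1 unfolding if_not_P[OF False] by (simp only: add_0_right)
        qed
      qed
      ultimately show ?thesis using base 1 by (simp add: distrib_left)
    qed
    ultimately show ?thesis by (rule suff)
  next
    case 2
    \<comment> \<open>Halving ensures \<open>2 * g \<le> Q\<close>; the weight
      \<open>u = 2 * \<mu>\<close> makes up for it.\<close>
    define g where "g = (t (m + n))\<^sup>2 / 2"
    have "(t (m + n))\<^sup>2 \<le> Q"
      unfolding Q_def power2_eq_square using tm[of n "m + n"] tp[of "m + n"] by (intro mult_mono) auto
    then have g: "0 \<le> g" "2 * g \<le> Q" by (auto simp: g_def)
    have Q1: "Q \<le> 1" unfolding Q_def using tp[of n] tp[of "m + n"] by (intro mult_le_one) auto
    have X1: "X \<le> 1" unfolding X_def using tp[of n] tp[of m] tp[of "m + n"] tm[of m "m + n"]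
      by (intro mult_le_one) auto
    have P1: "P \<le> 1" using P(2) mult_le_one[OF tp(2)[of m] _ tp(2)[of "m + n"]] tp[of "m + n"] by simp
    have "2 * \<mu> * g * (a + b)\<^sup>2 - k * b\<^sup>2 - (X\<^sup>2 / k + 2 * \<mu> * (1 / Q + 2)) * a\<^sup>2 \<le> J"
      unfolding J_def
      by (rule triangle_form_gain_heavy) (use P X Q PXQ k0 g Q1 X1 P1 mu in auto)
    moreover have "gain e \<mu> m n = 2 * \<mu> * g" using 2 by (simp add: gain_def g_def t_def)
    moreover have "r * (X\<^sup>2 / k + 2 * \<mu> * (1 / Q + 2)) \<le> loss q e \<kappa> \<mu> m n"
    proof -
      have "r * (X\<^sup>2 / k) \<le> r * l" using Xl r by (intro mult_left_mono) auto
      moreover have "r * (2 * \<mu> * (1 / Q + 2)) \<le> \<mu> * corner_cost q n"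
      proof -
        have "1 / Q = 1 / t n * (1 / t (m + n))" by (simp add: Q_def)
        also have "\<dots> \<le> (real (n + 1) + 1) ^ 4 * (real (n + 1) + 1) ^ 4"
          unfolding t_def using e tp[of n] tp[of "m + n"] 2
          by (intro mult_mono inverse_decay_le) (auto simp: t_def)
        also have "\<dots> = (real n + 2) ^ 8" by (simp flip: power_add add: add.commute)
        finally have "1 / Q \<le> (real n + 2) ^ 8" .
        then have "2 * \<mu> * r * (1 / Q + 2) \<le> 2 * \<mu> * r * ((real n + 2) ^ 8 + 2)"
          using mu r by (intro mult_left_mono) auto
        then show ?thesis using 2 by (simp add: corner_cost_def r_def algebra_simps)
      qed
      ultimately show ?thesis using base 2 by (simp add: distrib_left)
    qed
    ultimately show ?thesis by (rule suff)
  next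
    case 3
    have "0 * (a + b)\<^sup>2 - k * b\<^sup>2 - (X\<^sup>2 / k) * a\<^sup>2 \<le> J"
      using triangle_form_lower[of P X Q k b a] P X Q PXQ k0 by (simp add: J_def)
    moreover have "gain e \<mu> m n = 0" using 3 by (simp add: gain_def)
    moreover have "r * (X\<^sup>2 / k) \<le> loss q e \<kappa> \<mu> m n"
      using base 3 mult_left_mono[OF Xl, of r] r by simp
    ultimately show ?thesis by (rule suff)
  qed
qed

lemma sum_loss_le:
  fixes q e \<kappa> \<mu> C :: real
  assumes "0 \<le> e" "0 \<le> \<kappa>" "0 \<le> \<mu>" "0 < q" "0 \<le> s"
    and C: "(\<Sum>n=1..H. (real n + 1)\<^sup>2 * q ^ (2 * n)) \<le> C" and s: "16 * e / \<kappa> * C \<le> s"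
  shows "(\<Sum>n=1..H. loss q e \<kappa> \<mu> d n)
    \<le> (s + \<kappa> + \<mu> * ((1 + q\<^sup>2) / 2)) * (decay e d)\<^sup>2
      + (if d = 1 then \<mu> * (\<Sum>n=1..H. corner_cost q n) else 0)"
proof -
  have "(\<Sum>n=1..H. (real n)\<^sup>2 * q ^ (2 * n)) \<le> (\<Sum>n=1..H. (real n + 1)\<^sup>2 * q ^ (2 * n))"
    using assms by (intro sum_mono mult_right_mono power_mono) auto
  then have "(\<Sum>n=1..H. (real n)\<^sup>2 * q ^ (2 * n)) \<le> C" using C by linarith
  then have "16 * e / \<kappa> * (\<Sum>n=1..H. (real n)\<^sup>2 * q ^ (2 * n)) \<le> 16 * e / \<kappa> * C"
    using assms by (intro mult_left_mono) auto
  then have "16 * e / \<kappa> * (\<Sum>n=1..H. (real n)\<^sup>2 * q ^ (2 * n)) * (decay e d)\<^sup>2 \<le> s * (decay e d)\<^sup>2"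
    using s by (intro mult_right_mono) auto
  moreover have "16 * e / \<kappa> * (\<Sum>n=1..H. (real n)\<^sup>2 * q ^ (2 * n)) * (decay e d)\<^sup>2
      = (\<Sum>n=1..H. 16 * e / \<kappa> * (real n)\<^sup>2 * q ^ (2 * n) * (decay e d)\<^sup>2)"
    by (simp add: sum_distrib_left sum_distrib_right mult_ac)
  moreover have "\<kappa> * (\<Sum>n=1..H. e / (1 + e * real n)\<^sup>2) * (decay e d)\<^sup>2 \<le> \<kappa> * 1 * (decay e d)\<^sup>2"
    using assms by (intro mult_right_mono mult_left_mono sum_inverse_square_le) auto
  moreover have "\<kappa> * (\<Sum>n=1..H. e / (1 + e * real n)\<^sup>2) * (decay e d)\<^sup>2
      = (\<Sum>n=1..H. \<kappa> * (e / (1 + e * real n)\<^sup>2) * (decay e d)\<^sup>2)"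
    by (simp add: sum_distrib_left sum_distrib_right mult_ac)
  moreover have "(\<Sum>n=1..H. if n = 1 then \<mu> * ((1 + q\<^sup>2) / 2) * (decay e d)\<^sup>2 else 0)
      \<le> \<mu> * ((1 + q\<^sup>2) / 2) * (decay e d)\<^sup>2"
    using assms by (simp add: sum.delta)
  moreover have "(\<Sum>n=1..H. if d = 1 then \<mu> * corner_cost q n else 0)
      = (if d = 1 then \<mu> * (\<Sum>n=1..H. corner_cost q n) else 0)"
    by (simp add: sum_distrib_left)
  ultimately show ?thesis
    unfolding loss_def sum.distrib by (simp add: distrib_right)
qed

text \<open>The order of choice is \<open>\<mu>\<close>, \<open>\<kappa>\<close>, \<open>e\<close>.
  Of the budget \<open>\<mu> * (decay e d)\<^sup>2\<close> of a long bond, the fraction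
  \<open>(1 + q\<^sup>2) / 2\<close> repays the gain of bonds one layer longer; the rest amounts to
  \<open>4 * \<kappa>\<close>, of which the two other loss sums use \<open>2 * \<kappa>\<close>. For
  unit bonds \<open>\<mu>\<close> must also outweigh the corner costs. The target
  \<open>q\<^sup>2 / 1024\<close> is a quarter of \<open>q\<^sup>2 / 256\<close>, the lower bound
  for \<open>q\<^sup>2 * (decay e 1)\<^sup>2\<close> used in \<open>curvature_lower\<close>.\<close>

lemma radial_weights_exist:
  fixes q :: real
  assumes q: "0 < q" "q < 1"
  obtains e \<kappa> \<mu> where "0 < e" "e \<le> 1" "0 < \<kappa>" "0 \<le> \<mu>"
    "4 * \<mu> * (1 + 2 * q\<^sup>2 / (1 - q\<^sup>2)) \<le> 3" "2 * \<mu> \<le> 1"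
    "\<And>d H. 2 \<le> d \<Longrightarrow> (\<Sum>n=1..H. loss q e \<kappa> \<mu> d n) \<le> \<mu> * (decay e d)\<^sup>2"
    "\<And>H. (\<Sum>n=1..H. loss q e \<kappa> \<mu> 1 n) \<le> q\<^sup>2 / 1024"
proof -
  have q2: "0 < q\<^sup>2" "q\<^sup>2 < 1" using q mult_strict_mono[of q 1 q 1] by (simp_all add: power2_eq_square)
  obtain C where C: "0 \<le> C" "\<And>H. (\<Sum>n=1..H. (real n + 1)\<^sup>2 * q ^ (2 * n)) \<le> C"
    using sum_geometric_poly_bounded[OF q, of 1 2] by auto
  obtain D where D: "0 \<le> D" "\<And>H. (\<Sum>n=1..H. (real n + 2) ^ 8 * q ^ (2 * n)) \<le> D"
    using sum_geometric_poly_bounded[OF q, of 2 8] by auto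
  have corner: "(\<Sum>n=1..H. corner_cost q n) \<le> 1 + 6 * D" for H
  proof -
    have "corner_cost q n \<le> (if n = 1 then 1 else 0) + 6 * ((real n + 2) ^ 8 * q ^ (2 * n))" for n
    proof -
      have "1 \<le> (real n + 2) ^ 8" by (rule one_le_power) simp
      then have "q ^ (2 * n) * (2 * (real n + 2) ^ 8 + 4) \<le> q ^ (2 * n) * (6 * (real n + 2) ^ 8)"
        using q by (intro mult_left_mono) auto
      then show ?thesis by (simp add: corner_cost_def algebra_simps)
    qed
    then have "(\<Sum>n=1..H. corner_cost q n)
        \<le> (\<Sum>n=1..H. (if n = 1 then 1 else 0) + 6 * ((real n + 2) ^ 8 * q ^ (2 * n)))"
      by (intro sum_mono)
    also have "\<dots> = (\<Sum>n=1..H. if n = 1 then 1 else 0) + 6 * (\<Sum>n=1..H. (real n + 2) ^ 8 * q ^ (2 * n))"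
      by (simp add: sum.distrib sum_distrib_left)
    also have "(\<Sum>n=1..H. if n = 1 then 1 else 0 :: real) \<le> 1" by (simp add: sum.delta)
    finally show ?thesis using D(2)[of H] by linarith
  qed
  define B where "B = 1 + 2 * q\<^sup>2 / (1 - q\<^sup>2)"
  have B: "0 \<le> B" using q2 by (simp add: B_def)
  define K where "K = 4 + 6 * D + 4 * B"
  have K: "4 \<le> K" using D B by (simp add: K_def)
  define \<mu> where "\<mu> = q\<^sup>2 / 1024 / K"
  have mu: "0 < \<mu>" "\<mu> * K = q\<^sup>2 / 1024" using q2 K by (auto simp: \<mu>_def)
  define \<kappa> where "\<kappa> = \<mu> * (1 - q\<^sup>2) / 8"
  have k: "0 < \<kappa>" using mu q2 by (simp add: \<kappa>_def)
  have k8: "8 * \<kappa> = \<mu> * (1 - q\<^sup>2)" by (simp add: \<kappa>_def)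
  \<comment> \<open>Possible at this point because \<open>C\<close> and \<open>\<kappa>\<close> do
    not depend on \<open>e\<close>; it brings the sum of the first summand of \<open>loss\<close>
    down to \<open>\<kappa>\<close>.\<close>
  define e where "e = min 1 (\<kappa> * \<kappa> / (16 * (C + 1)))"
  have e: "0 < e" "e \<le> 1" "e \<le> \<kappa> * \<kappa> / (16 * (C + 1))"
    using k C by (auto simp: e_def)
  have "16 * e * C \<le> 16 * e * (C + 1)" using e by simp
  also have "\<dots> \<le> \<kappa> * \<kappa>" using e(3) C by (simp add: field_simps)
  finally have s: "16 * e / \<kappa> * C \<le> \<kappa>" using k by (simp add: field_simps)
  have "4 * \<mu> * B \<le> \<mu> * K" using mu D B by (simp add: K_def algebra_simps)
  then have c1: "4 * \<mu> * B \<le> 3" using mu q2 by linarith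
  have "\<mu> * 4 \<le> \<mu> * K" using mu K by (intro mult_left_mono) auto
  then have c2: "2 * \<mu> \<le> 1" using mu q2 by linarith
  have sums: "(\<Sum>n=1..H. loss q e \<kappa> \<mu> d n)
    \<le> (\<kappa> + \<kappa> + \<mu> * ((1 + q\<^sup>2) / 2)) * (decay e d)\<^sup>2
      + (if d = 1 then \<mu> * (\<Sum>n=1..H. corner_cost q n) else 0)" for d H
    by (rule sum_loss_le[OF _ _ _ _ _ C(2) s]) (use e k mu q in auto)
  have kk: "\<kappa> + \<kappa> + \<mu> * ((1 + q\<^sup>2) / 2) \<le> \<mu>"
  proof -
    have "\<mu> * ((1 + q\<^sup>2) / 2) = \<mu> - \<mu> * (1 - q\<^sup>2) / 2" by (simp add: field_simps)
    then show ?thesis using k8 k by linarith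
  qed
  show ?thesis
  proof (rule that[OF e(1,2) k])
    show "(\<Sum>n=1..H. loss q e \<kappa> \<mu> d n) \<le> \<mu> * (decay e d)\<^sup>2" if "2 \<le> d" for d H
      using sums[of d H] that mult_right_mono[OF kk, of "(decay e d)\<^sup>2"] by simp
    show "(\<Sum>n=1..H. loss q e \<kappa> \<mu> 1 n) \<le> q\<^sup>2 / 1024" for H
    proof -
      have "(decay e 1)\<^sup>2 \<le> 1" using e decay_pos[of e 1] decay_le_1[of e 1] by (intro power_le_one) auto
      then have "(\<kappa> + \<kappa> + \<mu> * ((1 + q\<^sup>2) / 2)) * (decay e 1)\<^sup>2 \<le> \<mu> * 1"
        using kk mu by (intro mult_mono) auto
      moreover have "\<mu> * (\<Sum>n=1..H. corner_cost q n) \<le> \<mu> * (1 + 6 * D)"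
        using corner mu by (intro mult_left_mono) auto
      moreover have "\<mu> * (2 + 6 * D) \<le> \<mu> * K" using mu B by (intro mult_left_mono) (auto simp: K_def)
      ultimately show ?thesis using sums[of 1 H] mu by (simp add: algebra_simps)
    qed
    show "4 * \<mu> * (1 + 2 * q\<^sup>2 / (1 - q\<^sup>2)) \<le> 3" using c1 by (simp add: B_def)
  qed (use mu c2 in auto)
qed

section \<open>Exchanges and detailed balance\<close>

lemma exchange_apply: "exchange x y \<alpha> z = (if z = x then \<alpha> y else if z = y then \<alpha> x else \<alpha> z)"
  by (auto simp: exchange_def)

lemma exchange_commute: "exchange x y \<alpha> = exchange y x \<alpha>"
  by (auto simp: exchange_apply fun_eq_iff)

lemma sum_exchange:
  fixes g :: "config \<Rightarrow> 'b::comm_monoid_add"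
  assumes "x \<in> Lattice L H" "y \<in> Lattice L H"
  shows "(\<Sum>\<alpha>\<in>Omega_N L H N. g (exchange x y \<alpha>)) = (\<Sum>\<alpha>\<in>Omega_N L H N. g \<alpha>)"
  by (rule sum.reindex_bij_betw, rule bij_betwI[where g = "exchange x y"])
    (use exchange_Omega_N[OF assms] in \<open>auto simp: exchange_exchange\<close>)

lemma Omega_N_01:
  assumes "\<alpha> \<in> Omega_N L H N" "x \<in> Lattice L H"
  shows "\<alpha> x = 0 \<or> \<alpha> x = 1"
  using assms by (auto simp: Omega_N_def Omega_def PiE_iff)

lemma finite_Omega_N: "finite (Omega_N L H N)"
  using finite_subset[OF Omega_N_subset finite_Omega] .

lemma mu_weight_exchange:
  assumes "0 < q" "x \<in> Lattice L H" "y \<in> Lattice L H" "\<alpha> x = 1" "\<alpha> y = 0"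
  shows "mu_weight q L H (exchange x y \<alpha>) * q ^ (2 * snd x) = mu_weight q L H \<alpha> * q ^ (2 * snd y)"
proof -
  let ?g = "\<lambda>\<alpha> z. q ^ (2 * snd z * \<alpha> z) / (1 + q ^ (2 * snd z))"
  let ?R = "Lattice L H - {x} - {y}"
  have "x \<noteq> y" using assms by auto
  then have split: "mu_weight q L H \<beta> = ?g \<beta> x * (?g \<beta> y * (\<Prod>z\<in>?R. ?g \<beta> z))" for \<beta>
    unfolding mu_weight_alt
    by (subst prod.remove[OF finite_Lattice assms(2)], subst prod.remove[of _ y])
       (use assms finite_Lattice in auto)
  have R: "(\<Prod>z\<in>?R. ?g (exchange x y \<alpha>) z) = (\<Prod>z\<in>?R. ?g \<alpha> z)"
    by (rule prod.cong) (auto simp: exchange_def)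
  show ?thesis
    unfolding split R using \<open>x \<noteq> y\<close> assms by (simp add: exchange_apply)
qed

text \<open>For \<open>s = 1\<close> we follow a particle among holes, for \<open>s = 0\<close> a hole among particles; exchanging the two
  reverses the order of the heights.\<close>

definition depth :: "nat \<Rightarrow> site \<Rightarrow> int" where
  "depth s x = (if s = 1 then int (snd x) else - int (snd x))"

text \<open>Detailed balance for Metropolis rates: \<open>nat\<close> truncates, so at most one of
  the two exponents is nonzero and the move towards larger weight has factor
  \<open>1\<close>.\<close>

lemma mu_weight_exchange_depth:
  assumes q: "0 < q" and xy: "x \<in> Lattice L H" "y \<in> Lattice L H" and s: "s = 0 \<or> s = 1"
    and a: "\<alpha> x = s" "\<alpha> y = 1 - s"
  shows "mu_weight q L H \<alpha> * q ^ (2 * nat (depth s y - depth s x))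
    = mu_weight q L H (exchange x y \<alpha>) * q ^ (2 * nat (depth s x - depth s y))"
proof -
  have cancel: "v * q ^ (2 * (b - a)) = v' * q ^ (2 * (a - b))"
    if "v' * q ^ (2 * a) = v * q ^ (2 * b)" for v v' :: real and a b :: nat
  proof (cases "a \<le> b")
    case True
    then obtain c where "b = a + c" by (auto simp: le_iff_add)
    then show ?thesis using that q by (simp add: power_add power_mult)
  next
    case False
    then obtain c where "a = b + c" by (metis le_iff_add nat_le_linear)
    then show ?thesis using that q by (simp add: power_add power_mult)
  qed
  show ?thesis
  proof (cases "s = 1")
    case True
    then show ?thesis
      using cancel[OF mu_weight_exchange[OF q xy, of \<alpha>]] a by (simp add: depth_def nat_diff_distrib')
  next
    case False
    then have "s = 0" using s by simp
    then show ?thesis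
      using cancel[OF mu_weight_exchange[OF q xy(2,1), of \<alpha>]] a
      by (simp add: depth_def exchange_commute[of y x] nat_diff_distrib')
  qed
qed

locale exclusion =
  fixes q :: real and L H N :: nat
  assumes q: "0 < q" "q < 1"
begin

abbreviation "S \<equiv> Lattice L H"
abbreviation "A \<equiv> Omega_N L H N"
abbreviation "w \<equiv> mu_weight q L H"

definition hop :: "nat \<Rightarrow> site \<Rightarrow> site \<Rightarrow> real" where
  "hop s x y = q ^ (2 * nat (depth s y - depth s x))"

lemma hop_pos: "0 < hop s x y"
  using q by (simp add: hop_def)

lemma hop_le_1: "hop s x y \<le> 1"
  using q by (simp add: hop_def power_le_one)

lemma hop_flip: "s = 0 \<or> s = 1 \<Longrightarrow> hop (1 - s) x y = hop s y x"
  by (auto simp: hop_def depth_def)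

lemma hop_balance:
  "x \<in> S \<Longrightarrow> y \<in> S \<Longrightarrow> s = 0 \<or> s = 1 \<Longrightarrow> \<alpha> x = s \<Longrightarrow> \<alpha> y = 1 - s
    \<Longrightarrow> w \<alpha> * hop s x y = w (exchange x y \<alpha>) * hop s y x"
  unfolding hop_def by (rule mu_weight_exchange_depth) (use q in auto)

definition layer_dist :: "site \<Rightarrow> site \<Rightarrow> nat" where
  "layer_dist x y = (snd x - snd y) + (snd y - snd x)"

lemma layer_dist_commute: "layer_dist x y = layer_dist y x"
  by (simp add: layer_dist_def)

lemma w_pos: "0 < w \<alpha>"
  using q by (simp add: mu_weight_pos)

text \<open>The share of the bond \<open>x\<close>, \<open>y\<close> in a triangle: only
  configurations in which exactly one of the three sites has the value \<open>s\<close>. Both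
  \<open>s = 1\<close> and \<open>s = 0\<close> are needed, since a triangle may hold one particle
  or two.\<close>

definition edge :: "(config \<Rightarrow> real) \<Rightarrow> nat \<Rightarrow> site \<Rightarrow> site \<Rightarrow> site \<Rightarrow> real" where
  "edge f s x y z = (\<Sum>\<alpha>\<in>A. of_bool (\<alpha> x = s \<and> \<alpha> y = 1 - s \<and> \<alpha> z = 1 - s)
     * (w \<alpha> * hop s x y * (f \<alpha> - f (exchange x y \<alpha>))\<^sup>2))"

lemma edge_commute:
  assumes "x \<in> S" "y \<in> S" "z \<noteq> x" "z \<noteq> y" "s = 0 \<or> s = 1"
  shows "edge f s x y z = edge f s y x z"
proof -
  have "edge f s y x z = (\<Sum>\<alpha>\<in>A. of_bool (exchange x y \<alpha> y = s \<and> exchange x y \<alpha> x = 1 - s \<and> exchange x y \<alpha> z = 1 - s)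
     * (w (exchange x y \<alpha>) * hop s y x * (f (exchange x y \<alpha>) - f (exchange y x (exchange x y \<alpha>)))\<^sup>2))"
    unfolding edge_def by (rule sum_exchange[symmetric]) (use assms in auto)
  also have "\<dots> = edge f s x y z"
    unfolding edge_def
  proof (intro sum.cong refl)
    fix \<alpha>
    show "of_bool (exchange x y \<alpha> y = s \<and> exchange x y \<alpha> x = 1 - s \<and> exchange x y \<alpha> z = 1 - s)
     * (w (exchange x y \<alpha>) * hop s y x * (f (exchange x y \<alpha>) - f (exchange y x (exchange x y \<alpha>)))\<^sup>2)
     = of_bool (\<alpha> x = s \<and> \<alpha> y = 1 - s \<and> \<alpha> z = 1 - s) * (w \<alpha> * hop s x y * (f \<alpha> - f (exchange x y \<alpha>))\<^sup>2)"
      using hop_balance[OF assms(1,2,5), of \<alpha>] assms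
      by (auto simp: exchange_apply exchange_commute[of y x] exchange_exchange power2_commute)
  qed
  finally show ?thesis by simp
qed

end

section \<open>Triangles of bonds\<close>

locale bochner = exclusion +
  fixes e \<kappa> \<mu> :: real
  assumes e: "0 < e" "e \<le> 1" and kappa: "0 < \<kappa>"
    and mu: "0 \<le> \<mu>" "4 * \<mu> * (1 + 2 * q\<^sup>2 / (1 - q\<^sup>2)) \<le> 3" "2 * \<mu> \<le> 1"
begin

abbreviation t :: "nat \<Rightarrow> real" where "t \<equiv> decay e"

text \<open>\<open>beyond\<close> and \<open>between\<close> are the coefficients that a triangle
  grants to its sides. A zero argument next to a nonzero one means that the third site lies in the
  layer of an end; those are the terms from which the factor \<open>L\<close> arises.\<close>

definition beyond :: "nat \<Rightarrow> nat \<Rightarrow> real" where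
  "beyond m n = (if m = 0 then 0 else if n = 0 then q ^ (2 * m) * (t m)\<^sup>2 else - loss q e \<kappa> \<mu> m n)"

definition between :: "nat \<Rightarrow> nat \<Rightarrow> real" where
  "between m n = (if m = 0 \<and> n = 0 then 0
    else if m = 0 \<or> n = 0 then q ^ (2 * (m + n)) * (t (m + n))\<^sup>2 else gain e \<mu> m n)"

lemma between_commute: "between m n = between n m"
  by (simp add: between_def gain_def add.commute)

lemma triangle_form:
  fixes a b :: real
  shows "beyond m n * a\<^sup>2 + beyond n m * q ^ (2 * n) * b\<^sup>2 + between m n * q ^ (2 * n) * (a + b)\<^sup>2
    \<le> q ^ (2 * n) * (2 * (q ^ (2 * m) * t m * t (m + n) * (a * (a + b))
        - t n * (t m - t (m + n)) * (a * b) + t n * t (m + n) * b\<^sup>2))"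
proof -
  have tp: "0 < t d" "t d \<le> 1" for d using e by (simp_all add: decay_pos decay_le_1)
  have qp: "0 < q ^ (2 * d)" "q ^ (2 * d) \<le> 1" for d using q by (auto simp: power_le_one)
  consider "m = 0" "n = 0" | "m = 0" "n \<noteq> 0" | "m \<noteq> 0" "n = 0" | "1 \<le> m" "1 \<le> n" by linarith
  then show ?thesis
  proof cases
    case 1
    have "0 \<le> (a + b)\<^sup>2 + a\<^sup>2 + b\<^sup>2" by simp
    also have "\<dots> = 2 * (a * (a + b) + b\<^sup>2)"
      by (simp add: algebra_simps power2_eq_square)
    finally have "0 \<le> 2 * (a * (a + b) + b\<^sup>2)" .
    then show ?thesis using 1 by (simp add: beyond_def between_def)
  next
    case 2
    define r u where "r = q ^ (2 * n)" and "u = t n"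
    have u: "0 < u" "u \<le> 1" "u * u \<le> u" and r: "0 < r" "r \<le> 1"
      using tp[of n] qp[of n] by (auto simp: u_def r_def mult_left_le)
    \<comment> \<open>A factor \<open>r\<close> is given away: when the two lighter sites share a
      layer instead, only the smaller coefficient is available, and \<open>third\<close> does not
      distinguish the two situations.\<close>
    have "r * (r * u\<^sup>2 * (b\<^sup>2 + (a + b)\<^sup>2)) \<le> 1 * (r * u\<^sup>2 * (b\<^sup>2 + (a + b)\<^sup>2))"
      using r by (intro mult_right_mono) auto
    moreover have "0 \<le> r * ((2 * u - u * u) * a\<^sup>2)" using u r by simp
    moreover have "r * (2 * (u * (a * (a + b)) - u * (1 - u) * (a * b) + u * u * b\<^sup>2))
        = r * ((2 * u - u * u) * a\<^sup>2) + r * u\<^sup>2 * (b\<^sup>2 + (a + b)\<^sup>2)"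
      by (simp add: algebra_simps power2_eq_square)
    ultimately have "r * (r * u\<^sup>2 * (b\<^sup>2 + (a + b)\<^sup>2))
       \<le> r * (2 * (u * (a * (a + b)) - u * (1 - u) * (a * b) + u * u * b\<^sup>2))" by linarith
    moreover have "beyond m n = 0" "beyond n m = r * u\<^sup>2" "between m n = r * u\<^sup>2" "m + n = n" "t m = 1" "q ^ (2 * m) = 1"
      using 2 by (simp_all add: beyond_def between_def r_def u_def)
    ultimately show ?thesis
      unfolding r_def[symmetric] u_def[symmetric] by (simp add: r_def[symmetric] u_def[symmetric] distrib_left mult.assoc mult.left_commute)
  next
    case 3
    define p u where "p = q ^ (2 * m)" and "u = t m"
    have u: "0 < u" "u \<le> 1" and p: "0 < p" "p \<le> 1"
      using tp[of m] qp[of m] by (auto simp: u_def p_def)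
    have "p * (u * u) \<le> 1 * (u * 1)" using u p by (intro mult_mono) auto
    then have "0 \<le> (2 * u - p * u * u) * b\<^sup>2" using u by simp
    moreover have "2 * (p * u * u * (a * (a + b)) + u * b\<^sup>2)
        = p * u\<^sup>2 * (a\<^sup>2 + (a + b)\<^sup>2) + (2 * u - p * u * u) * b\<^sup>2"
      by (simp add: algebra_simps power2_eq_square)
    ultimately have "p * u\<^sup>2 * (a\<^sup>2 + (a + b)\<^sup>2) \<le> 2 * (p * u * u * (a * (a + b)) + u * b\<^sup>2)" by linarith
    moreover have "beyond m n = p * u\<^sup>2" "beyond n m = 0" "between m n = p * u\<^sup>2" "m + n = m" "t n = 1" "q ^ (2 * n) = 1"
      using 3 by (simp_all add: beyond_def between_def p_def u_def)
    ultimately show ?thesis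
      unfolding p_def[symmetric] u_def[symmetric] by (simp add: p_def[symmetric] u_def[symmetric] distrib_left mult.assoc mult.left_commute)
  next
    case 4
    then show ?thesis
      using triangle_form_radial[OF q e kappa mu 4, of a b] by (simp add: beyond_def between_def)
  qed
qed

definition third :: "site \<Rightarrow> site \<Rightarrow> site \<Rightarrow> real" where
  "third x y z = (let a = min (snd x) (snd y); b = max (snd x) (snd y); c = snd z in
     if c < a then beyond (b - a) (a - c) else if b < c then beyond (b - a) (c - b)
     else between (c - a) (b - c))"

lemma third_commute: "third x y z = third y x z"
  by (simp add: third_def min.commute max.commute)

text \<open>Sites in a common layer can be sorted in two ways. The values of \<open>beyond\<close>
  and \<open>between\<close> at zero arguments are matched so that either sorting yields the same
  coefficient.\<close>

lemma third_sorted: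
  assumes "snd x \<le> snd y \<and> snd y \<le> snd z \<or> snd z \<le> snd y \<and> snd y \<le> snd x"
  shows "third x y z = beyond (layer_dist x y) (layer_dist y z)"
    "third y z x = beyond (layer_dist y z) (layer_dist x y)"
    "third x z y = between (layer_dist x y) (layer_dist y z)"
  using assms
  by (auto simp: third_def layer_dist_def Let_def min_def max_def between_commute beyond_def between_def)

abbreviation tt :: "site \<Rightarrow> site \<Rightarrow> real" where "tt x y \<equiv> t (layer_dist x y)"

definition cross :: "(config \<Rightarrow> real) \<Rightarrow> nat \<Rightarrow> site \<Rightarrow> site \<Rightarrow> site \<Rightarrow> real" where
  "cross f s x y z = (\<Sum>\<alpha>\<in>A. of_bool (\<alpha> x = s \<and> \<alpha> y = 1 - s \<and> \<alpha> z = 1 - s)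
     * (w \<alpha> * (tt x y * hop s x y) * (tt x z * hop s x z)
        * ((f \<alpha> - f (exchange x y \<alpha>)) * (f \<alpha> - f (exchange x z \<alpha>)))))"

lemma cross_commute: "cross f s x y z = cross f s x z y"
  unfolding cross_def by (intro sum.cong refl) (auto simp: mult_ac)

text \<open>Reversibility transports the cross term centred at \<open>y\<close> to configurations
  with the value \<open>s\<close> at \<open>x\<close>, so that the three cross terms of a triangle
  can be compared configuration by configuration.\<close>

lemma cross_shift:
  assumes S: "x \<in> S" "y \<in> S" and d: "x \<noteq> y" "y \<noteq> z" "x \<noteq> z" and s: "s = 0 \<or> s = 1"
  shows "cross f s y x z = (\<Sum>\<alpha>\<in>A. of_bool (\<alpha> x = s \<and> \<alpha> y = 1 - s \<and> \<alpha> z = 1 - s)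
     * (w \<alpha> * hop s x y * tt x y * (tt y z * hop s y z)
        * ((f (exchange x y \<alpha>) - f \<alpha>) * (f (exchange x y \<alpha>) - f (exchange x z \<alpha>)))))"
proof -
  let ?h = "\<lambda>\<beta>. of_bool (\<beta> y = s \<and> \<beta> x = 1 - s \<and> \<beta> z = 1 - s)
     * (w \<beta> * (tt y x * hop s y x) * (tt y z * hop s y z)
        * ((f \<beta> - f (exchange y x \<beta>)) * (f \<beta> - f (exchange y z \<beta>))))"
  have "cross f s y x z = (\<Sum>\<alpha>\<in>A. ?h (exchange x y \<alpha>))"
    unfolding cross_def by (rule sum_exchange[symmetric]) (use S in auto)
  also have "\<dots> = (\<Sum>\<alpha>\<in>A. of_bool (\<alpha> x = s \<and> \<alpha> y = 1 - s \<and> \<alpha> z = 1 - s)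
     * (w \<alpha> * hop s x y * tt x y * (tt y z * hop s y z)
        * ((f (exchange x y \<alpha>) - f \<alpha>) * (f (exchange x y \<alpha>) - f (exchange x z \<alpha>)))))"
  proof (intro sum.cong refl)
    fix \<alpha>
    show "?h (exchange x y \<alpha>) = of_bool (\<alpha> x = s \<and> \<alpha> y = 1 - s \<and> \<alpha> z = 1 - s)
     * (w \<alpha> * hop s x y * tt x y * (tt y z * hop s y z)
        * ((f (exchange x y \<alpha>) - f \<alpha>) * (f (exchange x y \<alpha>) - f (exchange x z \<alpha>))))"
    proof (cases "\<alpha> x = s \<and> \<alpha> y = 1 - s \<and> \<alpha> z = 1 - s")
      case True
      then have "exchange y z (exchange x y \<alpha>) = exchange x z \<alpha>"
        using d by (auto simp: exchange_apply fun_eq_iff)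
      moreover have "w (exchange x y \<alpha>) * (tt y x * hop s y x) = w \<alpha> * hop s x y * tt x y"
        using hop_balance[OF S s, of \<alpha>] True by (simp add: layer_dist_commute[of y x])
      ultimately show ?thesis
        using True d by (simp add: exchange_apply exchange_commute[of y x] exchange_exchange)
    qed (use d in \<open>auto simp: exchange_apply\<close>)
  qed
  finally show ?thesis .
qed

lemma edge_shift:
  assumes S: "x \<in> S" "y \<in> S" and d: "x \<noteq> y" "y \<noteq> z" "x \<noteq> z" and s: "s = 0 \<or> s = 1"
    and le: "depth s x \<le> depth s y"
  shows "edge f s y z x = (\<Sum>\<alpha>\<in>A. of_bool (\<alpha> x = s \<and> \<alpha> y = 1 - s \<and> \<alpha> z = 1 - s)
     * (w \<alpha> * hop s x y * hop s y z * (f (exchange x y \<alpha>) - f (exchange x z \<alpha>))\<^sup>2))"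
proof -
  let ?h = "\<lambda>\<beta>. of_bool (\<beta> y = s \<and> \<beta> z = 1 - s \<and> \<beta> x = 1 - s)
     * (w \<beta> * hop s y z * (f \<beta> - f (exchange y z \<beta>))\<^sup>2)"
  have "edge f s y z x = (\<Sum>\<alpha>\<in>A. ?h (exchange x y \<alpha>))"
    unfolding edge_def by (rule sum_exchange[symmetric]) (use S in auto)
  also have "\<dots> = (\<Sum>\<alpha>\<in>A. of_bool (\<alpha> x = s \<and> \<alpha> y = 1 - s \<and> \<alpha> z = 1 - s)
     * (w \<alpha> * hop s x y * hop s y z * (f (exchange x y \<alpha>) - f (exchange x z \<alpha>))\<^sup>2))"
  proof (intro sum.cong refl)
    fix \<alpha>
    show "?h (exchange x y \<alpha>) = of_bool (\<alpha> x = s \<and> \<alpha> y = 1 - s \<and> \<alpha> z = 1 - s)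
     * (w \<alpha> * hop s x y * hop s y z * (f (exchange x y \<alpha>) - f (exchange x z \<alpha>))\<^sup>2)"
    proof (cases "\<alpha> x = s \<and> \<alpha> y = 1 - s \<and> \<alpha> z = 1 - s")
      case True
      then have "exchange y z (exchange x y \<alpha>) = exchange x z \<alpha>"
        using d by (auto simp: exchange_apply fun_eq_iff)
      moreover have "w (exchange x y \<alpha>) = w \<alpha> * hop s x y"
        using hop_balance[OF S s, of \<alpha>] True le by (simp add: hop_def[of s y x])
      ultimately show ?thesis
        using True d by (simp add: exchange_apply)
    qed (use d in \<open>auto simp: exchange_apply\<close>)
  qed
  finally show ?thesis .
qed

lemma cross_triangle_sorted:
  assumes S: "x \<in> S" "y \<in> S" "z \<in> S" and d: "x \<noteq> y" "y \<noteq> z" "x \<noteq> z" and s: "s = 0 \<or> s = 1"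
    and le: "depth s x \<le> depth s y" "depth s y \<le> depth s z"
  shows "third x y z * edge f s x y z + third y z x * edge f s y z x + third x z y * edge f s x z y
    \<le> 2 * (cross f s x y z + cross f s y x z + cross f s z x y)"
proof -
  define m n where "m = layer_dist x y" and "n = layer_dist y z"
  have sorted: "snd x \<le> snd y \<and> snd y \<le> snd z \<or> snd z \<le> snd y \<and> snd y \<le> snd x"
    using le s by (auto simp: depth_def)
  have mn: "layer_dist x z = m + n" "hop s x y = q ^ (2 * m)" "hop s y z = q ^ (2 * n)"
    "hop s x z = q ^ (2 * m) * q ^ (2 * n)"
    using le s by (auto simp: depth_def m_def n_def layer_dist_def hop_def nat_diff_distrib' simp flip: power_add
        intro!: arg_cong[where f = "\<lambda>k. q ^ k"])
  have hz: "hop s z y = 1" using le by (simp add: hop_def)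
  let ?T = "\<lambda>\<alpha>. \<alpha> x = s \<and> \<alpha> y = 1 - s \<and> \<alpha> z = 1 - s"
  have e2: "edge f s x z y = (\<Sum>\<alpha>\<in>A. of_bool (?T \<alpha>) * (w \<alpha> * hop s x z * (f \<alpha> - f (exchange x z \<alpha>))\<^sup>2))"
    unfolding edge_def by (intro sum.cong refl) auto
  have c3: "cross f s z x y = (\<Sum>\<alpha>\<in>A. of_bool (?T \<alpha>)
     * (w \<alpha> * hop s x z * tt x z * (tt z y * hop s z y)
        * ((f (exchange x z \<alpha>) - f \<alpha>) * (f (exchange x z \<alpha>) - f (exchange x y \<alpha>)))))"
    unfolding cross_shift[OF S(1,3) d(3) d(2)[symmetric] d(1) s] by (intro sum.cong refl) auto
  show ?thesis
    unfolding third_sorted[OF sorted] m_def[symmetric] n_def[symmetric]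
    unfolding edge_def[of f s x y z] edge_shift[OF S(1,2) d s le(1)] e2
      cross_def[of f s x y z] cross_shift[OF S(1,2) d s] c3
      sum_distrib_left sum.distrib[symmetric]
  proof (rule sum_mono)
    fix \<alpha>
    show "beyond m n * (of_bool (?T \<alpha>) * (w \<alpha> * hop s x y * (f \<alpha> - f (exchange x y \<alpha>))\<^sup>2))
      + beyond n m * (of_bool (?T \<alpha>) * (w \<alpha> * hop s x y * hop s y z * (f (exchange x y \<alpha>) - f (exchange x z \<alpha>))\<^sup>2))
      + between m n * (of_bool (?T \<alpha>) * (w \<alpha> * hop s x z * (f \<alpha> - f (exchange x z \<alpha>))\<^sup>2))
      \<le> 2 * (of_bool (?T \<alpha>) * (w \<alpha> * (tt x y * hop s x y) * (tt x z * hop s x z)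
          * ((f \<alpha> - f (exchange x y \<alpha>)) * (f \<alpha> - f (exchange x z \<alpha>))))
        + of_bool (?T \<alpha>) * (w \<alpha> * hop s x y * tt x y * (tt y z * hop s y z)
          * ((f (exchange x y \<alpha>) - f \<alpha>) * (f (exchange x y \<alpha>) - f (exchange x z \<alpha>))))
        + of_bool (?T \<alpha>) * (w \<alpha> * hop s x z * tt x z * (tt z y * hop s z y)
          * ((f (exchange x z \<alpha>) - f \<alpha>) * (f (exchange x z \<alpha>) - f (exchange x y \<alpha>)))))"
    proof (cases "?T \<alpha>")
      case True
      define a b where "a = f \<alpha> - f (exchange x y \<alpha>)" and "b = f (exchange x y \<alpha>) - f (exchange x z \<alpha>)"
      have ab: "f \<alpha> - f (exchange x z \<alpha>) = a + b" "f (exchange x y \<alpha>) - f \<alpha> = - a"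
        "f (exchange x z \<alpha>) - f \<alpha> = - (a + b)" "f (exchange x z \<alpha>) - f (exchange x y \<alpha>) = - b"
        by (simp_all add: a_def b_def)
      \<comment> \<open>The three cross terms carry the common factor
        \<open>w \<alpha> * q ^ (2 * m) * q ^ (2 * n)\<close>; its last part is already contained in
        \<open>triangle_form\<close>.\<close>
      have "w \<alpha> * q ^ (2 * m) * (beyond m n * a\<^sup>2 + beyond n m * q ^ (2 * n) * b\<^sup>2 + between m n * q ^ (2 * n) * (a + b)\<^sup>2)
        \<le> w \<alpha> * q ^ (2 * m) * (q ^ (2 * n) * (2 * (q ^ (2 * m) * t m * t (m + n) * (a * (a + b))
        - t n * (t m - t (m + n)) * (a * b) + t n * t (m + n) * b\<^sup>2)))"
        using w_pos[of \<alpha>] q by (intro mult_left_mono triangle_form) auto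
      then show ?thesis
        using True unfolding ab a_def[symmetric] b_def[symmetric] hz mn layer_dist_commute[of z y]
          m_def[symmetric] n_def[symmetric]
        by (simp add: algebra_simps power2_eq_square)
    qed auto
  qed
qed

text \<open>Both sides are invariant under relabelling the sites, so the depths may be assumed
  sorted; the transpositions \<open>sym1\<close> and \<open>sym2\<close> reach all six
  orders.\<close>

lemma cross_triangle:
  assumes S: "x \<in> S" "y \<in> S" "z \<in> S" and d: "x \<noteq> y" "y \<noteq> z" "x \<noteq> z" and s: "s = 0 \<or> s = 1"
  shows "third x y z * edge f s x y z + third y z x * edge f s y z x + third x z y * edge f s x z y
    \<le> 2 * (cross f s x y z + cross f s y x z + cross f s z x y)" (is "?P x y z")
proof -
  have sym1: "?P a b c \<Longrightarrow> ?P b a c" if "a \<in> S" "b \<in> S" "c \<in> S" "a \<noteq> b" "b \<noteq> c" "a \<noteq> c" for a b c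
    using that s edge_commute[of a b c s f] edge_commute[of a c b s f] edge_commute[of b c a s f]
    by (simp add: third_commute[of b a] third_commute[of c a] third_commute[of c b]
        cross_commute[of f s c b a] add_ac)
  have sym2: "?P a b c \<Longrightarrow> ?P a c b" if "a \<in> S" "b \<in> S" "c \<in> S" "a \<noteq> b" "b \<noteq> c" "a \<noteq> c" for a b c
    using that s edge_commute[of a b c s f] edge_commute[of a c b s f] edge_commute[of b c a s f]
    by (simp add: third_commute[of b a] third_commute[of c a] third_commute[of c b]
        cross_commute[of f s a c b] cross_commute[of f s b a c] cross_commute[of f s c a b] add_ac)
  have main: "?P a b c" if "a \<in> S" "b \<in> S" "c \<in> S" "a \<noteq> b" "b \<noteq> c" "a \<noteq> c"
    "depth s a \<le> depth s b" "depth s b \<le> depth s c" for a b c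
    by (rule cross_triangle_sorted) (use that s in auto)
  consider "depth s x \<le> depth s y" "depth s y \<le> depth s z" | "depth s x \<le> depth s z" "depth s z \<le> depth s y"
    | "depth s y \<le> depth s x" "depth s x \<le> depth s z" | "depth s y \<le> depth s z" "depth s z \<le> depth s x"
    | "depth s z \<le> depth s x" "depth s x \<le> depth s y" | "depth s z \<le> depth s y" "depth s y \<le> depth s x"
    by linarith
  then show ?thesis
  proof cases
    case 1 then show ?thesis using main[of x y z] S d by auto
  next
    case 2 then show ?thesis using sym2[OF _ _ _ _ _ _ main[of x z y]] S d by auto
  next
    case 3 then show ?thesis using sym1[OF _ _ _ _ _ _ main[of y x z]] S d by auto
  next
    case 4
    then have "?P y z x" using main[of y z x] S d by auto
    then have "?P y x z" using sym2[of y z x] S d by auto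
    then show ?thesis using sym1[of y x z] S d by auto
  next
    case 5
    then have "?P z x y" using main[of z x y] S d by auto
    then have "?P x z y" using sym1[of z x y] S d by auto
    then show ?thesis using sym2[of x z y] S d by auto
  next
    case 6
    then have "?P z y x" using main[of z y x] S d by auto
    then have "?P y z x" using sym1[of z y x] S d by auto
    then have "?P y x z" using sym2[of y z x] S d by auto
    then show ?thesis using sym1[of y x z] S d by auto
  qed
qed

end

section \<open>Pairs of bonds\<close>

lemma sum_sum_diagonal:
  fixes g :: "'a \<Rightarrow> 'a \<Rightarrow> real"
  assumes "finite X"
  shows "(\<Sum>x\<in>X. \<Sum>y\<in>X. g x y) = (\<Sum>x\<in>X. g x x) + (\<Sum>x\<in>X. \<Sum>y\<in>X. of_bool (x \<noteq> y) * g x y)"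
proof -
  have "(\<Sum>y\<in>X. g x y) = g x x + (\<Sum>y\<in>X. of_bool (x \<noteq> y) * g x y)" if "x \<in> X" for x
  proof -
    have "(\<Sum>y\<in>X. of_bool (x \<noteq> y) * g x y) = (\<Sum>y\<in>X - {x}. g x y)"
      using assms by (intro sum.mono_neutral_cong_right) auto
    then show ?thesis using sum.remove[OF assms that, of "g x"] by simp
  qed
  then show ?thesis by (simp add: sum.distrib)
qed

lemma sum3_permute:
  fixes g :: "'a \<Rightarrow> 'a \<Rightarrow> 'a \<Rightarrow> real"
  shows "(\<Sum>x\<in>X. \<Sum>y\<in>X. \<Sum>z\<in>X. g y x z) = (\<Sum>x\<in>X. \<Sum>y\<in>X. \<Sum>z\<in>X. g x y z)"
    "(\<Sum>x\<in>X. \<Sum>y\<in>X. \<Sum>z\<in>X. g x z y) = (\<Sum>x\<in>X. \<Sum>y\<in>X. \<Sum>z\<in>X. g x y z)"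
    "(\<Sum>x\<in>X. \<Sum>y\<in>X. \<Sum>z\<in>X. g z x y) = (\<Sum>x\<in>X. \<Sum>y\<in>X. \<Sum>z\<in>X. g x y z)"
    "(\<Sum>x\<in>X. \<Sum>y\<in>X. \<Sum>z\<in>X. g y z x) = (\<Sum>x\<in>X. \<Sum>y\<in>X. \<Sum>z\<in>X. g x y z)"
proof -
  have a: "(\<Sum>x\<in>X. \<Sum>y\<in>X. \<Sum>z\<in>X. h y x z) = (\<Sum>x\<in>X. \<Sum>y\<in>X. \<Sum>z\<in>X. h x y z)" for h :: "'a \<Rightarrow> 'a \<Rightarrow> 'a \<Rightarrow> real"
    by (rule sum.swap)
  have b: "(\<Sum>x\<in>X. \<Sum>y\<in>X. \<Sum>z\<in>X. h x z y) = (\<Sum>x\<in>X. \<Sum>y\<in>X. \<Sum>z\<in>X. h x y z)" for h :: "'a \<Rightarrow> 'a \<Rightarrow> 'a \<Rightarrow> real"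
    by (rule sum.cong[OF refl]) (rule sum.swap)
  show "(\<Sum>x\<in>X. \<Sum>y\<in>X. \<Sum>z\<in>X. g y x z) = (\<Sum>x\<in>X. \<Sum>y\<in>X. \<Sum>z\<in>X. g x y z)"
    "(\<Sum>x\<in>X. \<Sum>y\<in>X. \<Sum>z\<in>X. g x z y) = (\<Sum>x\<in>X. \<Sum>y\<in>X. \<Sum>z\<in>X. g x y z)" by (rule a, rule b)
  show "(\<Sum>x\<in>X. \<Sum>y\<in>X. \<Sum>z\<in>X. g z x y) = (\<Sum>x\<in>X. \<Sum>y\<in>X. \<Sum>z\<in>X. g x y z)"
    using b[of "\<lambda>x y z. g y x z"] a[of g] by simp
  show "(\<Sum>x\<in>X. \<Sum>y\<in>X. \<Sum>z\<in>X. g y z x) = (\<Sum>x\<in>X. \<Sum>y\<in>X. \<Sum>z\<in>X. g x y z)"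
    using a[of "\<lambda>x y z. g x z y"] b[of g] by simp
qed

lemma sum_Lattice_height: "(\<Sum>z\<in>Lattice L H. \<phi> (snd z)) = real L * (\<Sum>h=1..H. \<phi> h)"
proof -
  have "(\<Sum>z\<in>Lattice L H. \<phi> (snd z)) = (\<Sum>i=1..L. \<Sum>h=1..H. \<phi> h)"
    unfolding Lattice_def by (subst sum.cartesian_product) (simp add: case_prod_beta)
  then show ?thesis by simp
qed

context exclusion
begin

text \<open>The unnormalized quadratic form of a single bond at unit strength. By reversibility it
  does not depend on the orientation, so sums over ordered pairs count each bond twice.\<close>

definition conductance :: "(config \<Rightarrow> real) \<Rightarrow> site \<Rightarrow> site \<Rightarrow> real" where
  "conductance f x y = (\<Sum>\<alpha>\<in>A. of_bool (\<alpha> x = 1 \<and> \<alpha> y = 0) * (w \<alpha> * hop 1 x y * (f \<alpha> - f (exchange x y \<alpha>))\<^sup>2))"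

lemma conductance_nonneg: "0 \<le> conductance f x y"
  unfolding conductance_def using w_pos hop_pos by (intro sum_nonneg mult_nonneg_nonneg) (auto simp: less_imp_le)

lemma conductance_self: "conductance f x x = 0"
  unfolding conductance_def by (rule sum.neutral) auto

lemma conductance_commute:
  assumes "x \<in> S" "y \<in> S"
  shows "conductance f x y = conductance f y x"
proof (cases "x = y")
  case False
  let ?h = "\<lambda>\<beta>. of_bool (\<beta> y = 1 \<and> \<beta> x = 0) * (w \<beta> * hop 1 y x * (f \<beta> - f (exchange y x \<beta>))\<^sup>2)"
  have "conductance f y x = (\<Sum>\<alpha>\<in>A. ?h (exchange x y \<alpha>))"
    unfolding conductance_def by (rule sum_exchange[symmetric]) (use assms in auto)
  also have "\<dots> = conductance f x y"
    unfolding conductance_def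
  proof (intro sum.cong refl)
    fix \<alpha>
    show "?h (exchange x y \<alpha>) = of_bool (\<alpha> x = 1 \<and> \<alpha> y = 0) * (w \<alpha> * hop 1 x y * (f \<alpha> - f (exchange x y \<alpha>))\<^sup>2)"
      using hop_balance[OF assms, of 1 \<alpha>] False
      by (auto simp: exchange_apply exchange_commute[of y x] exchange_exchange power2_commute)
  qed
  finally show ?thesis by simp
qed simp

text \<open>The value at \<open>z\<close> decides whether the triangle holds one particle or two. In
  the second case the hole moves from \<open>y\<close> to \<open>x\<close>, which is why the
  arguments are reversed.\<close>

lemma conductance_split:
  assumes "z \<in> S"
  shows "conductance f x y = edge f 1 x y z + edge f 0 y x z"
proof -
  have e0: "edge f 0 y x z = (\<Sum>\<alpha>\<in>A. of_bool (\<alpha> y = 0 \<and> \<alpha> x = 1 \<and> \<alpha> z = 1)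
     * (w \<alpha> * hop 1 x y * (f \<alpha> - f (exchange x y \<alpha>))\<^sup>2))"
    unfolding edge_def using hop_flip[of 1 y x] by (simp add: exchange_commute[of y x])
  show ?thesis
    unfolding conductance_def edge_def[of f 1] e0 sum.distrib[symmetric]
  proof (intro sum.cong refl)
    fix \<alpha> assume "\<alpha> \<in> A"
    then show "of_bool (\<alpha> x = 1 \<and> \<alpha> y = 0) * (w \<alpha> * hop 1 x y * (f \<alpha> - f (exchange x y \<alpha>))\<^sup>2)
      = of_bool (\<alpha> x = 1 \<and> \<alpha> y = 1 - 1 \<and> \<alpha> z = 1 - 1) * (w \<alpha> * hop 1 x y * (f \<alpha> - f (exchange x y \<alpha>))\<^sup>2)
      + of_bool (\<alpha> y = 0 \<and> \<alpha> x = 1 \<and> \<alpha> z = 1) * (w \<alpha> * hop 1 x y * (f \<alpha> - f (exchange x y \<alpha>))\<^sup>2)"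
      using Omega_N_01[OF _ assms, of \<alpha> N] by (cases "\<alpha> z = 0") auto
  qed
qed

end

context bochner
begin

definition jump :: "(config \<Rightarrow> real) \<Rightarrow> site \<Rightarrow> site \<Rightarrow> config \<Rightarrow> real" where
  "jump f x y \<alpha> = of_bool (\<alpha> x = 1 \<and> \<alpha> y = 0) * (tt x y * hop 1 x y * (f \<alpha> - f (exchange x y \<alpha>)))"

definition gen :: "(config \<Rightarrow> real) \<Rightarrow> config \<Rightarrow> real" where
  "gen f \<alpha> = (\<Sum>x\<in>S. \<Sum>y\<in>S. jump f x y \<alpha>)"

definition pairing :: "(config \<Rightarrow> real) \<Rightarrow> site \<Rightarrow> site \<Rightarrow> site \<Rightarrow> site \<Rightarrow> real" where
  "pairing f x y x' y' = (\<Sum>\<alpha>\<in>A. w \<alpha> * (jump f x y \<alpha> * jump f x' y' \<alpha>))"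

lemma pairing_diag: "pairing f x y x y = (tt x y)\<^sup>2 * hop 1 x y * conductance f x y"
  unfolding pairing_def jump_def conductance_def sum_distrib_left
  by (intro sum.cong refl) (auto simp: power2_eq_square mult_ac)

lemma pairing_particle: "pairing f x y x y' = cross f 1 x y y'"
  unfolding pairing_def jump_def cross_def by (intro sum.cong refl) (auto simp: mult_ac)

lemma pairing_hole: "pairing f x y x' y = cross f 0 y x x'"
  unfolding pairing_def jump_def cross_def
  using hop_flip[of 1 y x] hop_flip[of 1 y x']
  by (intro sum.cong refl)
    (auto simp: exchange_commute[of y x] exchange_commute[of y x'] layer_dist_commute[of y x] layer_dist_commute[of y x'] mult_ac)

definition disjoint4 :: "'a \<Rightarrow> 'a \<Rightarrow> 'a \<Rightarrow> 'a \<Rightarrow> bool" where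
  "disjoint4 x y x' y' \<longleftrightarrow> x \<noteq> y \<and> x \<noteq> x' \<and> x \<noteq> y' \<and> y \<noteq> x' \<and> y \<noteq> y' \<and> x' \<noteq> y'"

text \<open>Moves on disjoint pairs of sites commute, and summing over the four orientations of the two
  pairs produces the square of a mixed second difference.\<close>

lemma pairing_disjoint:
  assumes S: "x \<in> S" "y \<in> S" "x' \<in> S" "y' \<in> S" and d: "disjoint4 x y x' y'"
  shows "0 \<le> pairing f x y x' y' + pairing f y x x' y' + pairing f x y y' x' + pairing f y x y' x'"
proof -
  let ?u = "\<lambda>x y x' y' \<alpha>. w \<alpha> * (jump f x y \<alpha> * jump f x' y' \<alpha>)"
  have 1: "pairing f y x x' y' = (\<Sum>\<alpha>\<in>A. ?u y x x' y' (exchange x y \<alpha>))"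
    unfolding pairing_def by (rule sum_exchange[symmetric]) (use S in auto)
  have 2: "pairing f x y y' x' = (\<Sum>\<alpha>\<in>A. ?u x y y' x' (exchange x' y' \<alpha>))"
    unfolding pairing_def by (rule sum_exchange[symmetric]) (use S in auto)
  have "pairing f y x y' x' = (\<Sum>\<alpha>\<in>A. ?u y x y' x' (exchange x y \<alpha>))"
    unfolding pairing_def by (rule sum_exchange[symmetric]) (use S in auto)
  also have "\<dots> = (\<Sum>\<alpha>\<in>A. ?u y x y' x' (exchange x y (exchange x' y' \<alpha>)))"
    by (rule sum_exchange[symmetric, where g = "\<lambda>\<alpha>. ?u y x y' x' (exchange x y \<alpha>)"]) (use S in auto)
  finally have 3: "pairing f y x y' x' = (\<Sum>\<alpha>\<in>A. ?u y x y' x' (exchange x y (exchange x' y' \<alpha>)))" .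
  show ?thesis
    unfolding 1 2 3 unfolding pairing_def sum.distrib[symmetric]
  proof (rule sum_nonneg)
    fix \<alpha>
    let ?b = "exchange x y" and ?c = "exchange x' y'"
    show "0 \<le> ?u x y x' y' \<alpha> + ?u y x x' y' (?b \<alpha>) + ?u x y y' x' (?c \<alpha>) + ?u y x y' x' (?b (?c \<alpha>))"
    proof (cases "\<alpha> x = 1 \<and> \<alpha> y = 0 \<and> \<alpha> x' = 1 \<and> \<alpha> y' = 0")
      case True
      define k where "k = w \<alpha> * (tt x y * hop 1 x y) * (tt x' y' * hop 1 x' y')"
      have comm: "?b (?c \<beta>) = ?c (?b \<beta>)" for \<beta>
        using d by (auto simp: exchange_apply fun_eq_iff disjoint4_def)
      have vals: "?b \<alpha> x = 0" "?b \<alpha> y = 1" "?b \<alpha> x' = 1" "?b \<alpha> y' = 0"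
        "?c \<alpha> x = 1" "?c \<alpha> y = 0" "?c \<alpha> x' = 0" "?c \<alpha> y' = 1"
        "?c (?b \<alpha>) x = 0" "?c (?b \<alpha>) y = 1" "?c (?b \<alpha>) x' = 0" "?c (?b \<alpha>) y' = 1"
        using d True by (auto simp: exchange_apply disjoint4_def)
      have b1: "w (?b \<alpha>) * hop 1 y x = w \<alpha> * hop 1 x y"
        using hop_balance[OF S(1,2), of 1 \<alpha>] True by simp
      have c1: "w (?c \<alpha>) * hop 1 y' x' = w \<alpha> * hop 1 x' y'"
        using hop_balance[OF S(3,4), of 1 \<alpha>] True by simp
      have bc1: "w (?c (?b \<alpha>)) * hop 1 y' x' = w (?b \<alpha>) * hop 1 x' y'"
        using hop_balance[OF S(3,4), of 1 "?b \<alpha>"] vals by simp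
      have exch: "exchange y x \<beta> = ?b \<beta>" "exchange y' x' \<beta> = ?c \<beta>" for \<beta>
        by (simp_all add: exchange_commute)
      let ?f0 = "f \<alpha>" and ?f1 = "f (?b \<alpha>)" and ?f2 = "f (?c \<alpha>)" and ?f3 = "f (?c (?b \<alpha>))"
      have e0: "?u x y x' y' \<alpha> = k * ((?f0 - ?f1) * (?f0 - ?f2))"
        using True by (simp add: jump_def k_def)
      have e1: "?u y x x' y' (?b \<alpha>) = k * ((?f1 - ?f0) * (?f1 - ?f3))"
        using vals b1[symmetric]
        by (simp add: jump_def k_def exch exchange_exchange layer_dist_commute[of y x] mult_ac)
      have e2: "?u x y y' x' (?c \<alpha>) = k * ((?f2 - ?f3) * (?f2 - ?f0))"
      proof -
        have "?u x y y' x' (?c \<alpha>) = w (?c \<alpha>) * hop 1 y' x' * (tt x y * hop 1 x y) * tt x' y'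
            * ((?f2 - ?f3) * (?f2 - ?f0))"
          using vals by (simp add: jump_def exch exchange_exchange comm layer_dist_commute[of y' x'])
        then show ?thesis unfolding c1 k_def by simp
      qed
      have e3: "?u y x y' x' (?b (?c \<alpha>)) = k * ((?f3 - ?f2) * (?f3 - ?f1))"
      proof -
        have "?u y x y' x' (?b (?c \<alpha>)) = w (?c (?b \<alpha>)) * hop 1 y' x' * hop 1 y x * tt x y * tt x' y'
            * ((?f3 - ?f2) * (?f3 - ?f1))"
          using vals
          by (simp add: jump_def exch exchange_exchange comm layer_dist_commute[of y' x'] layer_dist_commute[of y x])
        also have "\<dots> = (w (?b \<alpha>) * hop 1 y x) * hop 1 x' y' * tt x y * tt x' y' * ((?f3 - ?f2) * (?f3 - ?f1))"
          unfolding bc1 by simp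
        finally show ?thesis unfolding b1 k_def by simp
      qed
      have "0 \<le> k" using w_pos[of \<alpha>] hop_pos e by (simp add: k_def less_imp_le decay_pos)
      then have "0 \<le> k * (?f0 - ?f1 - ?f2 + ?f3)\<^sup>2" by simp
      also have "\<dots> = k * ((?f0 - ?f1) * (?f0 - ?f2)) + k * ((?f1 - ?f0) * (?f1 - ?f3))
          + k * ((?f2 - ?f3) * (?f2 - ?f0)) + k * ((?f3 - ?f2) * (?f3 - ?f1))"
        by (simp add: algebra_simps power2_eq_square)
      finally show ?thesis unfolding e0 e1 e2 e3 .
    next
      case False
      then have "jump f x y \<alpha> * jump f x' y' \<alpha> = 0"
        "jump f y x (?b \<alpha>) * jump f x' y' (?b \<alpha>) = 0"
        "jump f x y (?c \<alpha>) * jump f y' x' (?c \<alpha>) = 0"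
        "jump f y x (?b (?c \<alpha>)) * jump f y' x' (?b (?c \<alpha>)) = 0"
        using d by (auto simp: jump_def exchange_apply disjoint4_def)
      then show ?thesis by (simp only: mult_zero_right add_0_left order_refl)
    qed
  qed
qed

end

section \<open>The Bochner inequality\<close>

context bochner
begin

lemma sum_pairing_disjoint_nonneg:
  "0 \<le> (\<Sum>x\<in>S. \<Sum>y\<in>S. \<Sum>x'\<in>S. \<Sum>y'\<in>S. of_bool (disjoint4 x y x' y') * pairing f x y x' y')"
proof -
  let ?g = "\<lambda>x y x' y'. of_bool (disjoint4 x y x' y') * pairing f x y x' y'"
  let ?D = "\<Sum>x\<in>S. \<Sum>y\<in>S. \<Sum>x'\<in>S. \<Sum>y'\<in>S. ?g x y x' y'"
  have 1: "(\<Sum>x\<in>S. \<Sum>y\<in>S. \<Sum>x'\<in>S. \<Sum>y'\<in>S. ?g y x x' y') = ?D" by (rule sum.swap)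
  have 2: "(\<Sum>x\<in>S. \<Sum>y\<in>S. \<Sum>x'\<in>S. \<Sum>y'\<in>S. ?g x y y' x') = ?D"
    by (rule sum.cong[OF refl], rule sum.cong[OF refl], rule sum.swap)
  have 3: "(\<Sum>x\<in>S. \<Sum>y\<in>S. \<Sum>x'\<in>S. \<Sum>y'\<in>S. ?g y x y' x') = ?D"
    unfolding 1[symmetric] by (rule sum.cong[OF refl], rule sum.cong[OF refl], rule sum.swap)
  have "4 * ?D = (\<Sum>x\<in>S. \<Sum>y\<in>S. \<Sum>x'\<in>S. \<Sum>y'\<in>S. ?g x y x' y' + ?g y x x' y' + ?g x y y' x' + ?g y x y' x')"
    unfolding sum.distrib 1 2 3 by simp
  also have "0 \<le> \<dots>"
  proof (intro sum_nonneg)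
    fix x y x' y' assume S: "x \<in> S" "y \<in> S" "x' \<in> S" "y' \<in> S"
    show "0 \<le> ?g x y x' y' + ?g y x x' y' + ?g x y y' x' + ?g y x y' x'"
    proof (cases "disjoint4 x y x' y'")
      case True
      then have "disjoint4 y x x' y'" "disjoint4 x y y' x'" "disjoint4 y x y' x'"
        by (auto simp: disjoint4_def)
      then show ?thesis using pairing_disjoint[OF S True, of f] True by simp
    next
      case False
      then have "\<not> disjoint4 y x x' y'" "\<not> disjoint4 x y y' x'" "\<not> disjoint4 y x y' x'"
        by (auto simp: disjoint4_def)
      then show ?thesis using False by simp
    qed
  qed
  finally show ?thesis by simp
qed

lemma pairing_degenerate:
  "x = y \<or> x = y' \<or> x' = y \<or> x' = y' \<Longrightarrow> pairing f x y x' y' = 0"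
  unfolding pairing_def by (rule sum.neutral) (auto simp: jump_def)

abbreviation "distinct3 x y z \<equiv> x \<noteq> y \<and> y \<noteq> z \<and> x \<noteq> z"

lemma sum_third_le_cross:
  assumes s: "s = 0 \<or> s = 1"
  shows "(\<Sum>x\<in>S. \<Sum>y\<in>S. \<Sum>z\<in>S. of_bool (distinct3 x y z) * (third x y z * edge f s x y z))
    \<le> 2 * (\<Sum>x\<in>S. \<Sum>y\<in>S. \<Sum>z\<in>S. of_bool (distinct3 x y z) * cross f s x y z)"
proof -
  let ?e = "\<lambda>x y z. of_bool (distinct3 x y z) * (third x y z * edge f s x y z)"
  let ?c = "\<lambda>x y z. of_bool (distinct3 x y z) * cross f s x y z"
  let ?Sum = "\<lambda>g::site \<Rightarrow> site \<Rightarrow> site \<Rightarrow> real. \<Sum>x\<in>S. \<Sum>y\<in>S. \<Sum>z\<in>S. g x y z"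
  have "3 * ?Sum ?e = ?Sum ?e + ?Sum (\<lambda>x y z. ?e y z x) + ?Sum (\<lambda>x y z. ?e x z y)"
    unfolding sum3_permute(2)[of ?e] sum3_permute(4)[of ?e] by simp
  also have "\<dots> = ?Sum (\<lambda>x y z. ?e x y z + ?e y z x + ?e x z y)"
    by (simp only: sum.distrib)
  also have "\<dots> \<le> ?Sum (\<lambda>x y z. 2 * (?c x y z + ?c y x z + ?c z x y))"
  proof (intro sum_mono)
    fix x y z assume S: "x \<in> S" "y \<in> S" "z \<in> S"
    show "?e x y z + ?e y z x + ?e x z y \<le> 2 * (?c x y z + ?c y x z + ?c z x y)"
    proof (cases "distinct3 x y z")
      case True
      then have "y \<noteq> x" "z \<noteq> y" "z \<noteq> x" by auto
      then show ?thesis using cross_triangle[OF S _ _ _ s, of f] True by simp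
    next
      case False
      then have "\<not> distinct3 y z x" "\<not> distinct3 x z y" "\<not> distinct3 y x z" "\<not> distinct3 z x y" by auto
      then show ?thesis using False by (simp only: of_bool_eq mult_zero_left) simp
    qed
  qed
  also have "\<dots> = 2 * (?Sum ?c + ?Sum (\<lambda>x y z. ?c y x z) + ?Sum (\<lambda>x y z. ?c z x y))"
    by (simp only: sum.distrib sum_distrib_left[symmetric])
  also have "\<dots> = 6 * ?Sum ?c"
    unfolding sum3_permute(1)[of ?c] sum3_permute(3)[of ?c] by simp
  finally show ?thesis by simp
qed

definition curvature :: "site \<Rightarrow> site \<Rightarrow> real" where
  "curvature x y = (tt x y)\<^sup>2 + (\<Sum>z\<in>S. of_bool (z \<noteq> x \<and> z \<noteq> y) * third x y z)"

text \<open>Two oriented bonds that can both fire are equal, share the particle end, share the hole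
  end, or are disjoint; if the particle end of one is the hole end of the other, their product
  vanishes. The shared ends produce the triangles with \<open>s = 1\<close> and
  \<open>s = 0\<close>, and \<open>conductance_split\<close> recombines the two kinds.\<close>

lemma bochner_lower:
  "(\<Sum>x\<in>S. \<Sum>y\<in>S. curvature x y * conductance f x y) \<le> 2 * (\<Sum>\<alpha>\<in>A. w \<alpha> * (gen f \<alpha>)\<^sup>2)"
proof -
  let ?p = "pairing f"
  have fin: "finite S" by (rule finite_Lattice)
  have right: "(\<Sum>x\<in>S. \<Sum>y\<in>S. a x y) * B = (\<Sum>x\<in>S. \<Sum>y\<in>S. a x y * B)"
    and left: "B * (\<Sum>x\<in>S. \<Sum>y\<in>S. a x y) = (\<Sum>x\<in>S. \<Sum>y\<in>S. B * a x y)" for a and B :: real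
    by (simp_all only: sum_distrib_left sum_distrib_right)
  have "(\<Sum>\<alpha>\<in>A. w \<alpha> * (gen f \<alpha>)\<^sup>2)
      = (\<Sum>\<alpha>\<in>A. \<Sum>x\<in>S. \<Sum>y\<in>S. \<Sum>x'\<in>S. \<Sum>y'\<in>S. w \<alpha> * (jump f x y \<alpha> * jump f x' y' \<alpha>))"
  proof (intro sum.cong refl)
    fix \<alpha>
    have "(gen f \<alpha>)\<^sup>2 = (\<Sum>x\<in>S. \<Sum>y\<in>S. jump f x y \<alpha> * gen f \<alpha>)"
      unfolding power2_eq_square by (subst gen_def) (rule right)
    also have "\<dots> = (\<Sum>x\<in>S. \<Sum>y\<in>S. \<Sum>x'\<in>S. \<Sum>y'\<in>S. jump f x y \<alpha> * jump f x' y' \<alpha>)"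
      unfolding gen_def left ..
    finally show "w \<alpha> * (gen f \<alpha>)\<^sup>2
      = (\<Sum>x\<in>S. \<Sum>y\<in>S. \<Sum>x'\<in>S. \<Sum>y'\<in>S. w \<alpha> * (jump f x y \<alpha> * jump f x' y' \<alpha>))"
      by (simp only: left)
  qed
  also have "\<dots> = (\<Sum>x\<in>S. \<Sum>y\<in>S. \<Sum>x'\<in>S. \<Sum>y'\<in>S. ?p x y x' y')"
    unfolding pairing_def
    by (subst sum.swap, rule sum.cong[OF refl], subst sum.swap, rule sum.cong[OF refl],
        subst sum.swap, rule sum.cong[OF refl], subst sum.swap, rule refl)
  also have "\<dots> = (\<Sum>x\<in>S. \<Sum>y\<in>S. \<Sum>x'\<in>S. \<Sum>y'\<in>S.
      of_bool (x = x') * (of_bool (y = y') * ?p x y x' y')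
      + of_bool (x = x') * (of_bool (distinct3 x y y') * cross f 1 x y y')
      + of_bool (y = y') * (of_bool (distinct3 y x x') * cross f 0 y x x')
      + of_bool (disjoint4 x y x' y') * ?p x y x' y')"
  proof (intro sum.cong refl)
    fix x y x' y'
    show "?p x y x' y' = of_bool (x = x') * (of_bool (y = y') * ?p x y x' y')
      + of_bool (x = x') * (of_bool (distinct3 x y y') * cross f 1 x y y')
      + of_bool (y = y') * (of_bool (distinct3 y x x') * cross f 0 y x x')
      + of_bool (disjoint4 x y x' y') * ?p x y x' y'"
    proof (cases "x = y \<or> x = y' \<or> x' = y \<or> x' = y'")
      case True
      then have "\<not> disjoint4 x y x' y'" "\<not> (x = x' \<and> distinct3 x y y')" "\<not> (y = y' \<and> distinct3 y x x')"
        by (auto simp: disjoint4_def)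
      then show ?thesis using pairing_degenerate[OF True, of f]
        by (cases "x = x'"; cases "y = y'") auto
    next
      case False
      then show ?thesis
        using pairing_particle[of f x y y'] pairing_hole[of f x y x']
        by (cases "x = x'"; cases "y = y'") (auto simp: disjoint4_def)
    qed
  qed
  also have "\<dots> = (\<Sum>x\<in>S. \<Sum>y\<in>S. ?p x y x y)
      + (\<Sum>x\<in>S. \<Sum>y\<in>S. \<Sum>z\<in>S. of_bool (distinct3 x y z) * cross f 1 x y z)
      + (\<Sum>x\<in>S. \<Sum>y\<in>S. \<Sum>z\<in>S. of_bool (distinct3 y x z) * cross f 0 y x z)
      + (\<Sum>x\<in>S. \<Sum>y\<in>S. \<Sum>x'\<in>S. \<Sum>y'\<in>S. of_bool (disjoint4 x y x' y') * ?p x y x' y')"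
  proof -
    have delta: "(\<Sum>x'\<in>S. of_bool (x = x') * g x') = g x" if "x \<in> S" for x and g :: "site \<Rightarrow> real"
    proof -
      have "(\<Sum>x'\<in>S. of_bool (x = x') * g x') = (\<Sum>x'\<in>S. if x = x' then g x' else 0)"
        by (intro sum.cong) auto
      then show ?thesis using that fin by (simp add: sum.delta')
    qed
    have delta2: "(\<Sum>x'\<in>S. \<Sum>y'\<in>S. of_bool (x = x') * h x' y') = (\<Sum>y'\<in>S. h x y')"
      if "x \<in> S" for x and h :: "site \<Rightarrow> site \<Rightarrow> real"
      using delta[OF that, of "\<lambda>x'. \<Sum>y'\<in>S. h x' y'"] by (simp only: sum_distrib_left)
    show ?thesis
      by (simp add: sum.distrib delta delta2)
  qed
  also have "(\<Sum>x\<in>S. \<Sum>y\<in>S. \<Sum>z\<in>S. of_bool (distinct3 y x z) * cross f 0 y x z)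
      = (\<Sum>x\<in>S. \<Sum>y\<in>S. \<Sum>z\<in>S. of_bool (distinct3 x y z) * cross f 0 x y z)"
    by (rule sum.swap)
  finally have expand: "(\<Sum>\<alpha>\<in>A. w \<alpha> * (gen f \<alpha>)\<^sup>2) = (\<Sum>x\<in>S. \<Sum>y\<in>S. ?p x y x y)
      + (\<Sum>x\<in>S. \<Sum>y\<in>S. \<Sum>z\<in>S. of_bool (distinct3 x y z) * cross f 1 x y z)
      + (\<Sum>x\<in>S. \<Sum>y\<in>S. \<Sum>z\<in>S. of_bool (distinct3 x y z) * cross f 0 x y z)
      + (\<Sum>x\<in>S. \<Sum>y\<in>S. \<Sum>x'\<in>S. \<Sum>y'\<in>S. of_bool (disjoint4 x y x' y') * ?p x y x' y')" .
  \<comment> \<open>At least one orientation of every bond does not go uphill and has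
    \<open>hop\<close> equal to \<open>1\<close>.\<close>
  have diag: "(\<Sum>x\<in>S. \<Sum>y\<in>S. (tt x y)\<^sup>2 * conductance f x y) \<le> 2 * (\<Sum>x\<in>S. \<Sum>y\<in>S. ?p x y x y)"
  proof -
    have sw: "(\<Sum>x\<in>S. \<Sum>y\<in>S. ?p x y x y) = (\<Sum>x\<in>S. \<Sum>y\<in>S. ?p y x y x)" by (rule sum.swap)
    have "2 * (\<Sum>x\<in>S. \<Sum>y\<in>S. ?p x y x y) = (\<Sum>x\<in>S. \<Sum>y\<in>S. ?p x y x y + ?p y x y x)"
      unfolding sum.distrib sw[symmetric] by simp
    also have "\<dots> \<ge> (\<Sum>x\<in>S. \<Sum>y\<in>S. (tt x y)\<^sup>2 * conductance f x y)"
    proof (intro sum_mono)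
      fix x y assume S: "x \<in> S" "y \<in> S"
      have "hop 1 x y = 1 \<or> hop 1 y x = 1" by (cases "snd x \<le> snd y") (simp_all add: hop_def depth_def)
      then have "1 \<le> hop 1 x y + hop 1 y x" using hop_pos[of 1 x y] hop_pos[of 1 y x] by linarith
      then have "1 * ((tt x y)\<^sup>2 * conductance f x y) \<le> (hop 1 x y + hop 1 y x) * ((tt x y)\<^sup>2 * conductance f x y)"
        using conductance_nonneg by (intro mult_right_mono) auto
      also have "\<dots> = ?p x y x y + ?p y x y x"
        unfolding pairing_diag layer_dist_commute[of y x] conductance_commute[OF S(2,1)]
        by (simp add: algebra_simps)
      finally show "(tt x y)\<^sup>2 * conductance f x y \<le> ?p x y x y + ?p y x y x" by simp
    qed
    finally show ?thesis .
  qed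
  have "(\<Sum>x\<in>S. \<Sum>y\<in>S. \<Sum>z\<in>S. of_bool (distinct3 x y z) * (third x y z * edge f 0 x y z))
      = (\<Sum>x\<in>S. \<Sum>y\<in>S. \<Sum>z\<in>S. of_bool (distinct3 x y z) * (third x y z * edge f 0 y x z))"
    by (subst sum.swap, intro sum.cong refl) (auto simp: third_commute)
  then have "(\<Sum>x\<in>S. \<Sum>y\<in>S. \<Sum>z\<in>S. of_bool (distinct3 x y z) * (third x y z * edge f 1 x y z))
      + (\<Sum>x\<in>S. \<Sum>y\<in>S. \<Sum>z\<in>S. of_bool (distinct3 x y z) * (third x y z * edge f 0 x y z))
      = (\<Sum>x\<in>S. \<Sum>y\<in>S. \<Sum>z\<in>S. of_bool (distinct3 x y z) * (third x y z * edge f 1 x y z)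
        + of_bool (distinct3 x y z) * (third x y z * edge f 0 y x z))"
    by (simp only: sum.distrib)
  also have "\<dots> = (\<Sum>x\<in>S. \<Sum>y\<in>S. (\<Sum>z\<in>S. of_bool (z \<noteq> x \<and> z \<noteq> y) * third x y z) * conductance f x y)"
    unfolding sum_distrib_right
  proof (intro sum.cong refl)
    fix x y z assume z: "z \<in> S"
    show "of_bool (distinct3 x y z) * (third x y z * edge f 1 x y z)
        + of_bool (distinct3 x y z) * (third x y z * edge f 0 y x z)
        = of_bool (z \<noteq> x \<and> z \<noteq> y) * third x y z * conductance f x y"
      using conductance_split[OF z, of f x y] conductance_self[of f x]
      by (cases "x = y"; cases "z = x \<or> z = y") (auto simp: algebra_simps)
  qed
  finally have "(\<Sum>x\<in>S. \<Sum>y\<in>S. (\<Sum>z\<in>S. of_bool (z \<noteq> x \<and> z \<noteq> y) * third x y z) * conductance f x y)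
    \<le> 2 * (\<Sum>x\<in>S. \<Sum>y\<in>S. \<Sum>z\<in>S. of_bool (distinct3 x y z) * cross f 1 x y z)
      + 2 * (\<Sum>x\<in>S. \<Sum>y\<in>S. \<Sum>z\<in>S. of_bool (distinct3 x y z) * cross f 0 x y z)"
    using sum_third_le_cross[of 1 f] sum_third_le_cross[of 0 f] by simp
  then show ?thesis
    using diag sum_pairing_disjoint_nonneg[of f] unfolding expand curvature_def distrib_right sum.distrib
    by (simp add: algebra_simps)
qed

end

section \<open>Curvature of a bond: the triangle coefficients summed over the third site\<close>

locale gap_setting = bochner +
  assumes loss_far: "\<And>d M. 2 \<le> d \<Longrightarrow> (\<Sum>n=1..M. loss q e \<kappa> \<mu> d n) \<le> \<mu> * (decay e d)\<^sup>2"
    and loss_near: "\<And>M. (\<Sum>n=1..M. loss q e \<kappa> \<mu> 1 n) \<le> q\<^sup>2 / 1024"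
begin

lemma loss_nonneg: "0 \<le> loss q e \<kappa> \<mu> d n"
  using q e kappa mu corner_cost_nonneg[of q n] unfolding loss_def
  by (intro add_nonneg_nonneg) auto

text \<open>The layers \<open>a\<close> and \<open>b\<close> of the ends give the positive terms,
  the layers \<open>a + 1\<close> and \<open>b - 1\<close> the gains; for \<open>d = 2\<close> these
  last two coincide and \<open>gain\<close> counts both. The layers below \<open>a\<close> and those
  above \<open>b\<close> each lose at most the full sum of \<open>loss\<close>.\<close>

lemma third_sum_lower:
  fixes a b :: nat
  defines "d \<equiv> b - a"
  assumes ab: "1 \<le> a" "a < b" "b \<le> H"
  shows "2 * (q ^ (2 * d) * (t d)\<^sup>2) + (if 2 \<le> d then 2 * (\<mu> * (t d)\<^sup>2) else 0)
      - 2 * (\<Sum>n=1..H. loss q e \<kappa> \<mu> d n)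
    \<le> (\<Sum>h=1..H. if h < a then beyond d (a - h) else if b < h then beyond d (h - b) else between (h - a) (b - h))"
    (is "_ \<le> (\<Sum>h=1..H. ?\<phi> h)")
proof -
  let ?l = "loss q e \<kappa> \<mu> d"
  define Qd where "Qd = q ^ (2 * d) * (t d)\<^sup>2"
  define g where "g = (if 2 \<le> d then \<mu> * (t d)\<^sup>2 else 0)"
  let ?\<psi> = "\<lambda>h. (if h = a then Qd else 0) + (if h = b then Qd else 0)
    + (if h = a + 1 then g else 0) + (if h = b - 1 then g else 0)
    - (if h < a then ?l (a - h) else 0) - (if b < h then ?l (h - b) else 0)"
  have d: "0 < d" using ab by (simp add: d_def)
  have "?\<psi> h \<le> ?\<phi> h" for h
  proof -
    consider "h < a" | "h = a" | "a < h" "h < b" | "h = b" | "b < h" by linarith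
    then show ?thesis
    proof cases
      case 3
      then have "h - a \<noteq> 0" "b - h \<noteq> 0" "h - a + (b - h) = d" by (auto simp: d_def)
      then have "?\<phi> h = \<mu> * (t d)\<^sup>2 * ((if h - a = 1 then 1 else 0) + (if b - h = 1 then 1 else 0))"
        using 3 by (simp add: between_def gain_def)
      moreover have "h - a = 1 \<longleftrightarrow> h = a + 1" "b - h = 1 \<longleftrightarrow> h = b - 1" using 3 by auto
      moreover have "2 \<le> d" using 3 by (simp add: d_def)
      ultimately show ?thesis using 3 by (simp add: g_def)
    next
      case 2
      then show ?thesis using ab d by (auto simp: between_def Qd_def g_def d_def)
    next
      case 4
      then show ?thesis using ab d by (auto simp: between_def Qd_def g_def d_def)
    qed (use d ab in \<open>auto simp: beyond_def\<close>)
  qed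
  then have "(\<Sum>h=1..H. ?\<psi> h) \<le> (\<Sum>h=1..H. ?\<phi> h)" by (intro sum_mono)
  moreover have "(\<Sum>h=1..H. ?\<psi> h) = 2 * Qd + 2 * g
     - (\<Sum>h=1..H. if h < a then ?l (a - h) else 0) - (\<Sum>h=1..H. if b < h then ?l (h - b) else 0)"
  proof (cases "2 \<le> d")
    case True
    then have "1 \<le> a" "a \<le> H" "1 \<le> b" "b \<le> H" "1 \<le> a + 1" "a + 1 \<le> H" "1 \<le> b - 1" "b - 1 \<le> H"
      using ab by (auto simp: d_def)
    then show ?thesis by (simp add: sum.distrib sum_subtractf sum.delta')
  next
    case False
    then have "g = 0" by (simp add: g_def)
    then show ?thesis using ab by (simp add: sum.distrib sum_subtractf sum.delta')
  qed
  moreover have "(\<Sum>h=1..H. if h < a then ?l (a - h) else 0) \<le> (\<Sum>n=1..H. ?l n)"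
  proof -
    have "(\<Sum>h=1..H. if h < a then ?l (a - h) else 0) = (\<Sum>h\<in>{1..<a}. ?l (a - h))"
      using ab by (intro sum.mono_neutral_cong_right) auto
    also have "\<dots> = (\<Sum>n\<in>{1..<a}. ?l n)"
      by (rule sum.reindex_bij_witness[of _ "\<lambda>n. a - n" "\<lambda>h. a - h"]) auto
    also have "\<dots> \<le> (\<Sum>n=1..H. ?l n)" using ab loss_nonneg by (intro sum_mono2) auto
    finally show ?thesis .
  qed
  moreover have "(\<Sum>h=1..H. if b < h then ?l (h - b) else 0) \<le> (\<Sum>n=1..H. ?l n)"
  proof -
    have "(\<Sum>h=1..H. if b < h then ?l (h - b) else 0) = (\<Sum>h\<in>{b<..H}. ?l (h - b))"
      by (intro sum.mono_neutral_cong_right) auto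
    also have "\<dots> = (\<Sum>n\<in>{1..H-b}. ?l n)"
      by (rule sum.reindex_bij_witness[of _ "\<lambda>n. n + b" "\<lambda>h. h - b"]) auto
    also have "\<dots> \<le> (\<Sum>n=1..H. ?l n)" using loss_nonneg by (intro sum_mono2) auto
    finally show ?thesis .
  qed
  moreover have "(if 2 \<le> d then 2 * (\<mu> * (t d)\<^sup>2) else 0) = 2 * g" by (simp add: g_def)
  ultimately show ?thesis unfolding Qd_def[symmetric] by linarith
qed

text \<open>The layer sum is multiplied by \<open>L\<close>, but the ends \<open>x\<close> and
  \<open>y\<close> are not third sites and their two terms must be taken off again. For
  \<open>d \<ge> 2\<close> one multiple of the layer sum covers them. For \<open>d = 1\<close> the
  diagonal term \<open>(t 1)\<^sup>2\<close> covers one and half of the layer terms the other; the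
  half that remains is at least \<open>real L * q\<^sup>2 / 256\<close>, twice the total
  loss.\<close>

lemma curvature_lower:
  assumes S: "x \<in> S" "y \<in> S" and ne: "x \<noteq> y"
  shows "of_bool (layer_dist x y = 1) * (real L * q\<^sup>2 / 512) \<le> curvature x y"
proof -
  define a b where "a = min (snd x) (snd y)" and "b = max (snd x) (snd y)"
  define d where "d = b - a"
  have ld: "layer_dist x y = d" by (auto simp: layer_dist_def a_def b_def d_def)
  have L: "1 \<le> real L" using S by (auto simp: Lattice_def)
  let ?\<phi> = "\<lambda>h. if h < a then beyond d (a - h) else if b < h then beyond d (h - b) else between (h - a) (b - h)"
  have third: "third x y z = ?\<phi> (snd z)" for z
    by (simp add: third_def Let_def a_def[symmetric] b_def[symmetric] d_def)
  have bounds: "1 \<le> a" "a \<le> b" "b \<le> H" using S by (auto simp: a_def b_def Lattice_def)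
  have rest: "(\<Sum>z\<in>S. of_bool (z \<noteq> x \<and> z \<noteq> y) * third x y z)
      = real L * (\<Sum>h=1..H. ?\<phi> h) - third x y x - third x y y"
  proof -
    have "(\<Sum>z\<in>S. of_bool (z \<noteq> x \<and> z \<noteq> y) * third x y z) = (\<Sum>z\<in>S - {x} - {y}. third x y z)"
      using finite_Lattice by (intro sum.mono_neutral_cong_right) auto
    moreover have "(\<Sum>z\<in>S. third x y z) = third x y x + (third x y y + (\<Sum>z\<in>S - {x} - {y}. third x y z))"
      using S ne finite_Lattice by (subst sum.remove[of S x], simp, simp, subst sum.remove[of _ y]) auto
    moreover have "(\<Sum>z\<in>S. third x y z) = real L * (\<Sum>h=1..H. ?\<phi> h)"
      unfolding third by (rule sum_Lattice_height)
    ultimately show ?thesis by simp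
  qed
  consider "d = 0" | "d = 1" | "2 \<le> d" by linarith
  then show ?thesis
  proof cases
    case 1
    then have "a = b" using bounds by (simp add: d_def)
    then have "?\<phi> h = 0" for h using 1 by (auto simp: beyond_def between_def)
    then have "third x y z = 0" for z unfolding third .
    then show ?thesis using 1 by (simp add: curvature_def ld)
  next
    case 2
    then have ab: "a < b" by (simp add: d_def)
    have t3: "third x y x = q ^ (2 * d) * (t d)\<^sup>2" "third x y y = q ^ (2 * d) * (t d)\<^sup>2"
      unfolding third using ab 2 by (auto simp: a_def b_def d_def between_def min_def max_def split: if_splits)
    define Q1 where "Q1 = q\<^sup>2 * (t 1)\<^sup>2"
    have "2 * Q1 - 2 * (q\<^sup>2 / 1024) \<le> (\<Sum>h=1..H. ?\<phi> h)"
      using third_sum_lower[OF bounds(1) ab bounds(3)] loss_near[of H] 2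
      unfolding d_def[symmetric] Q1_def by simp
    then have "real L * (2 * Q1 - 2 * (q\<^sup>2 / 1024)) \<le> real L * (\<Sum>h=1..H. ?\<phi> h)"
      by (intro mult_left_mono) auto
    then have "real L * (2 * Q1 - 2 * (q\<^sup>2 / 1024)) - 2 * Q1 + (t 1)\<^sup>2 \<le> curvature x y"
      unfolding curvature_def ld rest t3 Q1_def using 2 by simp
    moreover have "Q1 \<le> (t 1)\<^sup>2"
      unfolding Q1_def using q by (intro mult_left_le_one_le power_le_one) auto
    moreover have "q\<^sup>2 * (1 / 256) \<le> Q1"
    proof -
      have "1 / 16 \<le> t 1"
      proof -
        have "(1 + e) ^ 4 \<le> 2 ^ 4" using e by (intro power_mono) auto
        then show ?thesis using e by (simp add: decay_def field_simps)
      qed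
      then have "(1 / 16)\<^sup>2 \<le> (t 1)\<^sup>2" by (intro power_mono) auto
      then show ?thesis unfolding Q1_def by (intro mult_left_mono) (auto simp: power2_eq_square)
    qed
    moreover have "1 * Q1 \<le> real L * Q1" using L by (intro mult_right_mono) (auto simp: Q1_def)
    moreover have "real L * (q\<^sup>2 * (1 / 256)) \<le> real L * Q1"
      using calculation(3) by (intro mult_left_mono) auto
    ultimately show ?thesis using 2 by (simp add: ld algebra_simps)
  next
    case 3
    then have ab: "a < b" by (simp add: d_def)
    have t3: "third x y x = q ^ (2 * d) * (t d)\<^sup>2" "third x y y = q ^ (2 * d) * (t d)\<^sup>2"
      unfolding third using ab 3 by (auto simp: a_def b_def d_def between_def min_def max_def split: if_splits)
    define Qd where "Qd = q ^ (2 * d) * (t d)\<^sup>2"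
    have "2 * Qd \<le> (\<Sum>h=1..H. ?\<phi> h)"
      using third_sum_lower[OF bounds(1) ab bounds(3)] loss_far[OF 3, of H] 3
      unfolding d_def[symmetric] Qd_def[symmetric] by simp
    then have "1 * (2 * Qd) \<le> real L * (\<Sum>h=1..H. ?\<phi> h)"
      using L q by (intro mult_mono) (auto simp: Qd_def)
    then have "0 \<le> curvature x y"
      unfolding curvature_def ld rest t3 Qd_def[symmetric] by simp
    then show ?thesis using 3 by (simp add: ld)
  qed
qed

end

section \<open>Comparison with neighbouring layers\<close>

context exclusion
begin

text \<open>A particle-hole pair at \<open>x, y\<close> is exchanged in two moves through \<open>z\<close>: first \<open>x\<close> to \<open>z\<close> if \<open>z\<close>
  is empty, first \<open>z\<close> to \<open>y\<close> if \<open>z\<close> is occupied.\<close>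

lemma conductance_via:
  assumes S: "x \<in> S" "y \<in> S" "z \<in> S" and d: "x \<noteq> y" "y \<noteq> z" "x \<noteq> z" and th: "0 < \<theta>"
    and K: "hop 1 x y \<le> K * hop 1 x z" "hop 1 x y * hop 1 z x \<le> K * (hop 1 x z * hop 1 z y)"
      "hop 1 x y \<le> K * hop 1 z y" "hop 1 x y * hop 1 y z \<le> K * (hop 1 z y * hop 1 x z)"
  shows "conductance f x y \<le> K * ((1 + 1 / \<theta>) * conductance f x z + (1 + \<theta>) * conductance f z y)"
proof -
  define c1 where "c1 = 1 + 1 / \<theta>"
  define c2 where "c2 = 1 + \<theta>"
  have c: "0 < c1" "0 < c2" using th by (auto simp: c1_def c2_def add_pos_pos)
  have young: "(u + v)\<^sup>2 \<le> c1 * u\<^sup>2 + c2 * v\<^sup>2" for u v :: real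
    using square_sum_young[OF th, of v u] by (simp add: c1_def c2_def add.commute)
  let ?P = "\<lambda>i j \<alpha>. w \<alpha> * hop 1 i j * (f \<alpha> - f (exchange i j \<alpha>))\<^sup>2"
  let ?T0 = "\<lambda>\<alpha>. \<alpha> x = 1 \<and> \<alpha> y = 0 \<and> \<alpha> z = (0::nat)" and ?T1 = "\<lambda>\<alpha>. \<alpha> x = 1 \<and> \<alpha> y = 0 \<and> \<alpha> z = (1::nat)"
  have zy0: "(\<Sum>\<alpha>\<in>A. of_bool (\<alpha> z = 1 \<and> \<alpha> y = 0 \<and> \<alpha> x = 0) * ?P z y \<alpha>)
    = (\<Sum>\<alpha>\<in>A. of_bool (?T0 \<alpha>) * ?P z y (exchange x z \<alpha>))"
    by (subst sum_exchange[OF S(1,3), symmetric], intro sum.cong refl)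
      (use d in \<open>auto simp: exchange_apply\<close>)
  have xz1: "(\<Sum>\<alpha>\<in>A. of_bool (\<alpha> x = 1 \<and> \<alpha> z = 0 \<and> \<alpha> y = 1) * ?P x z \<alpha>)
    = (\<Sum>\<alpha>\<in>A. of_bool (?T1 \<alpha>) * ?P x z (exchange z y \<alpha>))"
    by (subst sum_exchange[OF S(3,2), symmetric], intro sum.cong refl)
      (use d in \<open>auto simp: exchange_apply\<close>)
  have zy: "conductance f z y = (\<Sum>\<alpha>\<in>A. of_bool (?T0 \<alpha>) * ?P z y (exchange x z \<alpha>))
      + (\<Sum>\<alpha>\<in>A. of_bool (?T1 \<alpha>) * ?P z y \<alpha>)"
    unfolding zy0[symmetric] conductance_def sum.distrib[symmetric]
  proof (intro sum.cong refl)
    fix \<alpha> assume "\<alpha> \<in> A"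
    then show "of_bool (\<alpha> z = 1 \<and> \<alpha> y = 0) * ?P z y \<alpha>
        = of_bool (\<alpha> z = 1 \<and> \<alpha> y = 0 \<and> \<alpha> x = 0) * ?P z y \<alpha> + of_bool (?T1 \<alpha>) * ?P z y \<alpha>"
      using Omega_N_01[OF _ S(1), of \<alpha> N] by (cases "\<alpha> x = 0") auto
  qed
  have xz: "conductance f x z = (\<Sum>\<alpha>\<in>A. of_bool (?T0 \<alpha>) * ?P x z \<alpha>)
      + (\<Sum>\<alpha>\<in>A. of_bool (?T1 \<alpha>) * ?P x z (exchange z y \<alpha>))"
    unfolding xz1[symmetric] conductance_def sum.distrib[symmetric]
  proof (intro sum.cong refl)
    fix \<alpha> assume "\<alpha> \<in> A"
    then show "of_bool (\<alpha> x = 1 \<and> \<alpha> z = 0) * ?P x z \<alpha>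
        = of_bool (?T0 \<alpha>) * ?P x z \<alpha> + of_bool (\<alpha> x = 1 \<and> \<alpha> z = 0 \<and> \<alpha> y = 1) * ?P x z \<alpha>"
      using Omega_N_01[OF _ S(2), of \<alpha> N] by (cases "\<alpha> y = 0") auto
  qed
  have two: "wt * h * (u + v)\<^sup>2 \<le> K * (c1 * (h1 * u\<^sup>2) + c2 * (h2 * v\<^sup>2))"
    if "wt * h \<le> K * h1" "wt * h \<le> K * h2" "0 \<le> wt * h" for wt h h1 h2 u v :: real
  proof -
    have "wt * h * (u + v)\<^sup>2 \<le> wt * h * (c1 * u\<^sup>2 + c2 * v\<^sup>2)" using that young by (intro mult_left_mono)
    also have "\<dots> = wt * h * (c1 * u\<^sup>2) + wt * h * (c2 * v\<^sup>2)" by (simp add: distrib_left)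
    also have "\<dots> \<le> K * h1 * (c1 * u\<^sup>2) + K * h2 * (c2 * v\<^sup>2)"
      using that c by (intro add_mono mult_right_mono) auto
    finally show ?thesis by (simp add: algebra_simps)
  qed
  have "conductance f x y \<le> (\<Sum>\<alpha>\<in>A. K * (c1 * (of_bool (?T0 \<alpha>) * ?P x z \<alpha> + of_bool (?T1 \<alpha>) * ?P x z (exchange z y \<alpha>))
      + c2 * (of_bool (?T0 \<alpha>) * ?P z y (exchange x z \<alpha>) + of_bool (?T1 \<alpha>) * ?P z y \<alpha>)))"
    unfolding conductance_def
  proof (rule sum_mono)
    fix \<alpha> assume "\<alpha> \<in> A"
    then have z01: "\<alpha> z = 0 \<or> \<alpha> z = 1" by (rule Omega_N_01[OF _ S(3)])
    have w0: "0 \<le> w \<alpha> * hop 1 x y" using w_pos[of \<alpha>] hop_pos[of 1 x y] by simp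
    consider "?T0 \<alpha>" | "?T1 \<alpha>" | "\<not> (\<alpha> x = 1 \<and> \<alpha> y = 0)" using z01 by blast
    then show "of_bool (\<alpha> x = 1 \<and> \<alpha> y = 0) * ?P x y \<alpha>
      \<le> K * (c1 * (of_bool (?T0 \<alpha>) * ?P x z \<alpha> + of_bool (?T1 \<alpha>) * ?P x z (exchange z y \<alpha>))
        + c2 * (of_bool (?T0 \<alpha>) * ?P z y (exchange x z \<alpha>) + of_bool (?T1 \<alpha>) * ?P z y \<alpha>))"
    proof cases
      case 1
      let ?b = "exchange x z \<alpha>"
      have ex: "exchange z y ?b = exchange x y \<alpha>" using d 1 by (auto simp: exchange_apply fun_eq_iff)
      have bal: "w ?b * hop 1 z x = w \<alpha> * hop 1 x z" using hop_balance[OF S(1,3), of 1 \<alpha>] 1 by simp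
      have "w \<alpha> * hop 1 x y * hop 1 z x \<le> w \<alpha> * (K * (hop 1 x z * hop 1 z y))"
        unfolding mult.assoc using K(2) w_pos[of \<alpha>] by (intro mult_left_mono) auto
      also have "\<dots> = K * (w ?b * hop 1 z y) * hop 1 z x" using bal by (simp add: mult_ac)
      finally have h2: "w \<alpha> * hop 1 x y \<le> K * (w ?b * hop 1 z y)" using hop_pos[of 1 z x] by simp
      have h1: "w \<alpha> * hop 1 x y \<le> K * (w \<alpha> * hop 1 x z)"
        using mult_left_mono[OF K(1), of "w \<alpha>"] w_pos[of \<alpha>] by (simp add: mult_ac)
      have "?P x y \<alpha> \<le> K * (c1 * ?P x z \<alpha> + c2 * ?P z y ?b)"
        using two[OF h1 h2 w0, of "f \<alpha> - f ?b" "f ?b - f (exchange x y \<alpha>)"] unfolding ex by simp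
      then show ?thesis using 1 by simp
    next
      case 2
      let ?b = "exchange z y \<alpha>"
      have ex: "exchange x z ?b = exchange x y \<alpha>" using d 2 by (auto simp: exchange_apply fun_eq_iff)
      have bal: "w ?b * hop 1 y z = w \<alpha> * hop 1 z y" using hop_balance[OF S(3,2), of 1 \<alpha>] 2 by simp
      have "w \<alpha> * hop 1 x y * hop 1 y z \<le> w \<alpha> * (K * (hop 1 z y * hop 1 x z))"
        unfolding mult.assoc using K(4) w_pos[of \<alpha>] by (intro mult_left_mono) auto
      also have "\<dots> = K * (w ?b * hop 1 x z) * hop 1 y z" using bal by (simp add: mult_ac)
      finally have h1: "w \<alpha> * hop 1 x y \<le> K * (w ?b * hop 1 x z)" using hop_pos[of 1 y z] by simp
      have h2: "w \<alpha> * hop 1 x y \<le> K * (w \<alpha> * hop 1 z y)"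
        using mult_left_mono[OF K(3), of "w \<alpha>"] w_pos[of \<alpha>] by (simp add: mult_ac)
      have "?P x y \<alpha> \<le> K * (c1 * ?P x z ?b + c2 * ?P z y \<alpha>)"
        using two[OF h1 h2 w0, of "f ?b - f (exchange x y \<alpha>)" "f \<alpha> - f ?b"] unfolding ex
        by (simp add: algebra_simps)
      then show ?thesis using 2 by simp
    qed auto
  qed
  also have "\<dots> = K * (c1 * conductance f x z + c2 * conductance f z y)"
    unfolding xz zy by (simp only: sum.distrib sum_distrib_left[symmetric])
  finally show ?thesis by (simp add: c1_def c2_def)
qed

definition layers :: "(config \<Rightarrow> real) \<Rightarrow> nat \<Rightarrow> nat \<Rightarrow> real" where
  "layers f h h' = (\<Sum>i=1..L. \<Sum>j=1..L. conductance f (i, h) (j, h'))"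

lemma layers_nonneg: "0 \<le> layers f h h'"
  unfolding layers_def by (intro sum_nonneg conductance_nonneg)

lemma layers_commute:
  assumes "h \<in> {1..H}" "h' \<in> {1..H}"
  shows "layers f h h' = layers f h' h"
  unfolding layers_def using assms
  by (subst sum.swap) (intro sum.cong refl conductance_commute, auto simp: Lattice_def)

text \<open>The intermediate site ranges over all of layer \<open>h3\<close>. Averaging over it
  spreads the load evenly, so that no factor \<open>L\<close> is lost. The case
  \<open>h1 = h2\<close> is included, with equal end sites contributing nothing.\<close>

lemma layers_via:
  assumes L: "1 \<le> L" and h: "h1 \<in> {1..H}" "h2 \<in> {1..H}" "h3 \<in> {1..H}" and ne: "h1 \<noteq> h3" "h2 \<noteq> h3"
    and th: "0 < \<theta>" and K0: "0 \<le> K"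
    and K: "\<And>i j k. hop 1 (i, h1) (j, h2) \<le> K * hop 1 (i, h1) (k, h3)"
      "\<And>i j k. hop 1 (i, h1) (j, h2) * hop 1 (k, h3) (i, h1) \<le> K * (hop 1 (i, h1) (k, h3) * hop 1 (k, h3) (j, h2))"
      "\<And>i j k. hop 1 (i, h1) (j, h2) \<le> K * hop 1 (k, h3) (j, h2)"
      "\<And>i j k. hop 1 (i, h1) (j, h2) * hop 1 (j, h2) (k, h3) \<le> K * (hop 1 (k, h3) (j, h2) * hop 1 (i, h1) (k, h3))"
  shows "layers f h1 h2 \<le> K * ((1 + 1 / \<theta>) * layers f h1 h3 + (1 + \<theta>) * layers f h3 h2)"
proof -
  have "real L * layers f h1 h2 = (\<Sum>i=1..L. \<Sum>j=1..L. \<Sum>k=1..L. conductance f (i, h1) (j, h2))"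
    by (simp add: layers_def sum_distrib_left)
  also have "\<dots> \<le> (\<Sum>i=1..L. \<Sum>j=1..L. \<Sum>k=1..L.
      K * ((1 + 1 / \<theta>) * conductance f (i, h1) (k, h3) + (1 + \<theta>) * conductance f (k, h3) (j, h2)))"
  proof (intro sum_mono)
    fix i j k assume ijk: "i \<in> {1..L}" "j \<in> {1..L}" "k \<in> {1..L}"
    show "conductance f (i, h1) (j, h2)
      \<le> K * ((1 + 1 / \<theta>) * conductance f (i, h1) (k, h3) + (1 + \<theta>) * conductance f (k, h3) (j, h2))"
    proof (cases "(i, h1) = (j, h2)")
      case True
      then show ?thesis using K0 th by (simp add: conductance_self conductance_nonneg)
    next
      case False
      show ?thesis
        by (rule conductance_via) (use False ijk h ne th K in \<open>auto simp: Lattice_def\<close>)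
    qed
  qed
  also have "\<dots> = real L * (K * ((1 + 1 / \<theta>) * layers f h1 h3 + (1 + \<theta>) * layers f h3 h2))"
  proof -
    have a: "(\<Sum>i=1..L. \<Sum>j=1..L. \<Sum>k=1..L. conductance f (i, h1) (k, h3)) = real L * layers f h1 h3"
      by (simp add: layers_def sum_distrib_left)
    have b: "(\<Sum>i=1..L. \<Sum>j=1..L. \<Sum>k=1..L. conductance f (k, h3) (j, h2)) = real L * layers f h3 h2"
      unfolding layers_def by (simp, subst sum.swap, simp)
    show ?thesis
      unfolding sum_distrib_left[symmetric] sum.distrib a b by (simp add: algebra_simps)
  qed
  finally show ?thesis using L by simp
qed

lemma layers_between:
  assumes "1 \<le> L" "1 \<le> h1" "h1 < h3" "h3 < h2" "h2 \<le> H" "0 < \<theta>"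
  shows "layers f h1 h2 \<le> (1 + 1 / \<theta>) * layers f h1 h3 + (1 + \<theta>) * layers f h3 h2"
proof -
  have "layers f h1 h2 \<le> 1 * ((1 + 1 / \<theta>) * layers f h1 h3 + (1 + \<theta>) * layers f h3 h2)"
  proof (rule layers_via)
    fix i j k
    have "hop 1 (i, h1) (j, h2) = hop 1 (i, h1) (k, h3) * hop 1 (k, h3) (j, h2)"
      using assms by (simp add: hop_def depth_def nat_diff_distrib' flip: power_add distrib_left)
    moreover have "hop 1 (k, h3) (i, h1) = 1" "hop 1 (j, h2) (k, h3) = 1"
      using assms by (simp_all add: hop_def depth_def)
    moreover have "u * v \<le> u" "u * v \<le> v" if "0 < u" "u \<le> 1" "0 < v" "v \<le> 1" for u v :: real
      using that by (auto simp: mult_left_le mult_left_le_one_le mult_right_le_one_le)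
    ultimately show "hop 1 (i, h1) (j, h2) \<le> 1 * hop 1 (i, h1) (k, h3)"
      "hop 1 (i, h1) (j, h2) * hop 1 (k, h3) (i, h1) \<le> 1 * (hop 1 (i, h1) (k, h3) * hop 1 (k, h3) (j, h2))"
      "hop 1 (i, h1) (j, h2) \<le> 1 * hop 1 (k, h3) (j, h2)"
      "hop 1 (i, h1) (j, h2) * hop 1 (j, h2) (k, h3) \<le> 1 * (hop 1 (k, h3) (j, h2) * hop 1 (i, h1) (k, h3))"
      using hop_pos hop_le_1 by (simp_all add: mult.commute)
  qed (use assms in auto)
  then show ?thesis by simp
qed

text \<open>Two sites of one layer are exchanged through an adjacent layer. Whichever side that
  layer lies on, one uphill step costs a factor \<open>q\<^sup>2\<close>, hence
  \<open>K = 1 / q\<^sup>2\<close>; the \<open>4\<close> is \<open>2 + 2\<close> from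
  \<open>\<theta> = 1\<close>.\<close>

lemma layers_same:
  assumes "1 \<le> L" "1 \<le> h" "h + 1 \<le> H"
  shows "layers f h h \<le> 4 / q\<^sup>2 * layers f h (h + 1)"
    "layers f (h + 1) (h + 1) \<le> 4 / q\<^sup>2 * layers f h (h + 1)"
proof -
  have hops: "hop 1 (i, h) (j, h) = 1" "hop 1 (i, h) (j, h + 1) = q\<^sup>2" "hop 1 (i, h + 1) (j, h) = 1"
     "hop 1 (i, h + 1) (j, h + 1) = 1" for i j
    by (simp_all add: hop_def depth_def)
  have q2: "0 < q\<^sup>2" "q\<^sup>2 \<le> 1" using q by (auto simp: power_le_one)
  have "1 \<le> 1 / q\<^sup>2" using q2 by simp
  then have le: "1 \<le> 1 / q\<^sup>2" "q\<^sup>2 \<le> 1 / q\<^sup>2" using q2 by linarith+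
  have "layers f h h \<le> 1 / q\<^sup>2 * ((1 + 1 / 1) * layers f h (h + 1) + (1 + 1) * layers f (h + 1) h)"
    by (rule layers_via) (use assms q q2 le in \<open>auto simp: hops hops[simplified]\<close>)
  then show "layers f h h \<le> 4 / q\<^sup>2 * layers f h (h + 1)"
    using layers_commute[of h "h + 1" f] assms by simp
  have "layers f (h + 1) (h + 1) \<le> 1 / q\<^sup>2 * ((1 + 1 / 1) * layers f (h + 1) h + (1 + 1) * layers f h (h + 1))"
    by (rule layers_via) (use assms q q2 le in \<open>auto simp: hops hops[simplified]\<close>)
  then show "layers f (h + 1) (h + 1) \<le> 4 / q\<^sup>2 * layers f h (h + 1)"
    using layers_commute[of h "h + 1" f] assms by simp
qed

text \<open>Splitting off the last layer with \<open>\<theta> = real (Suc d)\<close> reproduces the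
  Cauchy-Schwarz constant, as \<open>(1 + 1 / n) * n = n + 1\<close>. A fixed
  \<open>\<theta>\<close> would make the constant grow exponentially with the distance.\<close>

lemma layers_chain:
  assumes "1 \<le> L" "1 \<le> h"
  shows "h + Suc d \<le> H \<Longrightarrow> layers f h (h + Suc d) \<le> real (Suc d) * (\<Sum>j\<le>d. layers f (h + j) (h + j + 1))"
proof (induction d)
  case (Suc d)
  have "layers f h (h + Suc (Suc d)) \<le> (1 + 1 / real (Suc d)) * layers f h (h + Suc d)
      + (1 + real (Suc d)) * layers f (h + Suc d) (h + Suc (Suc d))"
    using Suc.prems assms by (intro layers_between) auto
  also have "(1 + 1 / real (Suc d)) * layers f h (h + Suc d)
     \<le> (1 + 1 / real (Suc d)) * (real (Suc d) * (\<Sum>j\<le>d. layers f (h + j) (h + j + 1)))"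
    using Suc by (intro mult_left_mono) auto
  also have "\<dots> = real (Suc (Suc d)) * (\<Sum>j\<le>d. layers f (h + j) (h + j + 1))"
    by (simp add: field_simps)
  finally show ?case by (simp add: algebra_simps)
qed simp

definition neighbours :: "(config \<Rightarrow> real) \<Rightarrow> real" where
  "neighbours f = (\<Sum>h=1..H-1. layers f h (h + 1))"

lemma neighbours_nonneg: "0 \<le> neighbours f"
  unfolding neighbours_def by (intro sum_nonneg layers_nonneg)

lemma sum_Lattice: "(\<Sum>x\<in>S. g x) = (\<Sum>h=1..H. \<Sum>i=1..L. g (i, h))"
  unfolding Lattice_def by (subst sum.swap) (simp add: sum.cartesian_product)

lemma sum_Lattice_pairs:
  "(\<Sum>x\<in>S. \<Sum>y\<in>S. \<phi> (snd x) (snd y) * conductance f x y) = (\<Sum>h=1..H. \<Sum>h'=1..H. \<phi> h h' * layers f h h')"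
proof -
  have "(\<Sum>x\<in>S. \<Sum>y\<in>S. \<phi> (snd x) (snd y) * conductance f x y)
    = (\<Sum>h=1..H. \<Sum>i=1..L. \<Sum>h'=1..H. \<Sum>j=1..L. \<phi> h h' * conductance f (i, h) (j, h'))"
    unfolding sum_Lattice by simp
  also have "\<dots> = (\<Sum>h=1..H. \<Sum>h'=1..H. \<Sum>i=1..L. \<Sum>j=1..L. \<phi> h h' * conductance f (i, h) (j, h'))"
    by (rule sum.cong[OF refl]) (rule sum.swap)
  finally show ?thesis by (simp only: layers_def sum_distrib_left)
qed

end

section \<open>From the Bochner inequality to the Poincare inequality\<close>

text \<open>If \<open>K\<close> is an admissible constant in the Poincare inequality, then one explicit Euler step
  \<open>f - s G f\<close> of the flow shows that \<open>(1 - s g) K + 2 s\<close> is admissible as well; the iterates of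
  this map converge to \<open>2 / g\<close>.\<close>

lemma poincare_from_bochner:
  fixes G :: "('a \<Rightarrow> real) \<Rightarrow> 'a \<Rightarrow> real" and w :: "'a \<Rightarrow> real" and A :: "'a set"
  defines "ip \<equiv> \<lambda>f g. \<Sum>\<alpha>\<in>A. w \<alpha> * (f \<alpha> * g \<alpha>)"
  assumes lin: "\<And>f h s. G (\<lambda>\<alpha>. f \<alpha> - s * h \<alpha>) = (\<lambda>\<alpha>. G f \<alpha> - s * G h \<alpha>)"
    and sym: "\<And>f h. ip f (G h) = ip h (G f)"
    and pos: "\<And>f. 0 \<le> ip f (G f)"
    and bdd: "\<And>f. ip f (G f) \<le> \<Lambda> * ip f f"
    and boch: "0 < g" "\<And>f. g * ip f (G f) \<le> ip (G f) (G f)"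
    and mean: "\<And>f. (\<Sum>\<alpha>\<in>A. w \<alpha> * G f \<alpha>) = 0"
    and weak: "\<And>f. (\<Sum>\<alpha>\<in>A. w \<alpha> * f \<alpha>) = 0 \<Longrightarrow> ip f f \<le> K * ip f (G f)"
    and wpos: "\<And>\<alpha>. 0 \<le> w \<alpha>"
    and f: "(\<Sum>\<alpha>\<in>A. w \<alpha> * f \<alpha>) = 0"
  shows "ip f f \<le> 2 / g * ip f (G f)"
proof -
  \<comment> \<open>\<open>s * \<Lambda> \<le> 1\<close> makes the step lower the quadratic form by
    at least \<open>s * ip (G h) (G h)\<close>, and \<open>s * g \<le> 1\<close> keeps the
    contraction factor \<open>r\<close> nonnegative.\<close>
  define s where "s = 1 / (\<bar>\<Lambda>\<bar> + g)"
  have s: "0 < s" "s * \<Lambda> \<le> 1" "s * g \<le> 1"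
    using boch(1) by (auto simp: s_def field_simps)
  define r where "r = 1 - s * g"
  have r: "0 \<le> r" "r < 1" using s boch by (auto simp: r_def)
  have norm0: "0 \<le> ip h h" for h using wpos by (simp add: ip_def sum_nonneg)
  have ip_step: "ip (\<lambda>\<alpha>. a \<alpha> - s * b \<alpha>) (\<lambda>\<alpha>. c \<alpha> - s * d \<alpha>) = ip a c - s * ip a d - s * ip b c + s\<^sup>2 * ip b d" for a b c d
    unfolding ip_def sum_distrib_left sum_subtractf[symmetric] sum.distrib[symmetric]
    by (intro sum.cong refl) (simp add: algebra_simps power2_eq_square)
  have ip_comm: "ip a b = ip b a" for a b by (simp add: ip_def mult.commute)
  have admissible: "ip h h \<le> (r ^ n * (K - 2 / g) + 2 / g) * ip h (G h)"
    if "(\<Sum>\<alpha>\<in>A. w \<alpha> * h \<alpha>) = 0" for n h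
    using that
  proof (induction n arbitrary: h)
    case 0
    then show ?case using weak by simp
  next
    case (Suc n)
    define h' where "h' = (\<lambda>\<alpha>. h \<alpha> - s * G h \<alpha>)"
    define K' where "K' = r ^ n * (K - 2 / g) + 2 / g"
    have "(\<Sum>\<alpha>\<in>A. w \<alpha> * h' \<alpha>) = (\<Sum>\<alpha>\<in>A. w \<alpha> * h \<alpha>) - s * (\<Sum>\<alpha>\<in>A. w \<alpha> * G h \<alpha>)"
      unfolding h'_def sum_distrib_left sum_subtractf[symmetric]
      by (intro sum.cong refl) (simp add: algebra_simps)
    then have h'0: "(\<Sum>\<alpha>\<in>A. w \<alpha> * h' \<alpha>) = 0" using Suc.prems mean by simp
    then have IH: "ip h' h' \<le> K' * ip h' (G h')" using Suc.IH unfolding K'_def by blast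
    have n1: "ip h' h' = ip h h - 2 * s * ip h (G h) + s\<^sup>2 * ip (G h) (G h)"
      unfolding h'_def ip_step ip_comm[of "G h" h] by simp
    have d1: "ip h' (G h') = ip h (G h) - 2 * s * ip (G h) (G h) + s\<^sup>2 * ip (G h) (G (G h))"
      unfolding h'_def lin ip_step using sym[of h "G h"] by simp
    have "s\<^sup>2 * ip (G h) (G (G h)) \<le> s\<^sup>2 * (\<Lambda> * ip (G h) (G h))" using bdd by (intro mult_left_mono) auto
    also have "\<dots> = s * (s * \<Lambda> * ip (G h) (G h))" by (simp add: power2_eq_square)
    also have "\<dots> \<le> s * (1 * ip (G h) (G h))" using s norm0 by (intro mult_left_mono mult_right_mono) auto
    finally have "ip h' (G h') \<le> ip h (G h) - s * ip (G h) (G h)" unfolding d1 by simp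
    moreover have "s * (g * ip h (G h)) \<le> s * ip (G h) (G h)" using boch(2)[of h] s by (intro mult_left_mono) auto
    ultimately have d2: "ip h' (G h') \<le> r * ip h (G h)" by (simp add: r_def algebra_simps)
    \<comment> \<open>\<open>2 / g\<close> is the fixed point of the update of the constant, since
      \<open>1 - r = s * g\<close>.\<close>
    have next_K: "r ^ Suc n * (K - 2 / g) + 2 / g = r * K' + 2 * s"
      using boch(1) by (simp add: K'_def r_def field_simps)
    have "ip h h \<le> ip h' h' + 2 * s * ip h (G h)"
      unfolding n1 using norm0[of "G h"] by simp
    moreover have "ip h' h' \<le> max 0 K' * ip h' (G h')"
      using IH mult_right_mono[OF max.cobounded2[of K' 0] pos[of h']] by linarith
    moreover have "max 0 K' * ip h' (G h') \<le> max 0 K' * (r * ip h (G h))"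
      using d2 by (intro mult_left_mono) auto
    ultimately have main: "ip h h \<le> (r * max 0 K' + 2 * s) * ip h (G h)" by (simp add: algebra_simps)
    show ?case
    proof (cases "0 \<le> K'")
      case True
      then show ?thesis using main unfolding next_K by (simp add: max_def)
    next
      \<comment> \<open>A negative admissible constant forces \<open>ip h h\<close> and
        \<open>ip h (G h)\<close> to vanish, and then every constant is admissible.\<close>
      case False
      then have "K' * ip h (G h) \<le> 0" using False pos[of h] by (simp add: mult_nonpos_nonneg)
      have "ip h h \<le> K' * ip h (G h)" using Suc.IH[OF Suc.prems] unfolding K'_def .
      then have "ip h h = 0 \<and> K' * ip h (G h) = 0" using norm0[of h] \<open>K' * ip h (G h) \<le> 0\<close> by linarith
      then show ?thesis using False by simp
    qed
  qed
  have "(\<lambda>n. (r ^ n * (K - 2 / g) + 2 / g) * ip f (G f)) \<longlonglongrightarrow> (0 * (K - 2 / g) + 2 / g) * ip f (G f)"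
    using r by (intro tendsto_intros LIMSEQ_realpow_zero) auto
  then have "ip f f \<le> (0 * (K - 2 / g) + 2 / g) * ip f (G f)"
    by (rule LIMSEQ_le_const) (use admissible[OF f] in auto)
  then show ?thesis by simp
qed

section \<open>The auxiliary generator: linearity, symmetry and boundedness\<close>

context bochner
begin

lemma gen_linear: "gen (\<lambda>\<alpha>. f \<alpha> - s * h \<alpha>) = (\<lambda>\<alpha>. gen f \<alpha> - s * gen h \<alpha>)"
proof
  fix \<alpha>
  have "jump (\<lambda>\<alpha>. f \<alpha> - s * h \<alpha>) x y \<alpha> = jump f x y \<alpha> - s * jump h x y \<alpha>" for x y
    by (simp add: jump_def algebra_simps)
  then show "gen (\<lambda>\<alpha>. f \<alpha> - s * h \<alpha>) \<alpha> = gen f \<alpha> - s * gen h \<alpha>"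
    by (simp add: gen_def sum_subtractf sum_distrib_left)
qed

text \<open>Each bond is averaged with its reversal. The expression obtained is symmetric in
  \<open>f\<close> and \<open>h\<close> and vanishes for constant \<open>f\<close>, which yields the
  quadratic form, self-adjointness and invariance of the measure together.\<close>

lemma gen_symmetrized:
  "2 * (\<Sum>\<alpha>\<in>A. w \<alpha> * (f \<alpha> * gen h \<alpha>)) = (\<Sum>x\<in>S. \<Sum>y\<in>S. tt x y *
     (\<Sum>\<alpha>\<in>A. of_bool (\<alpha> x = 1 \<and> \<alpha> y = 0)
        * (w \<alpha> * hop 1 x y * ((f \<alpha> - f (exchange x y \<alpha>)) * (h \<alpha> - h (exchange x y \<alpha>))))))"
proof -
  let ?b = "\<lambda>x y. \<Sum>\<alpha>\<in>A. w \<alpha> * (f \<alpha> * jump h x y \<alpha>)"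
  have "(\<Sum>\<alpha>\<in>A. w \<alpha> * (f \<alpha> * gen h \<alpha>)) = (\<Sum>\<alpha>\<in>A. \<Sum>x\<in>S. \<Sum>y\<in>S. w \<alpha> * (f \<alpha> * jump h x y \<alpha>))"
    by (simp add: gen_def sum_distrib_left)
  also have "\<dots> = (\<Sum>x\<in>S. \<Sum>y\<in>S. ?b x y)"
    by (subst sum.swap, rule sum.cong[OF refl], rule sum.swap)
  finally have B: "(\<Sum>\<alpha>\<in>A. w \<alpha> * (f \<alpha> * gen h \<alpha>)) = (\<Sum>x\<in>S. \<Sum>y\<in>S. ?b x y)" .
  have sw: "(\<Sum>x\<in>S. \<Sum>y\<in>S. ?b x y) = (\<Sum>x\<in>S. \<Sum>y\<in>S. ?b y x)" by (rule sum.swap)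
  have "2 * (\<Sum>x\<in>S. \<Sum>y\<in>S. ?b x y) = (\<Sum>x\<in>S. \<Sum>y\<in>S. ?b x y + ?b y x)"
    unfolding sum.distrib sw[symmetric] by simp
  also have "\<dots> = (\<Sum>x\<in>S. \<Sum>y\<in>S. tt x y *
     (\<Sum>\<alpha>\<in>A. of_bool (\<alpha> x = 1 \<and> \<alpha> y = 0)
        * (w \<alpha> * hop 1 x y * ((f \<alpha> - f (exchange x y \<alpha>)) * (h \<alpha> - h (exchange x y \<alpha>))))))"
  proof (intro sum.cong refl)
    fix x y assume S: "x \<in> S" "y \<in> S"
    have "?b y x = (\<Sum>\<alpha>\<in>A. w (exchange x y \<alpha>) * (f (exchange x y \<alpha>) * jump h y x (exchange x y \<alpha>)))"
      by (rule sum_exchange[symmetric]) (use S in auto)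
    then have "?b x y + ?b y x = (\<Sum>\<alpha>\<in>A. w \<alpha> * (f \<alpha> * jump h x y \<alpha>)
        + w (exchange x y \<alpha>) * (f (exchange x y \<alpha>) * jump h y x (exchange x y \<alpha>)))"
      by (simp add: sum.distrib)
    also have "\<dots> = tt x y * (\<Sum>\<alpha>\<in>A. of_bool (\<alpha> x = 1 \<and> \<alpha> y = 0)
        * (w \<alpha> * hop 1 x y * ((f \<alpha> - f (exchange x y \<alpha>)) * (h \<alpha> - h (exchange x y \<alpha>)))))"
      unfolding sum_distrib_left
    proof (intro sum.cong refl)
      fix \<alpha>
      let ?b = "exchange x y \<alpha>"
      have v: "?b y = \<alpha> x" "x \<noteq> y \<Longrightarrow> ?b x = \<alpha> y" by (auto simp: exchange_apply)
      show "w \<alpha> * (f \<alpha> * jump h x y \<alpha>) + w ?b * (f ?b * jump h y x ?b)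
        = tt x y * (of_bool (\<alpha> x = 1 \<and> \<alpha> y = 0) * (w \<alpha> * hop 1 x y * ((f \<alpha> - f ?b) * (h \<alpha> - h ?b))))"
      proof (cases "\<alpha> x = 1 \<and> \<alpha> y = 0")
        case True
        then have ne: "x \<noteq> y" by auto
        have "w ?b * (f ?b * jump h y x ?b) = w ?b * hop 1 y x * tt x y * (f ?b * (h ?b - h \<alpha>))"
          using True v(1) v(2)[OF ne]
          by (simp add: jump_def exchange_commute[of y x] exchange_exchange layer_dist_commute[of y x])
        also have "w ?b * hop 1 y x = w \<alpha> * hop 1 x y"
          using hop_balance[OF S, of 1 \<alpha>] True by simp
        finally show ?thesis using True by (simp add: jump_def algebra_simps)
      next
        case False
        then have "jump h x y \<alpha> = 0" "jump h y x ?b = 0"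
          by (auto simp: jump_def exchange_apply)
        then show ?thesis using False by auto
      qed
    qed
    finally show "?b x y + ?b y x = \<dots>" .
  qed
  finally show ?thesis unfolding B .
qed

lemma gen_form: "2 * (\<Sum>\<alpha>\<in>A. w \<alpha> * (f \<alpha> * gen f \<alpha>)) = (\<Sum>x\<in>S. \<Sum>y\<in>S. tt x y * conductance f x y)"
  unfolding gen_symmetrized conductance_def power2_eq_square ..

lemma gen_sym: "(\<Sum>\<alpha>\<in>A. w \<alpha> * (f \<alpha> * gen h \<alpha>)) = (\<Sum>\<alpha>\<in>A. w \<alpha> * (h \<alpha> * gen f \<alpha>))"
proof -
  have "2 * (\<Sum>\<alpha>\<in>A. w \<alpha> * (f \<alpha> * gen h \<alpha>)) = 2 * (\<Sum>\<alpha>\<in>A. w \<alpha> * (h \<alpha> * gen f \<alpha>))"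
    unfolding gen_symmetrized by (simp only: mult.commute[of "f _ - f _"])
  then show ?thesis by simp
qed

lemma gen_mean: "(\<Sum>\<alpha>\<in>A. w \<alpha> * gen f \<alpha>) = 0"
  using gen_symmetrized[of "\<lambda>_. 1" f] by simp

lemma tt_pos: "0 < tt x y" and tt_le_1: "tt x y \<le> 1"
  using e by (simp_all add: decay_pos decay_le_1)

lemma gen_form_nonneg: "0 \<le> (\<Sum>\<alpha>\<in>A. w \<alpha> * (f \<alpha> * gen f \<alpha>))"
proof -
  have "0 \<le> 2 * (\<Sum>\<alpha>\<in>A. w \<alpha> * (f \<alpha> * gen f \<alpha>))"
    unfolding gen_form using tt_pos by (intro sum_nonneg mult_nonneg_nonneg conductance_nonneg) (auto simp: less_imp_le)
  then show ?thesis by simp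
qed

text \<open>A crude bound is enough: it only fixes the step size in
  \<open>poincare_from_bochner\<close> and leaves no trace in the final constant.\<close>

lemma gen_form_bounded:
  "(\<Sum>\<alpha>\<in>A. w \<alpha> * (f \<alpha> * gen f \<alpha>)) \<le> 2 * (real (card S))\<^sup>2 * (\<Sum>\<alpha>\<in>A. w \<alpha> * (f \<alpha> * f \<alpha>))"
proof -
  define n where "n = (\<Sum>\<alpha>\<in>A. w \<alpha> * (f \<alpha> * f \<alpha>))"
  have "conductance f x y \<le> 4 * n" if S: "x \<in> S" "y \<in> S" for x y
  proof -
    have "conductance f x y \<le> (\<Sum>\<alpha>\<in>A. 2 * (w \<alpha> * (f \<alpha> * f \<alpha>))
        + 2 * (w (exchange x y \<alpha>) * (f (exchange x y \<alpha>) * f (exchange x y \<alpha>))))"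
      unfolding conductance_def
    proof (rule sum_mono)
      fix \<alpha>
      let ?b = "exchange x y \<alpha>"
      show "of_bool (\<alpha> x = 1 \<and> \<alpha> y = 0) * (w \<alpha> * hop 1 x y * (f \<alpha> - f ?b)\<^sup>2)
        \<le> 2 * (w \<alpha> * (f \<alpha> * f \<alpha>)) + 2 * (w ?b * (f ?b * f ?b))"
      proof (cases "\<alpha> x = 1 \<and> \<alpha> y = 0")
        case True
        have "(f \<alpha> - f ?b)\<^sup>2 \<le> 2 * (f \<alpha>)\<^sup>2 + 2 * (f ?b)\<^sup>2"
          using square_sum_young[of 1 "f \<alpha>" "- f ?b"] by simp
        then have "w \<alpha> * hop 1 x y * (f \<alpha> - f ?b)\<^sup>2 \<le> w \<alpha> * hop 1 x y * (2 * (f \<alpha>)\<^sup>2 + 2 * (f ?b)\<^sup>2)"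
          using w_pos[of \<alpha>] hop_pos[of 1 x y] by (intro mult_left_mono) auto
        also have "\<dots> = hop 1 x y * (2 * (w \<alpha> * (f \<alpha> * f \<alpha>))) + (w \<alpha> * hop 1 x y) * (2 * (f ?b)\<^sup>2)"
          by (simp add: algebra_simps power2_eq_square)
        also have "w \<alpha> * hop 1 x y * (2 * (f ?b)\<^sup>2) = hop 1 y x * (2 * (w ?b * (f ?b * f ?b)))"
        proof -
          have "w \<alpha> * hop 1 x y = w ?b * hop 1 y x" using hop_balance[OF S, of 1 \<alpha>] True by simp
          then show ?thesis by (simp add: power2_eq_square)
        qed
        also have "hop 1 x y * (2 * (w \<alpha> * (f \<alpha> * f \<alpha>))) + hop 1 y x * (2 * (w ?b * (f ?b * f ?b)))
          \<le> 1 * (2 * (w \<alpha> * (f \<alpha> * f \<alpha>))) + 1 * (2 * (w ?b * (f ?b * f ?b)))"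
          using w_pos[of \<alpha>] w_pos[of ?b] hop_le_1 by (intro add_mono mult_right_mono) (auto simp: less_imp_le)
        finally show ?thesis using True by simp
      next
        case False
        then show ?thesis using w_pos[of \<alpha>] w_pos[of ?b] by (auto intro!: add_nonneg_nonneg simp: less_imp_le)
      qed
    qed
    also have "\<dots> = 4 * n"
      unfolding sum.distrib sum_distrib_left[symmetric]
        sum_exchange[OF S, where g = "\<lambda>\<alpha>. w \<alpha> * (f \<alpha> * f \<alpha>)"] n_def by simp
    finally show ?thesis .
  qed
  then have "2 * (\<Sum>\<alpha>\<in>A. w \<alpha> * (f \<alpha> * gen f \<alpha>)) \<le> (\<Sum>x\<in>S. \<Sum>y\<in>S. 1 * (4 * n))"
    unfolding gen_form using tt_le_1 tt_pos
    by (intro sum_mono mult_mono) (auto simp: conductance_nonneg less_imp_le)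
  then show ?thesis by (simp add: n_def power2_eq_square)
qed

end

section \<open>A Poincare inequality with some constant, and the comparison with neighbouring
  layers\<close>

context bochner
begin

lemma square_diff_exchange_le:
  assumes "\<alpha> \<in> A" "x \<in> S" "y \<in> S" "\<alpha> x = 1" "\<alpha> y = 0"
  shows "\<exists>C. \<forall>f. (f \<alpha> - f (exchange x y \<alpha>))\<^sup>2 \<le> C * (\<Sum>\<beta>\<in>A. w \<beta> * (f \<beta> * gen f \<beta>))"
proof (intro exI allI)
  fix f
  let ?c = "tt x y * (w \<alpha> * hop 1 x y)"
  have c: "0 < ?c" using tt_pos w_pos hop_pos by simp
  have "w \<alpha> * hop 1 x y * (f \<alpha> - f (exchange x y \<alpha>))\<^sup>2 \<le> conductance f x y"
  proof -
    have "of_bool (\<alpha> x = 1 \<and> \<alpha> y = 0) * (w \<alpha> * hop 1 x y * (f \<alpha> - f (exchange x y \<alpha>))\<^sup>2) \<le> conductance f x y"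
      unfolding conductance_def using assms w_pos hop_pos finite_Omega_N
      by (intro member_le_sum) (auto simp: less_imp_le)
    then show ?thesis using assms by simp
  qed
  then have "?c * (f \<alpha> - f (exchange x y \<alpha>))\<^sup>2 \<le> tt x y * conductance f x y"
    using tt_pos[of x y] by (simp add: mult.assoc)
  also have "\<dots> \<le> (\<Sum>y\<in>S. tt x y * conductance f x y)"
    using assms tt_pos conductance_nonneg finite_Lattice
    by (intro member_le_sum[where f = "\<lambda>y. tt x y * conductance f x y"]) (auto simp: less_imp_le)
  also have "\<dots> \<le> (\<Sum>x\<in>S. \<Sum>y\<in>S. tt x y * conductance f x y)"
    using assms tt_pos conductance_nonneg finite_Lattice
    by (intro member_le_sum[where f = "\<lambda>x. \<Sum>y\<in>S. tt x y * conductance f x y"] sum_nonneg) (auto simp: less_imp_le)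
  finally show "(f \<alpha> - f (exchange x y \<alpha>))\<^sup>2 \<le> 2 / ?c * (\<Sum>\<beta>\<in>A. w \<beta> * (f \<beta> * gen f \<beta>))"
    using c unfolding gen_form[symmetric] by (simp add: field_simps)
qed

text \<open>Connectedness of the state space, with a constant independent of \<open>f\<close>. Equal
  particle numbers provide a particle of \<open>\<alpha>\<close> missing in \<open>\<beta>\<close>
  and a particle of \<open>\<beta>\<close> missing in \<open>\<alpha>\<close>; exchanging the two
  sites reduces the number of disagreements.\<close>

lemma square_diff_le:
  assumes "\<alpha> \<in> A" "\<beta> \<in> A"
  shows "\<exists>C. \<forall>f. (f \<alpha> - f \<beta>)\<^sup>2 \<le> C * (\<Sum>\<gamma>\<in>A. w \<gamma> * (f \<gamma> * gen f \<gamma>))"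
  using assms
proof (induction "card {x\<in>S. \<alpha> x \<noteq> \<beta> x}" arbitrary: \<alpha> rule: less_induct)
  case less
  show ?case
  proof (cases "\<alpha> = \<beta>")
    case True
    then show ?thesis by (intro exI[of _ 0]) auto
  next
    case False
    have sums: "(\<Sum>x\<in>S. \<alpha> x) = (\<Sum>x\<in>S. \<beta> x)" using less.prems by (simp add: Omega_N_def)
    have ext: "\<alpha> = \<beta>" if "\<And>x. x \<in> S \<Longrightarrow> \<alpha> x = \<beta> x"
      using less.prems that unfolding Omega_N_def Omega_def by (intro PiE_ext[of \<alpha> S "\<lambda>_. {0, 1}"]) auto
    have ex: "\<exists>x\<in>S. \<gamma> x = 1 \<and> \<delta> x = 0"
      if "\<gamma> \<in> A" "\<delta> \<in> A" "\<exists>x\<in>S. \<gamma> x \<noteq> \<delta> x" "(\<Sum>x\<in>S. \<gamma> x) = (\<Sum>x\<in>S. \<delta> x)" for \<gamma> \<delta>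
    proof (rule ccontr)
      assume no: "\<not> (\<exists>x\<in>S. \<gamma> x = 1 \<and> \<delta> x = 0)"
      have le: "\<gamma> x \<le> \<delta> x" if "x \<in> S" for x
        using no that Omega_N_01[OF \<open>\<gamma> \<in> A\<close> that] Omega_N_01[OF \<open>\<delta> \<in> A\<close> that] by auto
      have "(\<Sum>x\<in>S. \<gamma> x) < (\<Sum>x\<in>S. \<delta> x)"
        using finite_Lattice le that(3) by (intro sum_strict_mono_ex1) (auto simp: order_less_le)
      then show False using that(4) by simp
    qed
    have "\<exists>x\<in>S. \<alpha> x \<noteq> \<beta> x" using ext False by blast
    then obtain x y where x: "x \<in> S" "\<alpha> x = 1" "\<beta> x = 0" and y: "y \<in> S" "\<beta> y = 1" "\<alpha> y = 0"
      using ex[OF less.prems _ sums] ex[OF less.prems(2,1) _ sums[symmetric]] by metis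
    let ?a = "exchange x y \<alpha>"
    have a: "?a \<in> A" by (rule exchange_Omega_N[OF x(1) y(1) less.prems(1)])
    have "{z\<in>S. ?a z \<noteq> \<beta> z} \<subseteq> {z\<in>S. \<alpha> z \<noteq> \<beta> z} - {x}"
      using x y by (auto simp: exchange_apply split: if_splits)
    moreover have "x \<in> {z\<in>S. \<alpha> z \<noteq> \<beta> z}" using x by simp
    ultimately have "{z\<in>S. ?a z \<noteq> \<beta> z} \<subset> {z\<in>S. \<alpha> z \<noteq> \<beta> z}" by blast
    then have "card {z\<in>S. ?a z \<noteq> \<beta> z} < card {z\<in>S. \<alpha> z \<noteq> \<beta> z}"
      using finite_Lattice by (intro psubset_card_mono) auto
    then obtain C where C: "\<And>f. (f ?a - f \<beta>)\<^sup>2 \<le> C * (\<Sum>\<gamma>\<in>A. w \<gamma> * (f \<gamma> * gen f \<gamma>))"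
      using less.hyps[OF _ a less.prems(2)] by blast
    obtain D where D: "\<And>f. (f \<alpha> - f ?a)\<^sup>2 \<le> D * (\<Sum>\<gamma>\<in>A. w \<gamma> * (f \<gamma> * gen f \<gamma>))"
      using square_diff_exchange_le[OF less.prems(1) x(1) y(1) x(2) y(3)] by blast
    have "(f \<alpha> - f \<beta>)\<^sup>2 \<le> (2 * D + 2 * C) * (\<Sum>\<gamma>\<in>A. w \<gamma> * (f \<gamma> * gen f \<gamma>))" for f
      using square_sum_young[of 1 "f \<alpha> - f ?a" "f ?a - f \<beta>"] C[of f] D[of f]
      by (simp add: algebra_simps)
    then show ?thesis by blast
  qed
qed

text \<open>The starting point of the iteration in \<open>poincare_from_bochner\<close>, where the
  size of \<open>K\<close> is irrelevant. The variance is written as a double sum of squared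
  differences.\<close>

lemma weak_poincare:
  "\<exists>K. \<forall>f. (\<Sum>\<alpha>\<in>A. w \<alpha> * f \<alpha>) = 0 \<longrightarrow>
     (\<Sum>\<alpha>\<in>A. w \<alpha> * (f \<alpha> * f \<alpha>)) \<le> K * (\<Sum>\<gamma>\<in>A. w \<gamma> * (f \<gamma> * gen f \<gamma>))"
proof (cases "A = {}")
  case False
  define Z where "Z = (\<Sum>\<alpha>\<in>A. w \<alpha>)"
  have Z: "0 < Z" unfolding Z_def using False finite_Omega_N w_pos by (intro sum_pos) auto
  obtain C where C: "\<And>\<alpha> \<beta> f. \<alpha> \<in> A \<Longrightarrow> \<beta> \<in> A \<Longrightarrow>
      (f \<alpha> - f \<beta>)\<^sup>2 \<le> C \<alpha> \<beta> * (\<Sum>\<gamma>\<in>A. w \<gamma> * (f \<gamma> * gen f \<gamma>))"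
    using square_diff_le by metis
  define K where "K = (\<Sum>\<alpha>\<in>A. \<Sum>\<beta>\<in>A. w \<alpha> * w \<beta> * C \<alpha> \<beta>) / (2 * Z)"
  show ?thesis
  proof (intro exI allI impI)
    fix f assume f: "(\<Sum>\<alpha>\<in>A. w \<alpha> * f \<alpha>) = 0"
    define D where "D = (\<Sum>\<gamma>\<in>A. w \<gamma> * (f \<gamma> * gen f \<gamma>))"
    define V where "V = (\<Sum>\<alpha>\<in>A. w \<alpha> * (f \<alpha> * f \<alpha>))"
    have "(\<Sum>\<alpha>\<in>A. \<Sum>\<beta>\<in>A. w \<alpha> * w \<beta> * (f \<alpha> - f \<beta>)\<^sup>2) = 2 * Z * V"
    proof -
      have "(\<Sum>\<beta>\<in>A. w \<alpha> * w \<beta> * (f \<alpha> - f \<beta>)\<^sup>2) = w \<alpha> * (f \<alpha> * f \<alpha>) * Z + w \<alpha> * V" for \<alpha>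
      proof -
        have "(\<Sum>\<beta>\<in>A. w \<alpha> * w \<beta> * (f \<alpha> - f \<beta>)\<^sup>2)
          = (\<Sum>\<beta>\<in>A. w \<alpha> * (f \<alpha> * f \<alpha>) * w \<beta> + w \<alpha> * (w \<beta> * (f \<beta> * f \<beta>)) - 2 * (w \<alpha> * f \<alpha>) * (w \<beta> * f \<beta>))"
          by (intro sum.cong refl) (simp add: algebra_simps power2_eq_square)
        also have "\<dots> = w \<alpha> * (f \<alpha> * f \<alpha>) * Z + w \<alpha> * V - 2 * (w \<alpha> * f \<alpha>) * (\<Sum>\<beta>\<in>A. w \<beta> * f \<beta>)"
          by (simp only: sum.distrib sum_subtractf sum_distrib_left[symmetric] Z_def V_def)
        finally show ?thesis using f by simp
      qed
      then show ?thesis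
        by (simp add: sum.distrib sum_distrib_right[symmetric] Z_def[symmetric] V_def[symmetric])
    qed
    moreover have "(\<Sum>\<alpha>\<in>A. \<Sum>\<beta>\<in>A. w \<alpha> * w \<beta> * (f \<alpha> - f \<beta>)\<^sup>2)
      \<le> (\<Sum>\<alpha>\<in>A. \<Sum>\<beta>\<in>A. w \<alpha> * w \<beta> * (C \<alpha> \<beta> * D))"
      unfolding D_def using C w_pos by (intro sum_mono mult_left_mono) (auto simp: less_imp_le)
    moreover have "(\<Sum>\<alpha>\<in>A. \<Sum>\<beta>\<in>A. w \<alpha> * w \<beta> * (C \<alpha> \<beta> * D)) = 2 * Z * (K * D)"
      using Z by (simp add: K_def sum_distrib_right mult.assoc)
    ultimately have "2 * Z * V \<le> 2 * Z * (K * D)" by linarith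
    then show "V \<le> K * D" using Z by simp
  qed
qed auto

text \<open>Two layers at distance \<open>d\<close> are bounded by \<open>d\<close> times the sum
  over the \<open>d\<close> neighbouring pairs between them, and a given neighbouring pair serves at
  most \<open>d\<close> such pairs of layers. This is where \<open>d\<^sup>2 * t d\<close> comes
  from.\<close>

lemma gen_form_le_neighbours:
  assumes L: "1 \<le> L" and H: "2 \<le> H" and C: "\<And>M. (\<Sum>d=1..M. (real d)\<^sup>2 * t d) \<le> C"
  shows "(\<Sum>\<alpha>\<in>A. w \<alpha> * (f \<alpha> * gen f \<alpha>)) \<le> (4 / q\<^sup>2 + C) * neighbours f"
proof -
  let ?n = "neighbours f" and ?l = "layers f"
  let ?\<phi> = "\<lambda>h h'. t ((h - h') + (h' - h))"
  have q2: "0 < 4 / q\<^sup>2" using q by simp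
  have "2 * (\<Sum>\<alpha>\<in>A. w \<alpha> * (f \<alpha> * gen f \<alpha>)) = (\<Sum>h=1..H. \<Sum>h'=1..H. ?\<phi> h h' * ?l h h')"
    unfolding gen_form layer_dist_def by (rule sum_Lattice_pairs)
  also have "\<dots> = (\<Sum>h=1..H. ?l h h) + (\<Sum>h=1..H. \<Sum>h'=1..H. of_bool (h \<noteq> h') * (?\<phi> h h' * ?l h h'))"
    by (subst sum_sum_diagonal) auto
  also have "(\<Sum>h=1..H. \<Sum>h'=1..H. of_bool (h \<noteq> h') * (?\<phi> h h' * ?l h h'))
      = 2 * (\<Sum>h=1..H. \<Sum>h'=1..H. of_bool (h < h') * (?\<phi> h h' * ?l h h'))"
  proof -
    have "(\<Sum>h=1..H. \<Sum>h'=1..H. of_bool (h' < h) * (?\<phi> h h' * ?l h h'))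
        = (\<Sum>h=1..H. \<Sum>h'=1..H. of_bool (h < h') * (?\<phi> h h' * ?l h h'))"
      by (subst sum.swap, intro sum.cong refl) (simp add: layers_commute add.commute)
    moreover have "(\<Sum>h=1..H. \<Sum>h'=1..H. of_bool (h \<noteq> h') * (?\<phi> h h' * ?l h h'))
        = (\<Sum>h=1..H. \<Sum>h'=1..H. of_bool (h < h') * (?\<phi> h h' * ?l h h') + of_bool (h' < h) * (?\<phi> h h' * ?l h h'))"
      by (intro sum.cong refl) auto
    ultimately show ?thesis by (simp add: sum.distrib)
  qed
  also have "(\<Sum>h=1..H. ?l h h) \<le> 2 * (4 / q\<^sup>2 * ?n)"
  proof -
    \<comment> \<open>Every layer is compared with the one above it, except the top layer, which is
      compared with the one below; hence the factor \<open>2\<close>.\<close>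
    have "{1..H} = insert H {1..H-1}" using H by auto
    then have "(\<Sum>h=1..H. ?l h h) = ?l H H + (\<Sum>h=1..H-1. ?l h h)" using H by simp
    also have "(\<Sum>h=1..H-1. ?l h h) \<le> (\<Sum>h=1..H-1. 4 / q\<^sup>2 * ?l h (h + 1))"
      using L by (intro sum_mono layers_same) auto
    also have "\<dots> = 4 / q\<^sup>2 * ?n" by (simp add: neighbours_def sum_distrib_left)
    also have "?l H H \<le> 4 / q\<^sup>2 * ?n"
    proof -
      have "?l H H \<le> 4 / q\<^sup>2 * ?l (H - 1) (H - 1 + 1)" using layers_same(2)[of "H - 1" f] L H by simp
      also have "\<dots> \<le> 4 / q\<^sup>2 * ?n"
      proof (rule mult_left_mono)
        show "?l (H - 1) (H - 1 + 1) \<le> ?n"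
          unfolding neighbours_def using H layers_nonneg
          by (intro member_le_sum[where f = "\<lambda>h. ?l h (h + 1)"]) auto
      qed (use q2 in simp)
      finally show ?thesis .
    qed
    finally show ?thesis by simp
  qed
  also have "(\<Sum>h=1..H. \<Sum>h'=1..H. of_bool (h < h') * (?\<phi> h h' * ?l h h')) \<le> C * ?n"
  proof -
    have row: "(\<Sum>h'=1..H. of_bool (h < h') * (?\<phi> h h' * ?l h h'))
        \<le> (\<Sum>d<H. of_bool (h + Suc d \<le> H) * (t (Suc d) * (real (Suc d) * (\<Sum>j\<le>d. ?l (h + j) (h + j + 1)))))"
      if h: "h \<in> {1..H}" for h
    proof -
      have "(\<Sum>h'=1..H. of_bool (h < h') * (?\<phi> h h' * ?l h h')) = (\<Sum>h'\<in>{h<..H}. t (h' - h) * ?l h h')"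
        by (intro sum.mono_neutral_cong_right) auto
      also have "\<dots> = (\<Sum>d\<in>{..<H-h}. t (Suc d) * ?l h (h + Suc d))"
        by (rule sum.reindex_bij_witness[of _ "\<lambda>d. h + Suc d" "\<lambda>h'. h' - Suc h"]) (auto simp: Suc_diff_Suc)
      also have "\<dots> \<le> (\<Sum>d\<in>{..<H-h}. t (Suc d) * (real (Suc d) * (\<Sum>j\<le>d. ?l (h + j) (h + j + 1))))"
        using L h e by (intro sum_mono mult_left_mono layers_chain) (auto simp: decay_pos less_imp_le)
      also have "\<dots> = (\<Sum>d<H. of_bool (h + Suc d \<le> H) * (t (Suc d) * (real (Suc d) * (\<Sum>j\<le>d. ?l (h + j) (h + j + 1)))))"
        by (intro sum.mono_neutral_cong_left) auto
      finally show ?thesis .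
    qed
    \<comment> \<open>For a fixed offset \<open>j\<close> different \<open>h\<close> give different
      neighbouring pairs; the \<open>d + 1\<close> offsets supply the second factor
      \<open>real (Suc d)\<close>.\<close>
    have shift: "(\<Sum>h=1..H. of_bool (h + Suc d \<le> H) * ?l (h + j) (h + j + 1)) \<le> ?n" if "j \<le> d" for j d
    proof -
      have "(\<Sum>h=1..H. of_bool (h + Suc d \<le> H) * ?l (h + j) (h + j + 1)) = (\<Sum>h\<in>{1..H - Suc d}. ?l (h + j) (h + j + 1))"
        by (intro sum.mono_neutral_cong_right) auto
      also have "\<dots> = (\<Sum>h\<in>{1 + j..H - Suc d + j}. ?l h (h + 1))"
        by (rule sum.reindex_bij_witness[of _ "\<lambda>h. h - j" "\<lambda>h. h + j"]) auto
      also have "\<dots> \<le> ?n"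
        unfolding neighbours_def using that layers_nonneg by (intro sum_mono2) auto
      finally show ?thesis .
    qed
    have "(\<Sum>h=1..H. \<Sum>h'=1..H. of_bool (h < h') * (?\<phi> h h' * ?l h h'))
      \<le> (\<Sum>h=1..H. \<Sum>d<H. of_bool (h + Suc d \<le> H) * (t (Suc d) * (real (Suc d) * (\<Sum>j\<le>d. ?l (h + j) (h + j + 1)))))"
      by (intro sum_mono row)
    also have "\<dots> = (\<Sum>d<H. \<Sum>h=1..H. of_bool (h + Suc d \<le> H) * (t (Suc d) * (real (Suc d) * (\<Sum>j\<le>d. ?l (h + j) (h + j + 1)))))"
      by (rule sum.swap)
    also have "\<dots> = (\<Sum>d<H. t (Suc d) * real (Suc d) * (\<Sum>j\<le>d. \<Sum>h=1..H. of_bool (h + Suc d \<le> H) * ?l (h + j) (h + j + 1)))"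
    proof (intro sum.cong refl)
      fix d
      show "(\<Sum>h=1..H. of_bool (h + Suc d \<le> H) * (t (Suc d) * (real (Suc d) * (\<Sum>j\<le>d. ?l (h + j) (h + j + 1)))))
        = t (Suc d) * real (Suc d) * (\<Sum>j\<le>d. \<Sum>h=1..H. of_bool (h + Suc d \<le> H) * ?l (h + j) (h + j + 1))"
        by (subst sum.swap[of _ "{1..H}" "{..d}"]) (simp only: sum_distrib_left mult_ac)
    qed
    also have "\<dots> \<le> (\<Sum>d<H. t (Suc d) * real (Suc d) * (\<Sum>j\<le>d. ?n))"
      using e by (intro sum_mono mult_left_mono shift) (auto simp: decay_pos less_imp_le)
    also have "\<dots> = (\<Sum>d<H. (real (Suc d))\<^sup>2 * t (Suc d)) * ?n"
      unfolding sum_distrib_right by (intro sum.cong refl) (simp add: power2_eq_square)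
    also have "(\<Sum>d<H. (real (Suc d))\<^sup>2 * t (Suc d)) = (\<Sum>d=1..H. (real d)\<^sup>2 * t d)"
      by (rule sum.reindex_bij_witness[of _ "\<lambda>d. d - 1" Suc]) auto
    also have "(\<Sum>d=1..H. (real d)\<^sup>2 * t d) * ?n \<le> C * ?n"
      using C neighbours_nonneg by (intro mult_right_mono) auto
    finally show ?thesis .
  qed
  finally show ?thesis by (simp add: distrib_right)
qed

end

context gap_setting
begin

lemma neighbours_le_gen:
  "real L * q\<^sup>2 / 1024 * neighbours f \<le> (\<Sum>\<alpha>\<in>A. w \<alpha> * (gen f \<alpha> * gen f \<alpha>))"
proof -
  let ?c = "real L * q\<^sup>2 / 512"
  let ?\<phi> = "\<lambda>h h'::nat. of_bool ((h - h') + (h' - h) = 1) * ?c"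
  have c: "0 \<le> ?c" by simp
  have "?c * neighbours f = (\<Sum>h=1..H-1. ?\<phi> h (h + 1) * layers f h (h + 1))"
    by (simp add: neighbours_def sum_distrib_left)
  also have "\<dots> \<le> (\<Sum>h=1..H-1. \<Sum>h'=1..H. ?\<phi> h h' * layers f h h')"
  proof (rule sum_mono)
    fix h assume "h \<in> {1..H-1}"
    then show "?\<phi> h (h + 1) * layers f h (h + 1) \<le> (\<Sum>h'=1..H. ?\<phi> h h' * layers f h h')"
      using c layers_nonneg by (intro member_le_sum[where f = "\<lambda>h'. ?\<phi> h h' * layers f h h'"]) auto
  qed
  also have "\<dots> \<le> (\<Sum>h=1..H. \<Sum>h'=1..H. ?\<phi> h h' * layers f h h')"
    using c layers_nonneg by (intro sum_mono2 sum_nonneg mult_nonneg_nonneg) auto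
  also have "\<dots> = (\<Sum>x\<in>S. \<Sum>y\<in>S. ?\<phi> (snd x) (snd y) * conductance f x y)"
    by (rule sum_Lattice_pairs[symmetric])
  also have "\<dots> \<le> (\<Sum>x\<in>S. \<Sum>y\<in>S. curvature x y * conductance f x y)"
  proof (intro sum_mono)
    fix x y assume S: "x \<in> S" "y \<in> S"
    show "?\<phi> (snd x) (snd y) * conductance f x y \<le> curvature x y * conductance f x y"
    proof (cases "x = y")
      case False
      then show ?thesis
        using curvature_lower[OF S False] unfolding layer_dist_def
        by (intro mult_right_mono conductance_nonneg)
    qed (simp add: conductance_self)
  qed
  also have "\<dots> \<le> 2 * (\<Sum>\<alpha>\<in>A. w \<alpha> * (gen f \<alpha>)\<^sup>2)" by (rule bochner_lower)
  finally show ?thesis by (simp add: power2_eq_square)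
qed

text \<open>The comparison with neighbouring layers is used twice, to turn the Bochner bound into a
  spectral gap of order \<open>L\<close> and to return from the auxiliary form to
  \<open>neighbours\<close>. This accounts for the square.\<close>

lemma poincare_neighbours:
  assumes L: "1 \<le> L" and H: "2 \<le> H" and C: "\<And>M. (\<Sum>d=1..M. (real d)\<^sup>2 * t d) \<le> C"
    and f: "(\<Sum>\<alpha>\<in>A. w \<alpha> * f \<alpha>) = 0"
  shows "(\<Sum>\<alpha>\<in>A. w \<alpha> * (f \<alpha> * f \<alpha>)) \<le> 2048 * (4 / q\<^sup>2 + C)\<^sup>2 / q\<^sup>2 * (neighbours f / real L)"
proof -
  define K where "K = 4 / q\<^sup>2 + C"
  have q2: "0 < q\<^sup>2" using q by simp
  have "0 \<le> C" using C[of 0] by simp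
  then have K: "0 < K" using q2 by (simp add: K_def add_pos_nonneg)
  have L0: "0 < real L" using L by simp
  define g where "g = real L * q\<^sup>2 / 1024 / K"
  have g: "0 < g" using L0 q2 K by (simp add: g_def)
  have comp: "(\<Sum>\<alpha>\<in>A. w \<alpha> * (h \<alpha> * gen h \<alpha>)) \<le> K * neighbours h" for h
    unfolding K_def by (rule gen_form_le_neighbours[OF L H C])
  have boch: "g * (\<Sum>\<alpha>\<in>A. w \<alpha> * (h \<alpha> * gen h \<alpha>)) \<le> (\<Sum>\<alpha>\<in>A. w \<alpha> * (gen h \<alpha> * gen h \<alpha>))" for h
  proof -
    have "g * (\<Sum>\<alpha>\<in>A. w \<alpha> * (h \<alpha> * gen h \<alpha>)) \<le> g * (K * neighbours h)"
      using comp g by (intro mult_left_mono) auto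
    also have "\<dots> = real L * q\<^sup>2 / 1024 * neighbours h" using K by (simp add: g_def)
    also have "\<dots> \<le> (\<Sum>\<alpha>\<in>A. w \<alpha> * (gen h \<alpha> * gen h \<alpha>))" by (rule neighbours_le_gen)
    finally show ?thesis .
  qed
  obtain K0 where K0: "\<And>h. (\<Sum>\<alpha>\<in>A. w \<alpha> * h \<alpha>) = 0 \<Longrightarrow>
     (\<Sum>\<alpha>\<in>A. w \<alpha> * (h \<alpha> * h \<alpha>)) \<le> K0 * (\<Sum>\<gamma>\<in>A. w \<gamma> * (h \<gamma> * gen h \<gamma>))"
    using weak_poincare by blast
  have "(\<Sum>\<alpha>\<in>A. w \<alpha> * (f \<alpha> * f \<alpha>)) \<le> 2 / g * (\<Sum>\<alpha>\<in>A. w \<alpha> * (f \<alpha> * gen f \<alpha>))"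
  proof (rule poincare_from_bochner[OF gen_linear gen_sym gen_form_nonneg gen_form_bounded g boch gen_mean])
    show "0 \<le> w \<alpha>" for \<alpha> by (rule less_imp_le[OF w_pos])
  qed (use K0 f in blast)+
  also have "\<dots> \<le> 2 / g * (K * neighbours f)" using comp g by (intro mult_left_mono) auto
  also have "\<dots> = 2048 * K\<^sup>2 / q\<^sup>2 * (neighbours f / real L)"
    using K q2 L0 by (simp add: g_def field_simps power2_eq_square)
  finally show ?thesis by (simp add: K_def)
qed

end

section \<open>The Dirichlet form of the process\<close>

context exclusion
begin

lemma conductance_shift: "conductance (\<lambda>\<alpha>. f \<alpha> - m) = conductance f"
  by (simp add: conductance_def fun_eq_iff)

lemma neighbours_shift: "neighbours (\<lambda>\<alpha>. f \<alpha> - m) = neighbours f"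
  by (simp add: neighbours_def layers_def conductance_shift)

text \<open>On a particle-hole pair the rate of the process is \<open>hop\<close> divided by
  \<open>q\<close> in either direction, and sites with equal values contribute nothing.\<close>

lemma bond_form:
  assumes x: "x \<in> S" and y: "y \<in> S" and xy: "snd y = snd x + 1"
  shows "(\<Sum>\<alpha>\<in>A. w \<alpha> * (rate q x y \<alpha> * (nabla x y f \<alpha>)\<^sup>2)) = 2 / q * conductance f x y"
proof -
  have hops: "hop 1 x y = q\<^sup>2" "hop 1 y x = 1"
    using xy by (simp_all add: hop_def depth_def)
  have "q * (\<Sum>\<alpha>\<in>A. w \<alpha> * (rate q x y \<alpha> * (nabla x y f \<alpha>)\<^sup>2)) = conductance f x y + conductance f y x"
    unfolding conductance_def sum_distrib_left sum.distrib[symmetric]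
  proof (intro sum.cong refl)
    fix \<alpha> assume a: "\<alpha> \<in> A"
    have eq: "exchange x y \<alpha> = \<alpha>" if "\<alpha> x = \<alpha> y" using that by (auto simp: exchange_apply fun_eq_iff)
    show "q * (w \<alpha> * (rate q x y \<alpha> * (nabla x y f \<alpha>)\<^sup>2))
      = of_bool (\<alpha> x = 1 \<and> \<alpha> y = 0) * (w \<alpha> * hop 1 x y * (f \<alpha> - f (exchange x y \<alpha>))\<^sup>2)
      + of_bool (\<alpha> y = 1 \<and> \<alpha> x = 0) * (w \<alpha> * hop 1 y x * (f \<alpha> - f (exchange y x \<alpha>))\<^sup>2)"
      using Omega_N_01[OF a x] Omega_N_01[OF a y] q eq
      by (auto simp: hops hops[unfolded One_nat_def] rate_def nabla_def exchange_commute[of y x]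
          power2_commute[of "f (exchange x y \<alpha>)"] power2_eq_square[of q] power_int_minus)
  qed
  then show ?thesis using conductance_commute[OF x y, of f] q by (simp add: field_simps)
qed

lemma Dirichlet_eq_neighbours:
  assumes N: "N \<le> L * H"
  shows "Dirichlet q L H N f = neighbours f / (real L * q * (\<Sum>\<alpha>\<in>A. w \<alpha>))"
proof -
  define Z where "Z = (\<Sum>\<alpha>\<in>A. w \<alpha>)"
  have "D_cols q L H N i j f = (\<Sum>h=1..H-1. conductance f (i, h) (j, h + 1)) / (q * Z)"
    if "i \<in> {1..L}" "j \<in> {1..L}" for i j
  proof -
    have "(LINT \<alpha>|nu q L H N. rate q (i, h) (j, h + 1) \<alpha> * (nabla (i, h) (j, h + 1) f \<alpha>)\<^sup>2)
      = 2 * (conductance f (i, h) (j, h + 1) / (q * Z))" if "h \<in> {1..H-1}" for h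
      unfolding nu_expectation[OF q(1) N] using that \<open>i \<in> _\<close> \<open>j \<in> _\<close>
      by (subst bond_form) (auto simp: Lattice_def Z_def)
    then have "D_cols q L H N i j f = 1 / 2 * (\<Sum>h=1..H-1. 2 * (conductance f (i, h) (j, h + 1) / (q * Z)))"
      unfolding D_cols_def by (intro arg_cong[where f = "\<lambda>s. 1 / 2 * s"] sum.cong refl)
    then show ?thesis by (simp add: sum_distrib_left sum_divide_distrib)
  qed
  then have "Dirichlet q L H N f
      = 1 / real L * (\<Sum>i=1..L. \<Sum>j=1..L. (\<Sum>h=1..H-1. conductance f (i, h) (j, h + 1)) / (q * Z))"
    unfolding Dirichlet_eq_D_cols[OF q(1) N] by (intro arg_cong[where f = "\<lambda>s. 1 / real L * s"] sum.cong refl)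
  also have "\<dots> = 1 / real L * ((\<Sum>i=1..L. \<Sum>j=1..L. \<Sum>h=1..H-1. conductance f (i, h) (j, h + 1)) / (q * Z))"
    by (simp add: sum_divide_distrib)
  also have "(\<Sum>i=1..L. \<Sum>j=1..L. \<Sum>h=1..H-1. conductance f (i, h) (j, h + 1)) = neighbours f"
  proof -
    have "(\<Sum>i=1..L. \<Sum>j=1..L. \<Sum>h=1..H-1. conductance f (i, h) (j, h + 1))
      = (\<Sum>i=1..L. \<Sum>h=1..H-1. \<Sum>j=1..L. conductance f (i, h) (j, h + 1))"
      by (rule sum.cong[OF refl]) (rule sum.swap)
    also have "\<dots> = neighbours f" unfolding neighbours_def layers_def by (rule sum.swap)
    finally show ?thesis .
  qed
  finally show ?thesis by (simp add: Z_def mult.assoc)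
qed

end

context gap_setting
begin

lemma Var_le_Dirichlet:
  assumes L: "1 \<le> L" and H: "2 \<le> H" and N: "N \<le> L * H" and C: "\<And>M. (\<Sum>d=1..M. (real d)\<^sup>2 * t d) \<le> C"
  shows "Var (nu q L H N) f \<le> 2048 * (4 / q\<^sup>2 + C)\<^sup>2 / q * Dirichlet q L H N f"
proof -
  define Z where "Z = (\<Sum>\<alpha>\<in>A. w \<alpha>)"
  have Z: "0 < Z" unfolding Z_def by (rule sum_mu_weight_pos[OF q(1) N])
  define m where "m = (LINT \<alpha>|nu q L H N. f \<alpha>)"
  have m: "m * Z = (\<Sum>\<alpha>\<in>A. w \<alpha> * f \<alpha>)"
    using Z unfolding m_def nu_expectation[OF q(1) N] Z_def[symmetric] by simp
  have "(\<Sum>\<alpha>\<in>A. w \<alpha> * (f \<alpha> - m)) = (\<Sum>\<alpha>\<in>A. w \<alpha> * f \<alpha>) - m * Z"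
    by (simp add: Z_def sum_distrib_left sum_subtractf[symmetric] algebra_simps)
  then have 0: "(\<Sum>\<alpha>\<in>A. w \<alpha> * (f \<alpha> - m)) = 0" using m by simp
  have "Var (nu q L H N) f = (\<Sum>\<alpha>\<in>A. w \<alpha> * ((f \<alpha> - m) * (f \<alpha> - m))) / Z"
    unfolding Var_def m_def[symmetric] unfolding nu_expectation[OF q(1) N] Z_def[symmetric] power2_eq_square ..
  also have "\<dots> \<le> 2048 * (4 / q\<^sup>2 + C)\<^sup>2 / q\<^sup>2 * (neighbours f / real L) / Z"
    using poincare_neighbours[OF L H C 0] Z unfolding neighbours_shift by (intro divide_right_mono) auto
  also have "\<dots> = 2048 * (4 / q\<^sup>2 + C)\<^sup>2 / q * Dirichlet q L H N f"
    unfolding Dirichlet_eq_neighbours[OF N] Z_def[symmetric] using q by (simp add: field_simps power2_eq_square)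
  finally show ?thesis .
qed

end

text \<open>For \<open>d = 0\<close> the bound forces \<open>v = 0\<close>, and the quotient is
  \<open>0 / 0 = 0\<close>.\<close>

lemma ereal_ratio_le:
  assumes "0 \<le> v" "0 \<le> d" "0 \<le> c" "v \<le> c * d"
  shows "ereal v / ereal d \<le> ereal c"
proof (cases "d = 0")
  case True
  then have "v = 0" using assms by simp
  then show ?thesis using True assms by (simp add: zero_ereal_def[symmetric])
next
  case False
  then show ?thesis using assms by (simp add: divide_le_eq)
qed

theorem theorem1p1:
  fixes q :: real
  assumes "0 < q" and "q < 1"
  shows "\<exists>C::real. (SUP (L, H) \<in> {(L, H). 1 \<le> L \<and> 2 \<le> H}. gamma q L H) \<le> ereal C"
proof -
  obtain e \<kappa> \<mu> where params: "0 < e" "e \<le> 1" "0 < \<kappa>" "0 \<le> \<mu>"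
    "4 * \<mu> * (1 + 2 * q\<^sup>2 / (1 - q\<^sup>2)) \<le> 3" "2 * \<mu> \<le> 1"
    "\<And>d M. 2 \<le> d \<Longrightarrow> (\<Sum>n=1..M. loss q e \<kappa> \<mu> d n) \<le> \<mu> * (decay e d)\<^sup>2"
    "\<And>M. (\<Sum>n=1..M. loss q e \<kappa> \<mu> 1 n) \<le> q\<^sup>2 / 1024"
    using radial_weights_exist[OF assms] by blast
  obtain C where C: "\<And>M. (\<Sum>d=1..M. (real d)\<^sup>2 * decay e d) \<le> C"
    using sum_square_decay_bounded[OF params(1)] by blast
  \<comment> \<open>All parameters have been fixed before \<open>L\<close>, \<open>H\<close> and
    \<open>N\<close> appear, so \<open>K\<close> depends on \<open>q\<close> alone.\<close>
  define K where "K = 2048 * (4 / q\<^sup>2 + C)\<^sup>2 / q"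
  have "gamma q L H \<le> ereal K" if LH: "1 \<le> L" "2 \<le> H" for L H
    unfolding gamma_def
  proof (intro SUP_least)
    fix N f assume "N \<in> {1..L * H div 2}"
    then have N: "N \<le> L * H" by (auto intro: order_trans)
    interpret gap_setting q L H N e \<kappa> \<mu>
      by unfold_locales (use assms params in auto)
    have Z: "0 < (\<Sum>\<alpha>\<in>A. w \<alpha>)" by (rule sum_mu_weight_pos[OF assms(1) N])
    have "0 \<le> Dirichlet q L H N f"
      unfolding Dirichlet_eq_neighbours[OF N] using neighbours_nonneg assms Z by simp
    moreover have "0 \<le> Var (nu q L H N) f"
      unfolding Var_def by simp
    moreover have "0 \<le> K" using assms by (simp add: K_def)
    ultimately show "ereal (Var (nu q L H N) f) / ereal (Dirichlet q L H N f) \<le> ereal K"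
      using Var_le_Dirichlet[OF LH N C, of f] unfolding K_def[symmetric] by (intro ereal_ratio_le)
  qed
  then show ?thesis by (intro exI[of _ K] SUP_least) auto
qed

end
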